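(* Let $G$ be a finite group. For any $s\in G$ and any irreducible representation $\rho$ of the centralizer $G^s$, there exists a bi-one arrow Nichols algebra $\mathfrak{B}(G,r,\overrightarrow{\rho},u)$ such that $$\mathfrak{B}({\mathcal O}_s,\rho)\cong \mathfrak{B}(G,r,\overrightarrow{\rho},u)$$ as graded braided Hopf algebras in the Yetter-Drinfeld category ${}^{kG}_{kG}{\mathcal{YD}}$.
   Context: $k=\mathbb{C}$; $G$ is a finite group; $G^s$ is the centralizer of $s$; ${\mathcal O}_s$ is the conjugacy class of $s$; ${\mathcal K}(G)$ is the set of conjugacy classes of $G$. Yetter-Drinfeld (YD) modules over $kG$ are left modules and left comodules. For a YD module $M$, $\mathfrak{B}(M)$ denotes its Nichols algebra. The YD module $M({\mathcal O}_s,\rho)$: let $(\rho,V)$ be an irreducible (left) representation of $G^s$, let $t_1=s,\dots,t_m$ be a numeration of ${\mathcal O}_s$ and let $g_i\in G$ satisfy $g_isg_i^{-1}=t_i$. Then $M({\mathcal O}_s,\rho)=\bigoplus_{i=1}^m g_i\otimes V$; writing $g_iv=g_i\otimes v$, the structure is $\delta(g_iv)=t_i\otimes g_iv$ and $h\cdot(g_iv)=g_j(\gamma\cdot v)$, where $hg_i=g_j\gamma$ with $\gamma\in G^s$. Put $\mathfrak{B}({\mathcal O}_s,\rho):=\mathfrak{B}(M({\mathcal O}_s,\rho))$. Arrow Nichols algebras: a ramification of $G$ is a formal sum $r=\sum_{C\in{\mathcal K}(G)}r_CC$ with cardinal number coefficients; ${\mathcal K}_r(G)=\{C: r_C\ne0\}$.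 A ramification system with irreducible representations ${\rm RSR}(G,r,\overrightarrow\rho,u)$ consists of a ramification $r$, a map $u:{\mathcal K}(G)\to G$ with $u(C)\in C$, and, for each $C\in{\mathcal K}_r(G)$, a finite nonempty index set $I_C(r,u)$ and irreducible representations $\rho_C^{(i)}$ ($i\in I_C(r,u)$) of $G^{u(C)}$, written as right actions on spaces $X_C^{(i)}$ with bases $\{x_C^{(i,j)}\mid j\in J_C(i)\}$, $|J_C(i)|=\deg\rho_C^{(i)}$, with $r_C=\sum_i\deg\rho_C^{(i)}$. Fix right coset decompositions $G=\bigcup_{\theta\in\Theta_C}G^{u(C)}g_\theta$. The arrow YD module $kQ_1^1$ of the RSR has basis $a_{x,1}^{(i,j)}$ ($x\in C\in{\mathcal K}_r(G)$, $i\in I_C(r,u)$, $j\in J_C(i)$), coaction $\delta^-(a_{x,1}^{(i,j)})=x\otimes a_{x,1}^{(i,j)}$, and action $h\rhd a_{x,1}^{(i,j)}=\sum_pk_p\,a_{hxh^{-1},1}^{(i,p)}$, where $x=g_\theta^{-1}u(C)g_\theta$, $g_\theta h^{-1}=\zeta_\theta(h^{-1})g_{\theta'}$ with $\zeta_\theta(h^{-1})\in G^{u(C)}$, and $x_C^{(i,j)}\cdot\zeta_\theta(h^{-1})=\sum_pk_px_C^{(i,p)}$. The arrow Nichols algebra $\mathfrak{B}(G,r,\overrightarrow\rho,u)$ is the Nichols algebra of this YD module. It is called bi-one if $r=r_CC$ for a single class $C$ and $|I_C(r,u)|=1$. *)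

theory Defs
  imports Complex_Main "HOL-Algebra.Algebra" "HOL-Algebra.Algebraic_Closure_Type"
begin

section \<open>Complex vector spaces\<close>

text \<open>A complex vector space is an HOL-Algebra module over the field record \<open>\<C>\<close>. The fields
  \<open>mult\<close> and \<open>one\<close> of a \<open>module\<close> record are used only when the record is an algebra, and are left
  undefined otherwise.\<close>

abbreviation complex_field :: "complex ring" (\<open>\<C>\<close>)
  where "\<C> \<equiv> ring_of_type_algebra"

definition linear_map ::
    "(complex, 'v, 'm) module_scheme \<Rightarrow> (complex, 'w, 'n) module_scheme \<Rightarrow> ('v \<Rightarrow> 'w) \<Rightarrow> bool" where
  "linear_map V W f \<longleftrightarrow>
     f \<in> carrier V \<rightarrow> carrier W \<and>
     (\<forall>x\<in>carrier V. \<forall>y\<in>carrier V. f (x \<oplus>\<^bsub>V\<^esub> y) = f x \<oplus>\<^bsub>W\<^esub> f y) \<and>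
     (\<forall>c. \<forall>x\<in>carrier V. f (c \<odot>\<^bsub>V\<^esub> x) = c \<odot>\<^bsub>W\<^esub> f x)"

definition lin_span :: "(complex, 'v, 'm) module_scheme \<Rightarrow> 'v set \<Rightarrow> 'v set" where
  "lin_span V A = \<Inter>{W. submodule W \<C> V \<and> A \<subseteq> W}"

definition is_finite_basis ::
    "(complex, 'v, 'm) module_scheme \<Rightarrow> 'j set \<Rightarrow> ('j \<Rightarrow> 'v) \<Rightarrow> bool" where
  "is_finite_basis V J b \<longleftrightarrow>
     finite J \<and> b \<in> J \<rightarrow> carrier V \<and>
     (\<forall>v\<in>carrier V. \<exists>!k. k \<in> J \<rightarrow>\<^sub>E UNIV \<and> v = (\<Oplus>\<^bsub>V\<^esub>j\<in>J. k j \<odot>\<^bsub>V\<^esub> b j))"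

definition coords ::
    "(complex, 'v, 'm) module_scheme \<Rightarrow> 'j set \<Rightarrow> ('j \<Rightarrow> 'v) \<Rightarrow> 'v \<Rightarrow> 'j \<Rightarrow> complex" where
  "coords V J b v = (THE k. k \<in> J \<rightarrow>\<^sub>E UNIV \<and> v = (\<Oplus>\<^bsub>V\<^esub>j\<in>J. k j \<odot>\<^bsub>V\<^esub> b j))"

definition free_space :: "'s set \<Rightarrow> (complex, 's \<Rightarrow> complex) module" where
  "free_space S =
     \<lparr>carrier = {f. finite {s. f s \<noteq> 0} \<and> {s. f s \<noteq> 0} \<subseteq> S},
      monoid.mult = undefined, one = undefined,
      ring.zero = (\<lambda>_. 0), add = (\<lambda>f g s. f s + g s), module.smult = (\<lambda>c f s. c * f s)\<rparr>"

definition gen :: "'s \<Rightarrow> 's \<Rightarrow> complex" where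
  "gen s = (\<lambda>t. if t = s then 1 else 0)"

text \<open>The linear extension to a free space of a map given on its basis, evaluated at \<open>f\<close>.\<close>

definition lin_ext ::
    "(complex, 'v, 'm) module_scheme \<Rightarrow> ('s \<Rightarrow> 'v) \<Rightarrow> ('s \<Rightarrow> complex) \<Rightarrow> 'v" where
  "lin_ext U \<phi> f = (\<Oplus>\<^bsub>U\<^esub>s\<in>{s. f s \<noteq> 0}. f s \<odot>\<^bsub>U\<^esub> \<phi> s)"

definition quot_space ::
    "(complex, 'v, 'm) module_scheme \<Rightarrow> 'v set \<Rightarrow> (complex, 'v set) module" where
  "quot_space V W =
     \<lparr>carrier = a_rcosets\<^bsub>V\<^esub> W,
      monoid.mult = undefined, one = undefined,
      ring.zero = W, add = (\<lambda>A B. A <+>\<^bsub>V\<^esub> B),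
      module.smult = (\<lambda>c A. \<Union>a\<in>A. W +>\<^bsub>V\<^esub> (c \<odot>\<^bsub>V\<^esub> a))\<rparr>"

definition rep :: "'v set \<Rightarrow> 'v" where
  "rep A = (SOME a. a \<in> A)"

text \<open>A linear map out of a quotient of a free space, given on the classes of the generators
  by \<open>\<phi>\<close>; it is always used with a \<open>\<phi>\<close> that respects the relations, so that the choice of
  representative does not matter.\<close>

definition lift ::
    "(complex, 'v, 'm) module_scheme \<Rightarrow> ('s \<Rightarrow> 'v) \<Rightarrow> ('s \<Rightarrow> complex) set \<Rightarrow> 'v" where
  "lift U \<phi> A = lin_ext U \<phi> (rep A)"


section \<open>Tensor products\<close>

definition bilinear_relations ::
    "(complex, 'v, 'm) module_scheme \<Rightarrow> (complex, 'w, 'n) module_scheme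
       \<Rightarrow> ('v \<times> 'w \<Rightarrow> complex) set" where
  "bilinear_relations V W =
     (let F = free_space (carrier V \<times> carrier W) in
       {gen (v \<oplus>\<^bsub>V\<^esub> v', w) \<ominus>\<^bsub>F\<^esub> (gen (v, w) \<oplus>\<^bsub>F\<^esub> gen (v', w)) | v v' w.
          v \<in> carrier V \<and> v' \<in> carrier V \<and> w \<in> carrier W} \<union>
       {gen (v, w \<oplus>\<^bsub>W\<^esub> w') \<ominus>\<^bsub>F\<^esub> (gen (v, w) \<oplus>\<^bsub>F\<^esub> gen (v, w')) | v w w'.
          v \<in> carrier V \<and> w \<in> carrier W \<and> w' \<in> carrier W} \<union>
       {gen (c \<odot>\<^bsub>V\<^esub> v, w) \<ominus>\<^bsub>F\<^esub> (c \<odot>\<^bsub>F\<^esub> gen (v, w)) | c v w.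
          v \<in> carrier V \<and> w \<in> carrier W} \<union>
       {gen (v, c \<odot>\<^bsub>W\<^esub> w) \<ominus>\<^bsub>F\<^esub> (c \<odot>\<^bsub>F\<^esub> gen (v, w)) | c v w.
          v \<in> carrier V \<and> w \<in> carrier W})"

definition bilinear_null ::
    "(complex, 'v, 'm) module_scheme \<Rightarrow> (complex, 'w, 'n) module_scheme
       \<Rightarrow> ('v \<times> 'w \<Rightarrow> complex) set" where
  "bilinear_null V W =
     lin_span (free_space (carrier V \<times> carrier W)) (bilinear_relations V W)"

definition tensor ::
    "(complex, 'v, 'm) module_scheme \<Rightarrow> (complex, 'w, 'n) module_scheme
       \<Rightarrow> (complex, ('v \<times> 'w \<Rightarrow> complex) set) module" where
  "tensor V W = quot_space (free_space (carrier V \<times> carrier W)) (bilinear_null V W)"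

definition tens ::
    "(complex, 'v, 'm) module_scheme \<Rightarrow> (complex, 'w, 'n) module_scheme
       \<Rightarrow> 'v \<Rightarrow> 'w \<Rightarrow> ('v \<times> 'w \<Rightarrow> complex) set" where
  "tens V W v w =
     bilinear_null V W +>\<^bsub>free_space (carrier V \<times> carrier W)\<^esub> gen (v, w)"

text \<open>\<open>f \<otimes> g\<close> with values in \<open>V' \<otimes> W'\<close>.\<close>

definition tensor_map ::
    "(complex, 'a, 'm) module_scheme \<Rightarrow> (complex, 'b, 'n) module_scheme
       \<Rightarrow> ('v \<Rightarrow> 'a) \<Rightarrow> ('w \<Rightarrow> 'b)
       \<Rightarrow> ('v \<times> 'w \<Rightarrow> complex) set \<Rightarrow> ('a \<times> 'b \<Rightarrow> complex) set" where
  "tensor_map V' W' f g = lift (tensor V' W') (\<lambda>(v, w). tens V' W' (f v) (g w))"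


section \<open>Yetter-Drinfeld modules and braided Hopf algebras: the data\<close>

text \<open>Since \<open>kG \<otimes> M\<close> is the direct sum of the spaces \<open>g \<otimes> M\<close>, a coaction \<open>\<delta> : M \<rightarrow> kG \<otimes> M\<close> of
  the group algebra of a finite group is stored by its components: \<open>coact M x g\<close> is the vector
  \<open>x_g\<close> in \<open>\<delta>(x) = \<Sum>_g g \<otimes> x_g\<close>.

  The braiding is \<open>c(x \<otimes> y) = \<Sum>_g (g \<cdot> y) \<otimes> x_g\<close>.\<close>

record ('g, 'v) yd_module = "(complex, 'v) module" +
  action :: "'g \<Rightarrow> 'v \<Rightarrow> 'v"
  coact :: "'v \<Rightarrow> 'g \<Rightarrow> 'v"

text \<open>\<open>hdeg H n\<close> is the homogeneous component of degree \<open>n\<close>; product and unit are the fields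
  \<open>mult\<close> and \<open>one\<close>.\<close>

record ('g, 'v) braided_hopf = "('g, 'v) yd_module" +
  comult :: "'v \<Rightarrow> ('v \<times> 'v \<Rightarrow> complex) set"
  counit :: "'v \<Rightarrow> complex"
  antipode :: "'v \<Rightarrow> 'v"
  hdeg :: "nat \<Rightarrow> 'v set"

definition graded_braided_hopf_iso ::
    "('g, 'm) monoid_scheme \<Rightarrow> ('g, 'v) braided_hopf \<Rightarrow> ('g, 'w) braided_hopf
       \<Rightarrow> ('v \<Rightarrow> 'w) \<Rightarrow> bool" where
  "graded_braided_hopf_iso G A B \<phi> \<longleftrightarrow>
     linear_map A B \<phi> \<and> bij_betw \<phi> (carrier A) (carrier B) \<and>
     (\<forall>h\<in>carrier G. \<forall>x\<in>carrier A. \<phi> (action A h x) = action B h (\<phi> x)) \<and>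
     (\<forall>h\<in>carrier G. \<forall>x\<in>carrier A. \<phi> (coact A x h) = coact B (\<phi> x) h) \<and>
     (\<forall>x\<in>carrier A. \<forall>y\<in>carrier A. \<phi> (x \<otimes>\<^bsub>A\<^esub> y) = \<phi> x \<otimes>\<^bsub>B\<^esub> \<phi> y) \<and>
     \<phi> \<one>\<^bsub>A\<^esub> = \<one>\<^bsub>B\<^esub> \<and>
     (\<forall>x\<in>carrier A. tensor_map B B \<phi> \<phi> (comult A x) = comult B (\<phi> x)) \<and>
     (\<forall>x\<in>carrier A. counit A x = counit B (\<phi> x)) \<and>
     (\<forall>x\<in>carrier A. \<phi> (antipode A x) = antipode B (\<phi> x)) \<and>
     (\<forall>n. \<phi> ` hdeg A n = hdeg B n)"

definition graded_braided_hopf_isomorphic ::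
    "('g, 'm) monoid_scheme \<Rightarrow> ('g, 'v) braided_hopf \<Rightarrow> ('g, 'w) braided_hopf \<Rightarrow> bool" where
  "graded_braided_hopf_isomorphic G A B \<longleftrightarrow> (\<exists>\<phi>. graded_braided_hopf_iso G A B \<phi>)"


section \<open>The tensor algebra of a Yetter-Drinfeld module\<close>

text \<open>\<open>T(M)\<close> is the free space on words in \<open>M\<close> modulo multilinearity in each letter, so that
  words of length \<open>n\<close> span the \<open>n\<close>-th tensor power of \<open>M\<close>.\<close>

definition multilinear_relations ::
    "(complex, 'v, 'm) module_scheme \<Rightarrow> ('v list \<Rightarrow> complex) set" where
  "multilinear_relations M =
     (let F = free_space (lists (carrier M)) in
       {gen (xs @ [a \<oplus>\<^bsub>M\<^esub> b] @ ys) \<ominus>\<^bsub>F\<^esub> (gen (xs @ [a] @ ys) \<oplus>\<^bsub>F\<^esub> gen (xs @ [b] @ ys))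
          | xs a b ys. xs \<in> lists (carrier M) \<and> a \<in> carrier M \<and> b \<in> carrier M
                       \<and> ys \<in> lists (carrier M)} \<union>
       {gen (xs @ [c \<odot>\<^bsub>M\<^esub> a] @ ys) \<ominus>\<^bsub>F\<^esub> (c \<odot>\<^bsub>F\<^esub> gen (xs @ [a] @ ys))
          | xs c a ys. xs \<in> lists (carrier M) \<and> a \<in> carrier M \<and> ys \<in> lists (carrier M)})"

definition multilinear_null ::
    "(complex, 'v, 'm) module_scheme \<Rightarrow> ('v list \<Rightarrow> complex) set" where
  "multilinear_null M =
     lin_span (free_space (lists (carrier M))) (multilinear_relations M)"

definition tensor_space ::
    "(complex, 'v, 'm) module_scheme \<Rightarrow> (complex, ('v list \<Rightarrow> complex) set) module" where
  "tensor_space M = quot_space (free_space (lists (carrier M))) (multilinear_null M)"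

definition word ::
    "(complex, 'v, 'm) module_scheme \<Rightarrow> 'v list \<Rightarrow> ('v list \<Rightarrow> complex) set" where
  "word M w = multilinear_null M +>\<^bsub>free_space (lists (carrier M))\<^esub> gen w"

definition tensor_mult ::
    "(complex, 'v, 'm) module_scheme \<Rightarrow> ('v list \<Rightarrow> complex) set \<Rightarrow> ('v list \<Rightarrow> complex) set
       \<Rightarrow> ('v list \<Rightarrow> complex) set" where
  "tensor_mult M A B =
     lift (tensor_space M) (\<lambda>v. lift (tensor_space M) (\<lambda>w. word M (v @ w)) B) A"

text \<open>The codiagonal coaction: the component at \<open>h\<close> of \<open>\<delta>(x\<^sub>1 \<cdots> x\<^sub>n)\<close> is the sum of all
  \<open>(x\<^sub>1)_{g\<^sub>1} \<cdots> (x\<^sub>n)_{g\<^sub>n}\<close> with \<open>g\<^sub>1 \<cdots> g\<^sub>n = h\<close>.\<close>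

primrec word_coact ::
    "('g, 'm) monoid_scheme \<Rightarrow> ('g, 'v) yd_module \<Rightarrow> 'v list \<Rightarrow> 'g
       \<Rightarrow> ('v list \<Rightarrow> complex) set" where
  "word_coact G M [] h = (if h = \<one>\<^bsub>G\<^esub> then word M [] else \<zero>\<^bsub>tensor_space M\<^esub>)"
| "word_coact G M (x # w) h =
     (\<Oplus>\<^bsub>tensor_space M\<^esub>g\<in>carrier G.
        tensor_mult M (word M [coact M x g]) (word_coact G M w (inv\<^bsub>G\<^esub> g \<otimes>\<^bsub>G\<^esub> h)))"

definition tensor_algebra ::
    "('g, 'm) monoid_scheme \<Rightarrow> ('g, 'v) yd_module
       \<Rightarrow> ('g, ('v list \<Rightarrow> complex) set) yd_module" where
  "tensor_algebra G M =
     \<lparr>carrier = carrier (tensor_space M),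
      monoid.mult = tensor_mult M, one = word M [],
      ring.zero = \<zero>\<^bsub>tensor_space M\<^esub>, add = add (tensor_space M),
      module.smult = module.smult (tensor_space M),
      action = (\<lambda>g. lift (tensor_space M) (\<lambda>w. word M (map (action M g) w))),
      coact = (\<lambda>A h. lift (tensor_space M) (\<lambda>w. word_coact G M w h) A)\<rparr>"

text \<open>The product of the braided tensor product algebra \<open>A \<otimes> A\<close>:
  \<open>(a \<otimes> b)(c \<otimes> d) = \<Sum>_g a(g \<cdot> c) \<otimes> b_g d\<close>.\<close>

definition braided_mult ::
    "('g, 'm) monoid_scheme \<Rightarrow> ('g, 'v) yd_module
       \<Rightarrow> ('v \<times> 'v \<Rightarrow> complex) set \<Rightarrow> ('v \<times> 'v \<Rightarrow> complex) set \<Rightarrow> ('v \<times> 'v \<Rightarrow> complex) set" where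
  "braided_mult G A P Q =
     lift (tensor A A)
       (\<lambda>(a, b). lift (tensor A A)
          (\<lambda>(c, d). \<Oplus>\<^bsub>tensor A A\<^esub>g\<in>carrier G.
             tens A A (a \<otimes>\<^bsub>A\<^esub> action A g c) (coact A b g \<otimes>\<^bsub>A\<^esub> d)) Q) P"

text \<open>The comultiplication of \<open>T(M)\<close> is the algebra map into the braided tensor product with
  \<open>\<Delta>(x) = x \<otimes> 1 + 1 \<otimes> x\<close> for \<open>x\<close> in \<open>M\<close>.\<close>

primrec word_comult ::
    "('g, 'm) monoid_scheme \<Rightarrow> ('g, 'v) yd_module \<Rightarrow> 'v list
       \<Rightarrow> (('v list \<Rightarrow> complex) set \<times> ('v list \<Rightarrow> complex) set \<Rightarrow> complex) set" where
  "word_comult G M [] =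
     tens (tensor_algebra G M) (tensor_algebra G M) (word M []) (word M [])"
| "word_comult G M (x # w) =
     (let T = tensor_algebra G M in
       braided_mult G T
         (tens T T (word M [x]) (word M []) \<oplus>\<^bsub>tensor T T\<^esub> tens T T (word M []) (word M [x]))
         (word_comult G M w))"

text \<open>The antipode of \<open>T(M)\<close> is determined by \<open>S(x) = - x\<close> for \<open>x\<close> in \<open>M\<close> and braided
  anti-multiplicativity, \<open>S(x y) = \<Sum>_g S(g \<cdot> y) S(x_g) = \<Sum>_g (g \<cdot> S(y)) S(x_g)\<close>.\<close>

primrec word_antipode ::
    "('g, 'm) monoid_scheme \<Rightarrow> ('g, 'v) yd_module \<Rightarrow> 'v list \<Rightarrow> ('v list \<Rightarrow> complex) set" where
  "word_antipode G M [] = word M []"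
| "word_antipode G M (x # w) =
     (let T = tensor_algebra G M in
       \<ominus>\<^bsub>T\<^esub> (\<Oplus>\<^bsub>T\<^esub>g\<in>carrier G.
              action T g (word_antipode G M w) \<otimes>\<^bsub>T\<^esub> word M [coact M x g]))"

text \<open>The counit is the coefficient of the empty word, which does not depend on the representative:
  the multilinear relations involve only nonempty words.\<close>

definition tensor_hopf ::
    "('g, 'm) monoid_scheme \<Rightarrow> ('g, 'v) yd_module
       \<Rightarrow> ('g, ('v list \<Rightarrow> complex) set) braided_hopf" where
  "tensor_hopf G M =
     (let T = tensor_algebra G M in
       \<lparr>carrier = carrier T, monoid.mult = monoid.mult T, one = one T,
        ring.zero = ring.zero T, add = add T, module.smult = module.smult T,
        action = action T, coact = coact T,
        comult = lift (tensor T T) (word_comult G M),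
        counit = (\<lambda>A. rep A []),
        antipode = lift T (word_antipode G M),
        hdeg = (\<lambda>n. lin_span T {word M w | w. w \<in> lists (carrier M) \<and> length w = n})\<rparr>)"


section \<open>Nichols algebras\<close>

definition quot_hopf ::
    "('g, 'v) braided_hopf \<Rightarrow> 'v set \<Rightarrow> ('g, 'v set) braided_hopf" where
  "quot_hopf H I =
     (let Q = quot_space H I; \<pi> = (\<lambda>a. I +>\<^bsub>H\<^esub> a) in
       \<lparr>carrier = carrier Q,
        monoid.mult = (\<lambda>A B. \<pi> (rep A \<otimes>\<^bsub>H\<^esub> rep B)), one = \<pi> \<one>\<^bsub>H\<^esub>,
        ring.zero = \<zero>\<^bsub>Q\<^esub>, add = add Q, module.smult = module.smult Q,
        action = (\<lambda>g A. \<pi> (action H g (rep A))),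
        coact = (\<lambda>A g. \<pi> (coact H (rep A) g)),
        comult = (\<lambda>A. tensor_map Q Q \<pi> \<pi> (comult H (rep A))),
        counit = (\<lambda>A. counit H (rep A)),
        antipode = (\<lambda>A. \<pi> (antipode H (rep A))),
        hdeg = (\<lambda>n. \<pi> ` hdeg H n)\<rparr>)"

text \<open>The ideals of \<open>T(M)\<close> that are generated by homogeneous elements of degree at least 2, are
  coideals (\<open>\<Delta>(I) \<subseteq> I \<otimes> T(M) + T(M) \<otimes> I\<close>), and are Yetter-Drinfeld submodules. The Nichols
  algebra is the quotient of \<open>T(M)\<close> by the sum of all of them.\<close>

definition nichols_ideals ::
    "('g, 'm) monoid_scheme \<Rightarrow> ('g, 'v) yd_module \<Rightarrow> ('v list \<Rightarrow> complex) set set set" where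
  "nichols_ideals G M =
     (let T = tensor_hopf G M in
       {I. ideal I T \<and>
           (\<exists>A. A \<subseteq> (\<Union>n\<in>{2..}. hdeg T n) \<and> I = Idl\<^bsub>T\<^esub> A) \<and>
           (\<forall>x\<in>I. comult T x \<in> lin_span (tensor T T)
              {tens T T a b | a b. a \<in> carrier T \<and> b \<in> carrier T \<and> (a \<in> I \<or> b \<in> I)}) \<and>
           submodule I \<C> T \<and>
           (\<forall>g\<in>carrier G. \<forall>x\<in>I. action T g x \<in> I \<and> coact T x g \<in> I)})"

definition nichols_algebra ::
    "('g, 'm) monoid_scheme \<Rightarrow> ('g, 'v) yd_module
       \<Rightarrow> ('g, ('v list \<Rightarrow> complex) set set) braided_hopf" where
  "nichols_algebra G M =
     (let T = tensor_hopf G M in quot_hopf T (lin_span T (\<Union>(nichols_ideals G M))))"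


section \<open>Centralizers, conjugacy classes, representations\<close>

definition centralizer :: "('g, 'm) monoid_scheme \<Rightarrow> 'g \<Rightarrow> 'g set" where
  "centralizer G s = {g \<in> carrier G. g \<otimes>\<^bsub>G\<^esub> s = s \<otimes>\<^bsub>G\<^esub> g}"

definition conj_class :: "('g, 'm) monoid_scheme \<Rightarrow> 'g \<Rightarrow> 'g set" where
  "conj_class G s = {g \<otimes>\<^bsub>G\<^esub> s \<otimes>\<^bsub>G\<^esub> inv\<^bsub>G\<^esub> g | g. g \<in> carrier G}"

definition conj_classes :: "('g, 'm) monoid_scheme \<Rightarrow> 'g set set" where
  "conj_classes G = conj_class G ` carrier G"

definition irreducible_left_rep ::
    "('g, 'm) monoid_scheme \<Rightarrow> 'g set \<Rightarrow> (complex, 'v) module \<Rightarrow> ('g \<Rightarrow> 'v \<Rightarrow> 'v) \<Rightarrow> bool" where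
  "irreducible_left_rep G H V \<rho> \<longleftrightarrow>
     module \<C> V \<and>
     (\<forall>h\<in>H. linear_map V V (\<rho> h)) \<and>
     (\<forall>v\<in>carrier V. \<rho> \<one>\<^bsub>G\<^esub> v = v) \<and>
     (\<forall>h\<in>H. \<forall>h'\<in>H. \<forall>v\<in>carrier V. \<rho> (h \<otimes>\<^bsub>G\<^esub> h') v = \<rho> h (\<rho> h' v)) \<and>
     carrier V \<noteq> {\<zero>\<^bsub>V\<^esub>} \<and>
     (\<forall>W. submodule W \<C> V \<and> (\<forall>h\<in>H. \<forall>w\<in>W. \<rho> h w \<in> W) \<longrightarrow> W = {\<zero>\<^bsub>V\<^esub>} \<or> W = carrier V)"

text \<open>Right actions are written \<open>\<rho> x h = x \<cdot> h\<close>.\<close>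

definition irreducible_right_rep ::
    "('g, 'm) monoid_scheme \<Rightarrow> 'g set \<Rightarrow> (complex, 'v) module \<Rightarrow> ('v \<Rightarrow> 'g \<Rightarrow> 'v) \<Rightarrow> bool" where
  "irreducible_right_rep G H U \<rho> \<longleftrightarrow>
     module \<C> U \<and>
     (\<forall>h\<in>H. linear_map U U (\<lambda>x. \<rho> x h)) \<and>
     (\<forall>x\<in>carrier U. \<rho> x \<one>\<^bsub>G\<^esub> = x) \<and>
     (\<forall>h\<in>H. \<forall>h'\<in>H. \<forall>x\<in>carrier U. \<rho> x (h \<otimes>\<^bsub>G\<^esub> h') = \<rho> (\<rho> x h) h') \<and>
     carrier U \<noteq> {\<zero>\<^bsub>U\<^esub>} \<and>
     (\<forall>W. submodule W \<C> U \<and> (\<forall>h\<in>H. \<forall>w\<in>W. \<rho> w h \<in> W) \<longrightarrow> W = {\<zero>\<^bsub>U\<^esub>} \<or> W = carrier U)"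


section \<open>The Yetter-Drinfeld module of a class and a representation\<close>

text \<open>\<open>t 1 = s, \<dots>, t m\<close> numerates the class of \<open>s\<close>, and \<open>g i\<close> conjugates \<open>s\<close> to \<open>t i\<close>.\<close>

definition class_numeration ::
    "('g, 'm) monoid_scheme \<Rightarrow> 'g \<Rightarrow> nat \<Rightarrow> (nat \<Rightarrow> 'g) \<Rightarrow> (nat \<Rightarrow> 'g) \<Rightarrow> bool" where
  "class_numeration G s m t g \<longleftrightarrow>
     bij_betw t {1..m} (conj_class G s) \<and> t 1 = s \<and>
     (\<forall>i\<in>{1..m}. g i \<in> carrier G \<and> g i \<otimes>\<^bsub>G\<^esub> s \<otimes>\<^bsub>G\<^esub> inv\<^bsub>G\<^esub> (g i) = t i)"

text \<open>Elements of the direct sum of the \<open>g i \<otimes> V\<close> are families \<open>f\<close> indexed by \<open>{1..m}\<close>, the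
  family \<open>f\<close> standing for the sum of the \<open>g i \<otimes> f i\<close>.\<close>

definition class_sum_space ::
    "(complex, 'v) module \<Rightarrow> nat \<Rightarrow> (complex, nat \<Rightarrow> 'v) module" where
  "class_sum_space V m =
     \<lparr>carrier = {1..m} \<rightarrow>\<^sub>E carrier V,
      monoid.mult = undefined, one = undefined,
      ring.zero = (\<lambda>i\<in>{1..m}. \<zero>\<^bsub>V\<^esub>),
      add = (\<lambda>f f'. \<lambda>i\<in>{1..m}. f i \<oplus>\<^bsub>V\<^esub> f' i),
      module.smult = (\<lambda>c f. \<lambda>i\<in>{1..m}. c \<odot>\<^bsub>V\<^esub> f i)\<rparr>"

definition class_elt :: "(complex, 'v) module \<Rightarrow> nat \<Rightarrow> nat \<Rightarrow> 'v \<Rightarrow> nat \<Rightarrow> 'v" where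
  "class_elt V m i v = (\<lambda>j\<in>{1..m}. if j = i then v else \<zero>\<^bsub>V\<^esub>)"

text \<open>In the action, \<open>h \<cdot> g\<^sub>i v = g\<^sub>j (\<gamma> \<cdot> v)\<close> where \<open>h g\<^sub>i = g\<^sub>j \<gamma>\<close> with \<open>\<gamma>\<close> in the centralizer
  of \<open>s\<close>, extended additively.\<close>

definition class_yd_module ::
    "('g, 'm) monoid_scheme \<Rightarrow> (complex, 'v) module \<Rightarrow> ('g \<Rightarrow> 'v \<Rightarrow> 'v) \<Rightarrow> 'g
       \<Rightarrow> nat \<Rightarrow> (nat \<Rightarrow> 'g) \<Rightarrow> (nat \<Rightarrow> 'g) \<Rightarrow> ('g, nat \<Rightarrow> 'v) yd_module" where
  "class_yd_module G V \<rho> s m t g =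
     (let S = class_sum_space V m in
       \<lparr>carrier = carrier S, monoid.mult = undefined, one = undefined,
        ring.zero = \<zero>\<^bsub>S\<^esub>, add = add S, module.smult = module.smult S,
        action = (\<lambda>h f. \<Oplus>\<^bsub>S\<^esub>i\<in>{1..m}.
          (THE y. \<exists>j\<in>{1..m}. \<exists>\<gamma>\<in>centralizer G s.
             h \<otimes>\<^bsub>G\<^esub> g i = g j \<otimes>\<^bsub>G\<^esub> \<gamma> \<and> y = class_elt V m j (\<rho> \<gamma> (f i)))),
        coact = (\<lambda>f x. \<lambda>i\<in>{1..m}. if t i = x then f i else \<zero>\<^bsub>V\<^esub>)\<rparr>)"


section \<open>Ramification systems and arrow Yetter-Drinfeld modules\<close>

text \<open>Ramification coefficients are natural numbers: irreducible complex representations of a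
  finite group are finite-dimensional and the index sets are finite, so the condition
  \<open>r\<^sub>C = \<Sum>\<^sub>i deg \<rho>\<^sub>C\<^sup>(i)\<close> excludes infinite cardinals. Only the values of the fields at conjugacy
  classes (for \<open>rep_index\<close> and the later fields, at classes with nonzero coefficient) matter.\<close>

record ('g, 'i, 'j, 'x) rsr =
  ramif :: "'g set \<Rightarrow> nat"
  class_rep :: "'g set \<Rightarrow> 'g"
  rep_index :: "'g set \<Rightarrow> 'i set"
  rep_space :: "'g set \<Rightarrow> 'i \<Rightarrow> (complex, 'x) module"
  rep_act :: "'g set \<Rightarrow> 'i \<Rightarrow> 'x \<Rightarrow> 'g \<Rightarrow> 'x"
  basis_index :: "'g set \<Rightarrow> 'i \<Rightarrow> 'j set"
  basis_vec :: "'g set \<Rightarrow> 'i \<Rightarrow> 'j \<Rightarrow> 'x"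

definition ramif_classes ::
    "('g, 'm) monoid_scheme \<Rightarrow> ('g, 'i, 'j, 'x) rsr \<Rightarrow> 'g set set" where
  "ramif_classes G R = {C \<in> conj_classes G. ramif R C \<noteq> 0}"

definition is_rsr :: "('g, 'm) monoid_scheme \<Rightarrow> ('g, 'i, 'j, 'x) rsr \<Rightarrow> bool" where
  "is_rsr G R \<longleftrightarrow>
     (\<forall>C\<in>conj_classes G. class_rep R C \<in> C) \<and>
     (\<forall>C\<in>ramif_classes G R.
        finite (rep_index R C) \<and> rep_index R C \<noteq> {} \<and>
        (\<forall>i\<in>rep_index R C.
           irreducible_right_rep G (centralizer G (class_rep R C)) (rep_space R C i) (rep_act R C i) \<and>
           is_finite_basis (rep_space R C i) (basis_index R C i) (basis_vec R C i)) \<and>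
        ramif R C = (\<Sum>i\<in>rep_index R C. card (basis_index R C i)))"

definition bi_one :: "('g, 'm) monoid_scheme \<Rightarrow> ('g, 'i, 'j, 'x) rsr \<Rightarrow> bool" where
  "bi_one G R \<longleftrightarrow> (\<exists>C. ramif_classes G R = {C} \<and> card (rep_index R C) = 1)"

text \<open>Decompositions of \<open>G\<close> into right cosets of the centralizer of \<open>u(C)\<close>, for every class \<open>C\<close>.\<close>

definition coset_decompositions ::
    "('g, 'm) monoid_scheme \<Rightarrow> ('g, 'i, 'j, 'x) rsr
       \<Rightarrow> ('g set \<Rightarrow> 't set) \<Rightarrow> ('g set \<Rightarrow> 't \<Rightarrow> 'g) \<Rightarrow> bool" where
  "coset_decompositions G R \<Theta> c \<longleftrightarrow>
     (\<forall>C\<in>conj_classes G.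
        c C \<in> \<Theta> C \<rightarrow> carrier G \<and>
        bij_betw (\<lambda>\<theta>. centralizer G (class_rep R C) #>\<^bsub>G\<^esub> c C \<theta>) (\<Theta> C)
          (rcosets\<^bsub>G\<^esub> (centralizer G (class_rep R C))))"

definition arrow_basis ::
    "('g, 'm) monoid_scheme \<Rightarrow> ('g, 'i, 'j, 'x) rsr \<Rightarrow> ('g \<times> 'i \<times> 'j) set" where
  "arrow_basis G R =
     {(x, i, j) | x i j C.
        C \<in> ramif_classes G R \<and> x \<in> C \<and> i \<in> rep_index R C \<and> j \<in> basis_index R C i}"

text \<open>\<open>h \<rhd> a\<^sub>x\<^sup>(i,j)\<close>, where \<open>gen (x, i, j)\<close> is the basis vector \<open>a\<^sub>x\<^sup>(i,j)\<close>.\<close>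

definition arrow_basis_action ::
    "('g, 'm) monoid_scheme \<Rightarrow> ('g, 'i, 'j, 'x) rsr
       \<Rightarrow> ('g set \<Rightarrow> 't set) \<Rightarrow> ('g set \<Rightarrow> 't \<Rightarrow> 'g) \<Rightarrow> 'g \<Rightarrow> 'g \<times> 'i \<times> 'j
       \<Rightarrow> ('g \<times> 'i \<times> 'j \<Rightarrow> complex)" where
  "arrow_basis_action G R \<Theta> c h = (\<lambda>(x, i, j).
     let F = free_space (arrow_basis G R);
         C = conj_class G x;
         \<theta> = (THE \<theta>. \<theta> \<in> \<Theta> C \<and> x = inv\<^bsub>G\<^esub> (c C \<theta>) \<otimes>\<^bsub>G\<^esub> class_rep R C \<otimes>\<^bsub>G\<^esub> c C \<theta>);
         \<zeta> = (THE \<zeta>. \<zeta> \<in> centralizer G (class_rep R C) \<and>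
                 (\<exists>\<theta>'\<in>\<Theta> C. c C \<theta> \<otimes>\<^bsub>G\<^esub> inv\<^bsub>G\<^esub> h = \<zeta> \<otimes>\<^bsub>G\<^esub> c C \<theta>'));
         k = coords (rep_space R C i) (basis_index R C i) (basis_vec R C i)
               (rep_act R C i (basis_vec R C i j) \<zeta>)
     in \<Oplus>\<^bsub>F\<^esub>p\<in>basis_index R C i. k p \<odot>\<^bsub>F\<^esub> gen (h \<otimes>\<^bsub>G\<^esub> x \<otimes>\<^bsub>G\<^esub> inv\<^bsub>G\<^esub> h, i, p))"

definition arrow_yd_module ::
    "('g, 'm) monoid_scheme \<Rightarrow> ('g, 'i, 'j, 'x) rsr
       \<Rightarrow> ('g set \<Rightarrow> 't set) \<Rightarrow> ('g set \<Rightarrow> 't \<Rightarrow> 'g)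
       \<Rightarrow> ('g, 'g \<times> 'i \<times> 'j \<Rightarrow> complex) yd_module" where
  "arrow_yd_module G R \<Theta> c =
     (let F = free_space (arrow_basis G R) in
       \<lparr>carrier = carrier F, monoid.mult = undefined, one = undefined,
        ring.zero = \<zero>\<^bsub>F\<^esub>, add = add F, module.smult = module.smult F,
        action = (\<lambda>h. lin_ext F (arrow_basis_action G R \<Theta> c h)),
        coact = (\<lambda>f g. lin_ext F (\<lambda>(x, i, j). if x = g then gen (x, i, j) else \<zero>\<^bsub>F\<^esub>) f)\<rparr>)"

definition class_nichols_algebra ::
    "('g, 'm) monoid_scheme \<Rightarrow> (complex, 'v) module \<Rightarrow> ('g \<Rightarrow> 'v \<Rightarrow> 'v) \<Rightarrow> 'g
       \<Rightarrow> nat \<Rightarrow> (nat \<Rightarrow> 'g) \<Rightarrow> (nat \<Rightarrow> 'g)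
       \<Rightarrow> ('g, ((nat \<Rightarrow> 'v) list \<Rightarrow> complex) set set) braided_hopf" where
  "class_nichols_algebra G V \<rho> s m t g = nichols_algebra G (class_yd_module G V \<rho> s m t g)"

definition arrow_nichols_algebra ::
    "('g, 'm) monoid_scheme \<Rightarrow> ('g, 'i, 'j, 'x) rsr
       \<Rightarrow> ('g set \<Rightarrow> 't set) \<Rightarrow> ('g set \<Rightarrow> 't \<Rightarrow> 'g)
       \<Rightarrow> ('g, (('g \<times> 'i \<times> 'j \<Rightarrow> complex) list \<Rightarrow> complex) set set) braided_hopf" where
  "arrow_nichols_algebra G R \<Theta> c = nichols_algebra G (arrow_yd_module G R \<Theta> c)"

end

theory Submission
  imports Defs
begin

text \<open>
  The Nichols algebra depends on the Yetter-Drinfeld module only up to isomorphism, and both modules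
  in question are induced from \<open>\<rho>\<close>. With \<open>u(\<O>\<^sub>s) = s\<close>, the right action \<open>x \<cdot> h = \<rho>(h\<^sup>-\<^sup>1) x\<close> and coset
  representatives \<open>d\<^sub>x\<close> such that \<open>x = d\<^sub>x\<^sup>-\<^sup>1 s d\<^sub>x\<close>, the map \<open>a\<^sub>x\<^sup>(\<^sup>j\<^sup>) \<mapsto> g\<^sub>i (\<rho>(d\<^sub>x g\<^sub>i)\<^sup>-\<^sup>1 b\<^sub>j)\<close>, where
  \<open>x = t\<^sub>i\<close>, is an isomorphism from the arrow module.

  Since the quotient structures are evaluated on arbitrary representatives, the sum of the Nichols
  ideals must be known to be compatible with all structure maps. The only compatibility that is not
  immediate is that the antipode \<open>S\<close> preserves a Nichols ideal \<open>I\<close>. In the convolution algebra of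
  linear endomorphisms of the tensor algebra, \<open>S * id = \<eta>\<epsilon>\<close> and \<open>S * \<eta>\<epsilon> = S\<close>, hence
  \<open>S = \<eta>\<epsilon> - S * (id - \<eta>\<epsilon>)\<close>. Starting from \<open>S\<^sub>0 = 0\<close>, the iterates
  \<open>S\<^sub>k\<^sub>+\<^sub>1 = \<eta>\<epsilon> - S\<^sub>k * (id - \<eta>\<epsilon>)\<close> all preserve \<open>I\<close>, because \<open>I\<close> is a coideal on which \<open>\<epsilon>\<close> vanishes,
  and \<open>S\<^sub>k\<close> agrees with \<open>S\<close> in degrees below \<open>k\<close>.
\<close>

section \<open>Complex vector spaces and linear maps\<close>

text \<open>The antipode is the hard compatibility because it is only braided anti-multiplicative,
  and the generators of a Nichols ideal are arbitrary homogeneous elements on which \<open>S\<close>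
  has no simple value. The iterates are built from multiplication, comultiplication and counit
  alone, and these treat an ideal in a controlled way.

  The work is split asymmetrically. A linear action and coaction (\<open>linear_yd\<close>) suffice
  to build the tensor algebra and its functoriality; the action laws and the Yetter-Drinfeld
  condition (\<open>yd\<close>) enter with the convolution identities. They are verified for the
  class module, and the isomorphism carries the resulting congruence over to the arrow module.

  The isomorphism originates in the module induced from \<open>V\<close>, taken over the
  centralizer. Both \<open>inv (d x)\<close> and \<open>g_i\<close> conjugate \<open>s\<close> to
  \<open>x = t_i\<close>, so \<open>a_x^(j)\<close> should be
  \<open>inv (d x) \<otimes> b_j\<close>; writing \<open>inv (d x) = g_i z\<close> with
  \<open>z\<close> in the centralizer turns this into
  \<open>g_i \<otimes> \<rho>(z) b_j\<close>.\<close>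

lemma complex_field_simps [simp]:
  "carrier \<C> = UNIV" "add \<C> = (+)" "monoid.mult \<C> = (*)" "\<one>\<^bsub>\<C>\<^esub> = 1" "\<zero>\<^bsub>\<C>\<^esub> = 0"
  by (auto simp: ring_of_type_algebra_def fun_eq_iff)

abbreviation cvs :: "(complex, 'v, 'm) module_scheme \<Rightarrow> bool"
  where "cvs V \<equiv> module \<C> V"

lemma cvs_abelian_group: "cvs V \<Longrightarrow> abelian_group V"
  by (simp add: module_def)

section \<open>Vector space arithmetic, finite sums and linear spans\<close>

context
  fixes V :: "(complex, 'v, 'm) module_scheme"
  assumes V: "cvs V"
begin

interpretation module \<C> V by (rule V)

lemma cvs_add_closed [simp]: "x \<in> carrier V \<Longrightarrow> y \<in> carrier V \<Longrightarrow> x \<oplus>\<^bsub>V\<^esub> y \<in> carrier V"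
  by simp

lemma cvs_zero_closed [simp]: "\<zero>\<^bsub>V\<^esub> \<in> carrier V"
  by simp

lemma cvs_smult_closed [simp]: "x \<in> carrier V \<Longrightarrow> c \<odot>\<^bsub>V\<^esub> x \<in> carrier V"
  by simp

lemma cvs_minus_closed [simp]: "x \<in> carrier V \<Longrightarrow> \<ominus>\<^bsub>V\<^esub> x \<in> carrier V"
  by simp

lemma cvs_diff_closed [simp]: "x \<in> carrier V \<Longrightarrow> y \<in> carrier V \<Longrightarrow> x \<ominus>\<^bsub>V\<^esub> y \<in> carrier V"
  by simp

lemma cvs_add_zero [simp]: "x \<in> carrier V \<Longrightarrow> x \<oplus>\<^bsub>V\<^esub> \<zero>\<^bsub>V\<^esub> = x" "x \<in> carrier V \<Longrightarrow> \<zero>\<^bsub>V\<^esub> \<oplus>\<^bsub>V\<^esub> x = x"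
  by simp_all

lemma cvs_smult_simps [simp]:
  "x \<in> carrier V \<Longrightarrow> 1 \<odot>\<^bsub>V\<^esub> x = x"
  "x \<in> carrier V \<Longrightarrow> 0 \<odot>\<^bsub>V\<^esub> x = \<zero>\<^bsub>V\<^esub>"
  "c \<odot>\<^bsub>V\<^esub> \<zero>\<^bsub>V\<^esub> = \<zero>\<^bsub>V\<^esub>"
  using smult_one smult_l_null smult_r_null by auto

lemma cvs_smult_smult: "x \<in> carrier V \<Longrightarrow> c \<odot>\<^bsub>V\<^esub> (d \<odot>\<^bsub>V\<^esub> x) = (c * d) \<odot>\<^bsub>V\<^esub> x"
  using smult_assoc1 by simp

lemma cvs_smult_add:
  "x \<in> carrier V \<Longrightarrow> y \<in> carrier V \<Longrightarrow> c \<odot>\<^bsub>V\<^esub> (x \<oplus>\<^bsub>V\<^esub> y) = c \<odot>\<^bsub>V\<^esub> x \<oplus>\<^bsub>V\<^esub> c \<odot>\<^bsub>V\<^esub> y"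
  using smult_r_distr by simp

lemma cvs_add_smult: "x \<in> carrier V \<Longrightarrow> (c + d) \<odot>\<^bsub>V\<^esub> x = c \<odot>\<^bsub>V\<^esub> x \<oplus>\<^bsub>V\<^esub> d \<odot>\<^bsub>V\<^esub> x"
  using smult_l_distr by simp

lemma cvs_add_ac:
  "x \<in> carrier V \<Longrightarrow> y \<in> carrier V \<Longrightarrow> x \<oplus>\<^bsub>V\<^esub> y = y \<oplus>\<^bsub>V\<^esub> x"
  "x \<in> carrier V \<Longrightarrow> y \<in> carrier V \<Longrightarrow> z \<in> carrier V \<Longrightarrow> (x \<oplus>\<^bsub>V\<^esub> y) \<oplus>\<^bsub>V\<^esub> z = x \<oplus>\<^bsub>V\<^esub> (y \<oplus>\<^bsub>V\<^esub> z)"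
  "x \<in> carrier V \<Longrightarrow> y \<in> carrier V \<Longrightarrow> z \<in> carrier V \<Longrightarrow> x \<oplus>\<^bsub>V\<^esub> (y \<oplus>\<^bsub>V\<^esub> z) = y \<oplus>\<^bsub>V\<^esub> (x \<oplus>\<^bsub>V\<^esub> z)"
  by (simp_all add: M.add.m_ac)

text \<open>Negation becomes a scaling, so that differences are normalised by the laws of addition
  and scaling, and closure under negation is a case of closure under scaling.\<close>

lemma cvs_minus: "x \<in> carrier V \<Longrightarrow> \<ominus>\<^bsub>V\<^esub> x = (-1) \<odot>\<^bsub>V\<^esub> x"
proof -
  assume x: "x \<in> carrier V"
  have "(-1) \<odot>\<^bsub>V\<^esub> x \<oplus>\<^bsub>V\<^esub> x = \<zero>\<^bsub>V\<^esub>"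
    using smult_l_distr[of "-1" 1 x] x by simp
  then show ?thesis using x by (metis M.minus_equality cvs_smult_closed)
qed

lemma cvs_diff: "x \<in> carrier V \<Longrightarrow> y \<in> carrier V \<Longrightarrow> x \<ominus>\<^bsub>V\<^esub> y = x \<oplus>\<^bsub>V\<^esub> (-1) \<odot>\<^bsub>V\<^esub> y"
  by (simp add: a_minus_def cvs_minus)

lemma cvs_diff_eq_zero [simp]:
  "x \<in> carrier V \<Longrightarrow> y \<in> carrier V \<Longrightarrow> x \<ominus>\<^bsub>V\<^esub> y = \<zero>\<^bsub>V\<^esub> \<longleftrightarrow> x = y"
  by (metis M.minus_equality M.minus_minus M.r_neg a_minus_def cvs_minus_closed)

lemma cvs_diff_zero [simp]: "x \<in> carrier V \<Longrightarrow> x \<ominus>\<^bsub>V\<^esub> \<zero>\<^bsub>V\<^esub> = x"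
  by (simp add: cvs_diff)

lemma cvs_add_minus [simp]: "x \<in> carrier V \<Longrightarrow> x \<oplus>\<^bsub>V\<^esub> \<ominus>\<^bsub>V\<^esub> x = \<zero>\<^bsub>V\<^esub>" "x \<in> carrier V \<Longrightarrow> \<ominus>\<^bsub>V\<^esub> x \<oplus>\<^bsub>V\<^esub> x = \<zero>\<^bsub>V\<^esub>"
  by (simp_all add: M.r_neg M.l_neg)

lemma cvs_sum_closed [simp]: "f \<in> A \<rightarrow> carrier V \<Longrightarrow> (\<Oplus>\<^bsub>V\<^esub>i\<in>A. f i) \<in> carrier V"
  by (rule M.finsum_closed)

lemma cvs_sum_empty [simp]: "(\<Oplus>\<^bsub>V\<^esub>i\<in>{}. f i) = \<zero>\<^bsub>V\<^esub>"
  by simp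

lemma cvs_sum_insert [simp]:
  "finite A \<Longrightarrow> a \<notin> A \<Longrightarrow> f \<in> A \<rightarrow> carrier V \<Longrightarrow> f a \<in> carrier V \<Longrightarrow>
    (\<Oplus>\<^bsub>V\<^esub>i\<in>insert a A. f i) = f a \<oplus>\<^bsub>V\<^esub> (\<Oplus>\<^bsub>V\<^esub>i\<in>A. f i)"
  by (rule M.finsum_insert)

lemma cvs_sum_add:
  "f \<in> A \<rightarrow> carrier V \<Longrightarrow> g \<in> A \<rightarrow> carrier V \<Longrightarrow>
    (\<Oplus>\<^bsub>V\<^esub>i\<in>A. f i \<oplus>\<^bsub>V\<^esub> g i) = (\<Oplus>\<^bsub>V\<^esub>i\<in>A. f i) \<oplus>\<^bsub>V\<^esub> (\<Oplus>\<^bsub>V\<^esub>i\<in>A. g i)"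
  by (rule M.finsum_addf)

lemma cvs_sum_smult:
  "finite A \<Longrightarrow> f \<in> A \<rightarrow> carrier V \<Longrightarrow> (\<Oplus>\<^bsub>V\<^esub>i\<in>A. c \<odot>\<^bsub>V\<^esub> f i) = c \<odot>\<^bsub>V\<^esub> (\<Oplus>\<^bsub>V\<^esub>i\<in>A. f i)"
  by (simp add: finsum_smult_ldistr)

lemma cvs_sum_zero: "(\<And>i. i \<in> A \<Longrightarrow> f i = \<zero>\<^bsub>V\<^esub>) \<Longrightarrow> (\<Oplus>\<^bsub>V\<^esub>i\<in>A. f i) = \<zero>\<^bsub>V\<^esub>"
  by (rule M.add.finprod_one_eqI)

lemma cvs_sum_cong:
  "A = B \<Longrightarrow> g \<in> B \<rightarrow> carrier V \<Longrightarrow> (\<And>i. i \<in> B \<Longrightarrow> f i = g i) \<Longrightarrow>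
    (\<Oplus>\<^bsub>V\<^esub>i\<in>A. f i) = (\<Oplus>\<^bsub>V\<^esub>i\<in>B. g i)"
  by (rule M.finsum_cong') (auto simp: Pi_iff)

lemma cvs_sum_mono_neutral:
  assumes "finite B" "A \<subseteq> B" "f \<in> A \<rightarrow> carrier V" "\<And>i. i \<in> B - A \<Longrightarrow> f i = \<zero>\<^bsub>V\<^esub>"
  shows "(\<Oplus>\<^bsub>V\<^esub>i\<in>B. f i) = (\<Oplus>\<^bsub>V\<^esub>i\<in>A. f i)"
  by (rule M.add.finprod_mono_neutral_cong_right) (use assms in \<open>auto simp: Pi_iff\<close>)

lemma cvs_sum_delta:
  assumes "finite A" "a \<in> A" "f a \<in> carrier V" "\<And>i. i \<in> A \<Longrightarrow> i \<noteq> a \<Longrightarrow> f i = \<zero>\<^bsub>V\<^esub>"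
  shows "(\<Oplus>\<^bsub>V\<^esub>i\<in>A. f i) = f a"
proof -
  have "(\<Oplus>\<^bsub>V\<^esub>i\<in>A. f i) = (\<Oplus>\<^bsub>V\<^esub>i\<in>{a}. f i)"
    by (rule cvs_sum_mono_neutral) (use assms in auto)
  then show ?thesis using assms by simp
qed

lemma cvs_sum_reindex:
  "inj_on h A \<Longrightarrow> f \<in> h ` A \<rightarrow> carrier V \<Longrightarrow> (\<Oplus>\<^bsub>V\<^esub>i\<in>h ` A. f i) = (\<Oplus>\<^bsub>V\<^esub>i\<in>A. f (h i))"
  by (rule M.finsum_reindex)

text \<open>The additive inverses of a submodule are its multiples by \<open>-1\<close>, and a
  nonempty set closed under scaling contains \<open>0 w\<close>, the zero vector. This leaves the
  familiar subspace criterion.\<close>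

lemma submodule_iff:
  "submodule W \<C> V \<longleftrightarrow> W \<subseteq> carrier V \<and> \<zero>\<^bsub>V\<^esub> \<in> W \<and> (\<forall>x\<in>W. \<forall>y\<in>W. x \<oplus>\<^bsub>V\<^esub> y \<in> W) \<and> (\<forall>c. \<forall>x\<in>W. c \<odot>\<^bsub>V\<^esub> x \<in> W)"
  (is "?L \<longleftrightarrow> ?R")
proof
  assume L: ?L
  note E = submoduleE[OF L]
  from E obtain w where "w \<in> W" by blast
  then have "0 \<odot>\<^bsub>V\<^esub> w \<in> W" "w \<in> carrier V" using E by auto
  then show ?R using E by auto
next
  assume R: ?R
  show ?L
    by (rule submoduleI) (use R cvs_minus in \<open>auto simp: subset_iff\<close>)
qed

lemma submoduleD:
  assumes "submodule W \<C> V"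
  shows "W \<subseteq> carrier V" "x \<in> W \<Longrightarrow> x \<in> carrier V" "\<zero>\<^bsub>V\<^esub> \<in> W"
    "x \<in> W \<Longrightarrow> y \<in> W \<Longrightarrow> x \<oplus>\<^bsub>V\<^esub> y \<in> W" "x \<in> W \<Longrightarrow> c \<odot>\<^bsub>V\<^esub> x \<in> W"
  using assms by (auto simp: submodule_iff)

lemma cvs_submoduleI:
  assumes "W \<subseteq> carrier V" "\<zero>\<^bsub>V\<^esub> \<in> W"
    "\<And>x y. x \<in> W \<Longrightarrow> y \<in> W \<Longrightarrow> x \<oplus>\<^bsub>V\<^esub> y \<in> W" "\<And>c x. x \<in> W \<Longrightarrow> c \<odot>\<^bsub>V\<^esub> x \<in> W"
  shows "submodule W \<C> V"
  using assms by (simp add: submodule_iff)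

lemma lin_span_submodule:
  assumes A: "A \<subseteq> carrier V"
  shows "submodule (lin_span V A) \<C> V"
proof -
  \<comment> \<open>The whole carrier is one of the intersected submodules, so the span stays inside
    \<open>V\<close>.\<close>
  have c: "submodule (carrier V) \<C> V" by (rule carrier_is_submodule)
  have I: "x \<in> lin_span V A \<longleftrightarrow> (\<forall>W. submodule W \<C> V \<longrightarrow> A \<subseteq> W \<longrightarrow> x \<in> W)" for x
    by (auto simp: lin_span_def)
  have sub: "lin_span V A \<subseteq> carrier V" using A c I by blast
  have z: "\<zero>\<^bsub>V\<^esub> \<in> lin_span V A"
    unfolding I using submodule_iff[THEN iffD1] by blast
  have p: "x \<oplus>\<^bsub>V\<^esub> y \<in> lin_span V A" if "x \<in> lin_span V A" "y \<in> lin_span V A" for x y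
    using that submodule_iff[THEN iffD1] unfolding I by blast
  have m: "c \<odot>\<^bsub>V\<^esub> x \<in> lin_span V A" if "x \<in> lin_span V A" for c x
    using that submodule_iff[THEN iffD1] unfolding I by blast
  show ?thesis by (rule submodule_iff[THEN iffD2]) (intro conjI ballI allI sub z p m)
qed

lemma lin_span_superset: "A \<subseteq> lin_span V A"
  by (auto simp: lin_span_def)

lemma lin_span_minimal: "submodule W \<C> V \<Longrightarrow> A \<subseteq> W \<Longrightarrow> lin_span V A \<subseteq> W"
  by (auto simp: lin_span_def)

lemma lin_span_subset: "A \<subseteq> carrier V \<Longrightarrow> lin_span V A \<subseteq> carrier V"
  by (rule submoduleD(1)[OF lin_span_submodule])

lemma lin_span_mono: "B \<subseteq> carrier V \<Longrightarrow> A \<subseteq> lin_span V B \<Longrightarrow> lin_span V A \<subseteq> lin_span V B"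
  by (simp add: lin_span_minimal lin_span_submodule)

lemma lin_span_sum:
  assumes "submodule W \<C> V" "finite A" "f \<in> A \<rightarrow> W"
  shows "(\<Oplus>\<^bsub>V\<^esub>i\<in>A. f i) \<in> W"
  using assms(2,3)
proof (induction A rule: finite_induct)
  case empty
  then show ?case using submoduleD[OF assms(1)] by simp
next
  case (insert a A)
  then show ?case
    using submoduleD[OF assms(1)] by (subst cvs_sum_insert) auto
qed

end

text \<open>Additive inverses come from scaling by \<open>-1\<close>: distributivity and
  \<open>0 x = 0\<close> give \<open>(-1) x + x = 0\<close>.\<close>

lemma cvsI:
  assumes "\<And>x y. x \<in> carrier V \<Longrightarrow> y \<in> carrier V \<Longrightarrow> x \<oplus>\<^bsub>V\<^esub> y \<in> carrier V"
    "\<zero>\<^bsub>V\<^esub> \<in> carrier V"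
    "\<And>c x. x \<in> carrier V \<Longrightarrow> c \<odot>\<^bsub>V\<^esub> x \<in> carrier V"
    "\<And>x y z. x \<in> carrier V \<Longrightarrow> y \<in> carrier V \<Longrightarrow> z \<in> carrier V \<Longrightarrow> (x \<oplus>\<^bsub>V\<^esub> y) \<oplus>\<^bsub>V\<^esub> z = x \<oplus>\<^bsub>V\<^esub> (y \<oplus>\<^bsub>V\<^esub> z)"
    "\<And>x y. x \<in> carrier V \<Longrightarrow> y \<in> carrier V \<Longrightarrow> x \<oplus>\<^bsub>V\<^esub> y = y \<oplus>\<^bsub>V\<^esub> x"
    "\<And>x. x \<in> carrier V \<Longrightarrow> \<zero>\<^bsub>V\<^esub> \<oplus>\<^bsub>V\<^esub> x = x"
    "\<And>x. x \<in> carrier V \<Longrightarrow> 0 \<odot>\<^bsub>V\<^esub> x = \<zero>\<^bsub>V\<^esub>"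
    "\<And>c d x. x \<in> carrier V \<Longrightarrow> (c + d) \<odot>\<^bsub>V\<^esub> x = c \<odot>\<^bsub>V\<^esub> x \<oplus>\<^bsub>V\<^esub> d \<odot>\<^bsub>V\<^esub> x"
    "\<And>c x y. x \<in> carrier V \<Longrightarrow> y \<in> carrier V \<Longrightarrow> c \<odot>\<^bsub>V\<^esub> (x \<oplus>\<^bsub>V\<^esub> y) = c \<odot>\<^bsub>V\<^esub> x \<oplus>\<^bsub>V\<^esub> c \<odot>\<^bsub>V\<^esub> y"
    "\<And>c d x. x \<in> carrier V \<Longrightarrow> (c * d) \<odot>\<^bsub>V\<^esub> x = c \<odot>\<^bsub>V\<^esub> (d \<odot>\<^bsub>V\<^esub> x)"
    "\<And>x. x \<in> carrier V \<Longrightarrow> 1 \<odot>\<^bsub>V\<^esub> x = x"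
  shows "cvs V"
proof (rule moduleI)
  show "cring \<C>" by (rule cring_from_type_algebra)
  show "abelian_group V"
  proof (rule abelian_groupI)
    fix x assume x: "x \<in> carrier V"
    have "(-1) \<odot>\<^bsub>V\<^esub> x \<oplus>\<^bsub>V\<^esub> x = \<zero>\<^bsub>V\<^esub>"
      using assms(8)[OF x, of "-1" 1] assms(7,11) x by simp
    then show "\<exists>y\<in>carrier V. y \<oplus>\<^bsub>V\<^esub> x = \<zero>\<^bsub>V\<^esub>" using assms(3) x by blast
  qed (use assms in auto)
qed (use assms in auto)

text \<open>Several records (\<open>tensor_space\<close> and \<open>tensor_hopf\<close>, or a module
  and its underlying space) share carrier, addition, zero and scaling; this moves the vector space
  property between them.\<close>

lemma cvs_cong:
  assumes "cvs V" "carrier V' = carrier V" "add V' = add V" "\<zero>\<^bsub>V'\<^esub> = \<zero>\<^bsub>V\<^esub>" "module.smult V' = module.smult V"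
  shows "cvs V'"
  by (rule cvsI)
    (use assms(2-) in \<open>auto simp: cvs_smult_smult[OF assms(1)] cvs_add_ac[OF assms(1)] cvs_add_smult[OF assms(1)]
      cvs_smult_add[OF assms(1)] assms(1)\<close>)

section \<open>Linear maps\<close>

lemma linear_mapI:
  assumes "\<And>x. x \<in> carrier V \<Longrightarrow> f x \<in> carrier W"
    "\<And>x y. x \<in> carrier V \<Longrightarrow> y \<in> carrier V \<Longrightarrow> f (x \<oplus>\<^bsub>V\<^esub> y) = f x \<oplus>\<^bsub>W\<^esub> f y"
    "\<And>c x. x \<in> carrier V \<Longrightarrow> f (c \<odot>\<^bsub>V\<^esub> x) = c \<odot>\<^bsub>W\<^esub> f x"
  shows "linear_map V W f"
  using assms by (auto simp: linear_map_def)

lemma linear_mapD: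
  assumes "linear_map V W f"
  shows "x \<in> carrier V \<Longrightarrow> f x \<in> carrier W"
    "x \<in> carrier V \<Longrightarrow> y \<in> carrier V \<Longrightarrow> f (x \<oplus>\<^bsub>V\<^esub> y) = f x \<oplus>\<^bsub>W\<^esub> f y"
    "x \<in> carrier V \<Longrightarrow> f (c \<odot>\<^bsub>V\<^esub> x) = c \<odot>\<^bsub>W\<^esub> f x"
  using assms by (auto simp: linear_map_def)

lemma linear_map_cong:
  "linear_map V W f \<Longrightarrow> (\<And>x. x \<in> carrier V \<Longrightarrow> f x = g x) \<Longrightarrow> cvs V \<Longrightarrow> linear_map V W g"
  by (auto simp: linear_map_def Pi_iff)

lemma linear_map_comp: "linear_map V W f \<Longrightarrow> linear_map U V g \<Longrightarrow> linear_map U W (\<lambda>x. f (g x))"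
  by (auto simp: linear_map_def Pi_iff)

lemma linear_map_id: "linear_map V V (\<lambda>x. x)"
  by (auto simp: linear_map_def)

lemma linear_map_zero:
  assumes "cvs V" "cvs W" "linear_map V W f"
  shows "f \<zero>\<^bsub>V\<^esub> = \<zero>\<^bsub>W\<^esub>"
proof -
  have "f (0 \<odot>\<^bsub>V\<^esub> \<zero>\<^bsub>V\<^esub>) = 0 \<odot>\<^bsub>W\<^esub> f \<zero>\<^bsub>V\<^esub>"
    using assms linear_mapD(3) cvs_zero_closed by metis
  then show ?thesis using assms linear_mapD(1)[OF assms(3)] by simp
qed

lemma linear_map_diff:
  assumes "cvs V" "cvs W" "linear_map V W f" "x \<in> carrier V" "y \<in> carrier V"
  shows "f (x \<ominus>\<^bsub>V\<^esub> y) = f x \<ominus>\<^bsub>W\<^esub> f y"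
  using assms linear_mapD[OF assms(3)] by (simp add: cvs_diff)

lemma linear_map_minus:
  assumes "cvs V" "cvs W" "linear_map V W f" "x \<in> carrier V"
  shows "f (\<ominus>\<^bsub>V\<^esub> x) = \<ominus>\<^bsub>W\<^esub> f x"
  using assms linear_mapD[OF assms(3)] by (simp add: cvs_minus)

lemma linear_map_sum:
  assumes "cvs V" "cvs W" "linear_map V W f" "finite A" "g \<in> A \<rightarrow> carrier V"
  shows "f (\<Oplus>\<^bsub>V\<^esub>i\<in>A. g i) = (\<Oplus>\<^bsub>W\<^esub>i\<in>A. f (g i))"
  using assms(4,5)
proof (induction A rule: finite_induct)
  case empty
  then show ?case using assms by (simp add: linear_map_zero)
next
  case (insert a A)
  moreover have "f (g a) \<in> carrier W" "(\<lambda>i. f (g i)) \<in> A \<rightarrow> carrier W"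
    using insert linear_mapD(1)[OF assms(3)] by auto
  ultimately show ?case using assms linear_mapD[OF assms(3)] by simp
qed

lemma linear_map_const_zero: "cvs W \<Longrightarrow> linear_map V W (\<lambda>x. \<zero>\<^bsub>W\<^esub>)"
  by (auto simp: linear_map_def)

lemma linear_map_plus:
  "cvs W \<Longrightarrow> linear_map V W f \<Longrightarrow> linear_map V W g \<Longrightarrow> linear_map V W (\<lambda>x. f x \<oplus>\<^bsub>W\<^esub> g x)"
  by (rule linear_mapI) (auto simp: linear_mapD cvs_add_ac cvs_smult_add)

lemma linear_map_scale:
  "cvs W \<Longrightarrow> linear_map V W f \<Longrightarrow> linear_map V W (\<lambda>x. c \<odot>\<^bsub>W\<^esub> f x)"
  by (rule linear_mapI) (auto simp: linear_mapD cvs_smult_add cvs_smult_smult mult.commute)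

lemma linear_map_uminus:
  assumes "cvs W" "linear_map V W f"
  shows "linear_map V W (\<lambda>x. \<ominus>\<^bsub>W\<^esub> f x)"
  using linear_map_scale[OF assms, of "-1"] assms
  by (auto simp: linear_map_def cvs_minus Pi_iff)

lemma linear_map_minus_fun:
  assumes "cvs W" "linear_map V W f" "linear_map V W g"
  shows "linear_map V W (\<lambda>x. f x \<ominus>\<^bsub>W\<^esub> g x)"
  unfolding a_minus_def by (intro linear_map_plus linear_map_uminus assms)

lemma linear_map_sum_fun:
  assumes "cvs V" "cvs W" "finite A" "\<And>i. i \<in> A \<Longrightarrow> linear_map V W (f i)"
  shows "linear_map V W (\<lambda>x. \<Oplus>\<^bsub>W\<^esub>i\<in>A. f i x)"
  using assms(3,4)
proof (induction A rule: finite_induct)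
  case empty
  then show ?case using assms by (simp add: linear_map_const_zero)
next
  case (insert a A)
  have "linear_map V W (\<lambda>x. f a x \<oplus>\<^bsub>W\<^esub> (\<Oplus>\<^bsub>W\<^esub>i\<in>A. f i x))"
    using insert assms by (intro linear_map_plus) auto
  moreover have "f a x \<oplus>\<^bsub>W\<^esub> (\<Oplus>\<^bsub>W\<^esub>i\<in>A. f i x) = (\<Oplus>\<^bsub>W\<^esub>i\<in>insert a A. f i x)" if "x \<in> carrier V" for x
    by (rule cvs_sum_insert[symmetric]) (use insert assms that in \<open>auto intro: linear_mapD(1)\<close>)
  ultimately show ?case
    using assms(1) by (rule linear_map_cong)
qed

section \<open>Preimages, images and spans under linear maps\<close>

lemma submodule_vimage:
  assumes "cvs V" "cvs W" "linear_map V W f" "submodule S \<C> W"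
  shows "submodule {x \<in> carrier V. f x \<in> S} \<C> V"
  by (rule cvs_submoduleI)
    (use assms(1,2) submoduleD[OF assms(2,4)] linear_mapD[OF assms(3)] linear_map_zero[OF assms(1-3)] in auto)

lemma submodule_zero: "cvs W \<Longrightarrow> submodule {\<zero>\<^bsub>W\<^esub>} \<C> W"
  by (rule cvs_submoduleI) auto

lemma submodule_image:
  assumes "cvs V" "cvs W" "linear_map V W f" "submodule S \<C> V"
  shows "submodule (f ` S) \<C> W"
proof (rule cvs_submoduleI[OF assms(2)])
  note S = submoduleD[OF assms(1,4)] and f = linear_mapD[OF assms(3)]
  show "f ` S \<subseteq> carrier W" using S(2) f(1) by blast
  show "\<zero>\<^bsub>W\<^esub> \<in> f ` S"
    using linear_map_zero[OF assms(1-3)] S(3) by (metis image_eqI)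
  show "x \<oplus>\<^bsub>W\<^esub> y \<in> f ` S" if "x \<in> f ` S" "y \<in> f ` S" for x y
  proof -
    from that obtain a b where ab: "a \<in> S" "b \<in> S" "x = f a" "y = f b" by blast
    then have "x \<oplus>\<^bsub>W\<^esub> y = f (a \<oplus>\<^bsub>V\<^esub> b)" using f(2) S(2) by simp
    then show ?thesis using S(4) ab by blast
  qed
  show "c \<odot>\<^bsub>W\<^esub> x \<in> f ` S" if "x \<in> f ` S" for c x
  proof -
    from that obtain a where a: "a \<in> S" "x = f a" by blast
    then have "c \<odot>\<^bsub>W\<^esub> x = f (c \<odot>\<^bsub>V\<^esub> a)" using f(3) S(2) by simp
    then show ?thesis using S(5) a by blast
  qed
qed

text \<open>The preimage of \<open>S\<close> is a submodule containing \<open>A\<close>, hence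
  contains the span. This serves as the induction principle for spans: every closure property below
  is checked on spanning vectors through it.\<close>

lemma linear_map_span:
  assumes "cvs V" "cvs W" "linear_map V W f" "submodule S \<C> W" "A \<subseteq> carrier V"
    "\<And>x. x \<in> A \<Longrightarrow> f x \<in> S" "x \<in> lin_span V A"
  shows "f x \<in> S"
  using lin_span_minimal[OF assms(1) submodule_vimage[OF assms(1-4)], of A] assms(5-) by auto

lemma linear_map_image_span:
  assumes "cvs V" "cvs W" "linear_map V W f" "A \<subseteq> carrier V"
  shows "f ` lin_span V A = lin_span W (f ` A)"
proof
  have fA: "f ` A \<subseteq> carrier W" using assms linear_mapD(1) by fastforce
  show "f ` lin_span V A \<subseteq> lin_span W (f ` A)"
    using linear_map_span[OF assms(1-3) lin_span_submodule[OF assms(2) fA] assms(4)]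
      lin_span_superset[OF assms(2), of "f ` A"] by blast
  show "lin_span W (f ` A) \<subseteq> f ` lin_span V A"
    by (rule lin_span_minimal[OF assms(2) submodule_image[OF assms(1-3) lin_span_submodule]])
      (use assms lin_span_superset[OF assms(1), of A] in auto)
qed

text \<open>The difference of the two maps sends \<open>A\<close> into the zero submodule.\<close>

lemma linear_map_eq_on_span:
  assumes "cvs V" "cvs W" "linear_map V W f" "linear_map V W g" "A \<subseteq> carrier V"
    "\<And>x. x \<in> A \<Longrightarrow> f x = g x" "x \<in> lin_span V A"
  shows "f x = g x"
proof -
  have x: "x \<in> carrier V" using lin_span_subset[OF assms(1,5)] assms(7) by blast
  have "f x \<ominus>\<^bsub>W\<^esub> g x \<in> {\<zero>\<^bsub>W\<^esub>}"
    by (rule linear_map_span[OF assms(1,2) linear_map_minus_fun[OF assms(2-4)] submodule_zero[OF assms(2)] assms(5)])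
      (use assms linear_mapD(1)[OF assms(4)] in auto)
  then show ?thesis using assms x by (auto simp: linear_mapD(1))
qed

lemma carrier_eq_spanI:
  "cvs V \<Longrightarrow> A \<subseteq> carrier V \<Longrightarrow> (\<And>x. x \<in> carrier V \<Longrightarrow> x \<in> lin_span V A) \<Longrightarrow> lin_span V A = carrier V"
  using lin_span_subset by blast

section \<open>Free spaces, quotients and presentations\<close>

lemma free_space_carrier: "f \<in> carrier (free_space S) \<longleftrightarrow> finite {s. f s \<noteq> 0} \<and> {s. f s \<noteq> 0} \<subseteq> S"
  by (simp add: free_space_def)

lemma free_space_simps [simp]:
  "\<zero>\<^bsub>free_space S\<^esub> = (\<lambda>_. 0)"
  "f \<oplus>\<^bsub>free_space S\<^esub> g = (\<lambda>s. f s + g s)"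
  "c \<odot>\<^bsub>free_space S\<^esub> f = (\<lambda>s. c * f s)"
  by (simp_all add: free_space_def)

lemma cvs_free_space [simp]: "cvs (free_space S)"
proof (rule cvsI)
  fix f g assume *: "f \<in> carrier (free_space S)" "g \<in> carrier (free_space S)"
  have "{s. f s + g s \<noteq> 0} \<subseteq> {s. f s \<noteq> 0} \<union> {s. g s \<noteq> 0}" by auto
  with * show "f \<oplus>\<^bsub>free_space S\<^esub> g \<in> carrier (free_space S)"
    by (auto simp: free_space_carrier intro: finite_subset)
next
  fix c f assume *: "f \<in> carrier (free_space S)"
  have "{s. c * f s \<noteq> 0} \<subseteq> {s. f s \<noteq> 0}" by auto
  with * show "c \<odot>\<^bsub>free_space S\<^esub> f \<in> carrier (free_space S)"
    by (auto simp: free_space_carrier intro: finite_subset)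
qed (auto simp: free_space_carrier algebra_simps)

lemma gen_closed [simp]: "s \<in> S \<Longrightarrow> gen s \<in> carrier (free_space S)"
  by (auto simp: gen_def free_space_carrier)

lemma free_space_span: "lin_span (free_space S) (gen ` S) = carrier (free_space S)"
proof (rule carrier_eq_spanI)
  let ?W = "lin_span (free_space S) (gen ` S)"
  show sub: "gen ` S \<subseteq> carrier (free_space S)" by (rule image_subsetI) (rule gen_closed)
  note W = submoduleD[OF cvs_free_space lin_span_submodule[OF cvs_free_space sub]]
  \<comment> \<open>The induction runs over a finite superset of the support. Clearing the value at
    the inserted point then leaves a function supported in the smaller set, whether or not that
    value was zero.\<close>
  have "f \<in> ?W" if "finite A" "A \<subseteq> S" "{s. f s \<noteq> 0} \<subseteq> A" for A f
    using that
  proof (induction A arbitrary: f rule: finite_induct)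
    case empty
    then have "f = \<zero>\<^bsub>free_space S\<^esub>" by auto
    then show ?case using W(3) by simp
  next
    case (insert a A)
    have "f(a := 0) \<in> ?W" using insert by (intro insert.IH) auto
    moreover have "gen a \<in> ?W"
      by (rule subsetD[OF lin_span_superset[OF cvs_free_space]]) (use insert in simp)
    ultimately have "(f a \<odot>\<^bsub>free_space S\<^esub> gen a) \<oplus>\<^bsub>free_space S\<^esub> f(a := 0) \<in> ?W"
      using W(4,5) by blast
    moreover have "(f a \<odot>\<^bsub>free_space S\<^esub> gen a) \<oplus>\<^bsub>free_space S\<^esub> f(a := 0) = f"
      by (auto simp: gen_def)
    ultimately show ?case by simp
  qed
  then show "f \<in> ?W" if "f \<in> carrier (free_space S)" for f
    using that unfolding free_space_carrier by blast
qed (rule cvs_free_space)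

text \<open>The sum in \<open>lin_ext\<close> ranges over the support of its argument, and supports
  change under addition and scaling. Over a common finite superset the sums can be compared term by
  term.\<close>

lemma lin_ext_superset:
  assumes "cvs U" "\<phi> \<in> S \<rightarrow> carrier U" "finite A" "A \<subseteq> S" "{s. f s \<noteq> 0} \<subseteq> A"
  shows "lin_ext U \<phi> f = (\<Oplus>\<^bsub>U\<^esub>s\<in>A. f s \<odot>\<^bsub>U\<^esub> \<phi> s)"
  unfolding lin_ext_def
  by (rule cvs_sum_mono_neutral[symmetric])
    (use assms in \<open>auto simp: Pi_iff subset_iff\<close>)

lemma lin_ext_linear:
  assumes "cvs U" "\<phi> \<in> S \<rightarrow> carrier U"
  shows "linear_map (free_space S) U (lin_ext U \<phi>)"
proof (rule linear_mapI)
  have c: "(\<lambda>s. f s \<odot>\<^bsub>U\<^esub> \<phi> s) \<in> A \<rightarrow> carrier U" if "A \<subseteq> S" for f A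
    using that assms by (auto simp: Pi_iff subset_iff)
  show "lin_ext U \<phi> f \<in> carrier U" if "f \<in> carrier (free_space S)" for f
    unfolding lin_ext_def using that assms(1) c by (simp add: free_space_carrier)
  show "lin_ext U \<phi> (f \<oplus>\<^bsub>free_space S\<^esub> g) = lin_ext U \<phi> f \<oplus>\<^bsub>U\<^esub> lin_ext U \<phi> g"
    if "f \<in> carrier (free_space S)" "g \<in> carrier (free_space S)" for f g
  proof -
    let ?A = "{s. f s \<noteq> 0} \<union> {s. g s \<noteq> 0}"
    have A: "finite ?A" "?A \<subseteq> S" using that by (auto simp: free_space_carrier)
    have "lin_ext U \<phi> (f \<oplus>\<^bsub>free_space S\<^esub> g) = (\<Oplus>\<^bsub>U\<^esub>s\<in>?A. (f s + g s) \<odot>\<^bsub>U\<^esub> \<phi> s)"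
      by (subst lin_ext_superset[OF assms A]) auto
    also have "\<dots> = (\<Oplus>\<^bsub>U\<^esub>s\<in>?A. f s \<odot>\<^bsub>U\<^esub> \<phi> s \<oplus>\<^bsub>U\<^esub> g s \<odot>\<^bsub>U\<^esub> \<phi> s)"
      by (rule cvs_sum_cong) (use assms A in \<open>auto simp: Pi_iff subset_iff cvs_add_smult\<close>)
    also have "\<dots> = (\<Oplus>\<^bsub>U\<^esub>s\<in>?A. f s \<odot>\<^bsub>U\<^esub> \<phi> s) \<oplus>\<^bsub>U\<^esub> (\<Oplus>\<^bsub>U\<^esub>s\<in>?A. g s \<odot>\<^bsub>U\<^esub> \<phi> s)"
      by (rule cvs_sum_add[OF assms(1) c[OF A(2)] c[OF A(2)]])
    also have "\<dots> = lin_ext U \<phi> f \<oplus>\<^bsub>U\<^esub> lin_ext U \<phi> g"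
      by (subst (1 2) lin_ext_superset[OF assms A]) auto
    finally show ?thesis .
  qed
  show "lin_ext U \<phi> (k \<odot>\<^bsub>free_space S\<^esub> f) = k \<odot>\<^bsub>U\<^esub> lin_ext U \<phi> f"
    if "f \<in> carrier (free_space S)" for k f
  proof -
    let ?A = "{s. f s \<noteq> 0}"
    have A: "finite ?A" "?A \<subseteq> S" using that by (auto simp: free_space_carrier)
    have "lin_ext U \<phi> (k \<odot>\<^bsub>free_space S\<^esub> f) = (\<Oplus>\<^bsub>U\<^esub>s\<in>?A. (k * f s) \<odot>\<^bsub>U\<^esub> \<phi> s)"
      by (subst lin_ext_superset[OF assms A]) auto
    also have "\<dots> = (\<Oplus>\<^bsub>U\<^esub>s\<in>?A. k \<odot>\<^bsub>U\<^esub> (f s \<odot>\<^bsub>U\<^esub> \<phi> s))"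
      by (rule cvs_sum_cong) (use assms A in \<open>auto simp: Pi_iff subset_iff cvs_smult_smult\<close>)
    also have "\<dots> = k \<odot>\<^bsub>U\<^esub> lin_ext U \<phi> f"
      unfolding lin_ext_def by (rule cvs_sum_smult[OF assms(1) A(1) c[OF A(2)]])
    finally show ?thesis .
  qed
qed

lemma lin_ext_gen:
  assumes "cvs U" "\<phi> \<in> S \<rightarrow> carrier U" "s \<in> S"
  shows "lin_ext U \<phi> (gen s) = \<phi> s"
proof -
  have "\<phi> s \<in> carrier U" using assms by auto
  then show ?thesis
    by (subst lin_ext_superset[OF assms(1,2), of "{s}"]) (use assms(1,3) in \<open>auto simp: gen_def\<close>)
qed

section \<open>Cosets and quotient spaces\<close>

context
  fixes V :: "(complex, 'v, 'm) module_scheme" and W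
  assumes V: "cvs V" and W: "submodule W \<C> V"
begin

interpretation module \<C> V by (rule V)

lemma coset_mem_iff:
  assumes "a \<in> carrier V"
  shows "b \<in> W +>\<^bsub>V\<^esub> a \<longleftrightarrow> b \<in> carrier V \<and> b \<ominus>\<^bsub>V\<^esub> a \<in> W"
proof -
  note W = submoduleD[OF V W]
  have "b = (b \<ominus>\<^bsub>V\<^esub> a) \<oplus>\<^bsub>V\<^esub> a" if "b \<in> carrier V"
    using that assms V by (simp add: a_minus_def M.add.m_assoc)
  moreover have "(h \<oplus>\<^bsub>V\<^esub> a) \<ominus>\<^bsub>V\<^esub> a = h" if "h \<in> W" for h
    using that W(2) assms V by (simp add: a_minus_def M.add.m_assoc)
  moreover have "h \<oplus>\<^bsub>V\<^esub> a \<in> carrier V" if "h \<in> W" for h using that W(2) assms V by simp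
  ultimately show ?thesis
    unfolding a_r_coset_def' by fastforce
qed

lemma coset_eq_iff:
  assumes "a \<in> carrier V" "b \<in> carrier V"
  shows "W +>\<^bsub>V\<^esub> a = W +>\<^bsub>V\<^esub> b \<longleftrightarrow> a \<ominus>\<^bsub>V\<^esub> b \<in> W"
proof -
  have "additive_subgroup W V"
    using W by (simp add: additive_subgroup_def submodule_def)
  then interpret abelian_subgroup W V
    by (rule abelian_subgroupI3) (rule cvs_abelian_group[OF V])
  have "W +>\<^bsub>V\<^esub> a = W +>\<^bsub>V\<^esub> b \<longleftrightarrow> a \<in> W +>\<^bsub>V\<^esub> b"
    by (metis a_repr_independence' a_repr_independenceD assms)
  then show ?thesis using coset_mem_iff assms by simp
qed

lemma coset_self: "a \<in> carrier V \<Longrightarrow> a \<in> W +>\<^bsub>V\<^esub> a"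
  using coset_mem_iff submoduleD(3)[OF V W] V by (metis cvs_diff_eq_zero)

lemma coset_memD:
  assumes "a \<in> carrier V" "b \<in> W +>\<^bsub>V\<^esub> a"
  shows "b \<in> carrier V" "W +>\<^bsub>V\<^esub> b = W +>\<^bsub>V\<^esub> a"
  using assms coset_mem_iff coset_eq_iff by auto

lemma carrier_quot_space: "carrier (quot_space V W) = (\<lambda>a. W +>\<^bsub>V\<^esub> a) ` carrier V"
  by (auto simp: quot_space_def A_RCOSETS_def' )

lemma coset_add:
  assumes "a \<in> carrier V" "b \<in> carrier V"
  shows "(W +>\<^bsub>V\<^esub> a) \<oplus>\<^bsub>quot_space V W\<^esub> (W +>\<^bsub>V\<^esub> b) = W +>\<^bsub>V\<^esub> (a \<oplus>\<^bsub>V\<^esub> b)"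
proof -
  have "additive_subgroup W V"
    using W by (simp add: additive_subgroup_def submodule_def)
  then interpret abelian_subgroup W V
    by (rule abelian_subgroupI3) (rule cvs_abelian_group[OF V])
  show ?thesis using assms by (simp add: quot_space_def a_rcos_sum)
qed

text \<open>Scaling in \<open>quot_space\<close> is a union of cosets, one for each member of the
  given coset. They all coincide, because \<open>c b - c a = c (b - a)\<close> lies in
  \<open>W\<close>, so the union is a single coset.\<close>

lemma coset_smult:
  assumes "a \<in> carrier V"
  shows "c \<odot>\<^bsub>quot_space V W\<^esub> (W +>\<^bsub>V\<^esub> a) = W +>\<^bsub>V\<^esub> (c \<odot>\<^bsub>V\<^esub> a)"
proof -
  have "W +>\<^bsub>V\<^esub> (c \<odot>\<^bsub>V\<^esub> b) = W +>\<^bsub>V\<^esub> (c \<odot>\<^bsub>V\<^esub> a)" if "b \<in> W +>\<^bsub>V\<^esub> a" for b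
  proof -
    have b: "b \<in> carrier V" "b \<ominus>\<^bsub>V\<^esub> a \<in> W" using that coset_mem_iff assms by auto
    have "c \<odot>\<^bsub>V\<^esub> b \<ominus>\<^bsub>V\<^esub> c \<odot>\<^bsub>V\<^esub> a = c \<odot>\<^bsub>V\<^esub> (b \<ominus>\<^bsub>V\<^esub> a)"
      using b(1) assms V by (simp add: cvs_diff cvs_smult_add cvs_smult_smult mult.commute)
    then show ?thesis using b submoduleD(5)[OF V W] assms V by (subst coset_eq_iff) auto
  qed
  then have "(\<Union>x\<in>W +>\<^bsub>V\<^esub> a. W +>\<^bsub>V\<^esub> (c \<odot>\<^bsub>V\<^esub> x)) = W +>\<^bsub>V\<^esub> (c \<odot>\<^bsub>V\<^esub> a)"
    using coset_self[OF assms] by blast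
  then show ?thesis by (simp add: quot_space_def)
qed

lemma coset_zero: "\<zero>\<^bsub>quot_space V W\<^esub> = W +>\<^bsub>V\<^esub> \<zero>\<^bsub>V\<^esub>"
proof -
  have "W +>\<^bsub>V\<^esub> \<zero>\<^bsub>V\<^esub> = W"
    using coset_mem_iff[of "\<zero>\<^bsub>V\<^esub>"] submoduleD(2)[OF V W] V by (auto simp: cvs_diff)
  then show ?thesis by (simp add: quot_space_def)
qed

lemma cvs_quot_space: "cvs (quot_space V W)"
  by (rule cvsI)
    (use V in \<open>auto simp: carrier_quot_space coset_add coset_smult coset_zero cvs_add_ac cvs_add_smult
       cvs_smult_add cvs_smult_smult\<close>)

lemma coset_linear: "linear_map V (quot_space V W) (\<lambda>a. W +>\<^bsub>V\<^esub> a)"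
  by (rule linear_mapI) (auto simp: carrier_quot_space coset_add coset_smult)

lemma coset_eq_zero_iff: "a \<in> carrier V \<Longrightarrow> W +>\<^bsub>V\<^esub> a = \<zero>\<^bsub>quot_space V W\<^esub> \<longleftrightarrow> a \<in> W"
  using V by (simp add: coset_zero coset_eq_iff cvs_diff)

lemma rep_coset:
  assumes "A \<in> carrier (quot_space V W)"
  shows "rep A \<in> A" "rep A \<in> carrier V" "W +>\<^bsub>V\<^esub> rep A = A"
proof -
  from assms obtain a where a: "a \<in> carrier V" "A = W +>\<^bsub>V\<^esub> a" by (auto simp: carrier_quot_space)
  show 1: "rep A \<in> A" unfolding rep_def using coset_self[OF a(1)] a(2) by (metis someI)
  show "rep A \<in> carrier V" "W +>\<^bsub>V\<^esub> rep A = A" using coset_memD[of a "rep A"] a 1 by auto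
qed

text \<open>Together with \<open>rep_coset\<close> this is everything known about the choice made by
  \<open>rep\<close>.\<close>

lemma rep_coset_diff: "a \<in> carrier V \<Longrightarrow> rep (W +>\<^bsub>V\<^esub> a) \<ominus>\<^bsub>V\<^esub> a \<in> W"
  using rep_coset[of "W +>\<^bsub>V\<^esub> a"] coset_eq_iff by (simp add: carrier_quot_space)

end

text \<open>The common form of \<open>tensor\<close> and \<open>tensor_space\<close>: generators
  \<open>S\<close> modulo relations \<open>R\<close>. Well-definedness and linearity of
  \<open>lift\<close> are proved once here and specialised to both.\<close>

definition presented_space :: "'s set \<Rightarrow> ('s \<Rightarrow> complex) set \<Rightarrow> (complex, ('s \<Rightarrow> complex) set) module" where
  "presented_space S R = quot_space (free_space S) (lin_span (free_space S) R)"

definition generator_class :: "'s set \<Rightarrow> ('s \<Rightarrow> complex) set \<Rightarrow> 's \<Rightarrow> ('s \<Rightarrow> complex) set" where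
  "generator_class S R s = lin_span (free_space S) R +>\<^bsub>free_space S\<^esub> gen s"

text \<open>The condition under which \<open>lift\<close> does not depend on representatives. Asking
  it on \<open>R\<close> suffices, because the kernel of the linear extension is a submodule and so
  contains the span of \<open>R\<close>.\<close>

definition descends ::
    "'s set \<Rightarrow> ('s \<Rightarrow> complex) set \<Rightarrow> (complex, 'u, 'n) module_scheme \<Rightarrow> ('s \<Rightarrow> 'u) \<Rightarrow> bool" where
  "descends S R U \<phi> \<longleftrightarrow> \<phi> \<in> S \<rightarrow> carrier U \<and> (\<forall>r\<in>R. lin_ext U \<phi> r = \<zero>\<^bsub>U\<^esub>)"

lemma cvs_presented_space: "R \<subseteq> carrier (free_space S) \<Longrightarrow> cvs (presented_space S R)"
  unfolding presented_space_def by (intro cvs_quot_space cvs_free_space lin_span_submodule)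

lemma generator_class_span:
  assumes "R \<subseteq> carrier (free_space S)"
  shows "lin_span (presented_space S R) (generator_class S R ` S) = carrier (presented_space S R)"
proof -
  note sub = lin_span_submodule[OF cvs_free_space assms]
  note quot = carrier_quot_space[OF cvs_free_space sub] 
  have gS: "gen ` S \<subseteq> carrier (free_space S)" by (rule image_subsetI) (rule gen_closed)
  show ?thesis
    using linear_map_image_span[OF cvs_free_space cvs_quot_space[OF cvs_free_space sub] coset_linear[OF cvs_free_space sub] gS]
    unfolding free_space_span quot[symmetric]
    by (simp add: presented_space_def generator_class_def image_image)
qed

lemma generator_class_closed:
  assumes "R \<subseteq> carrier (free_space S)" "s \<in> S"
  shows "generator_class S R s \<in> carrier (presented_space S R)"
  unfolding presented_space_def generator_class_def
  by (rule linear_mapD(1)[OF coset_linear[OF cvs_free_space lin_span_submodule[OF cvs_free_space assms(1)]]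
        gen_closed[OF assms(2)]])

text \<open>The chosen representative differs from \<open>f\<close> by an element of the span of
  \<open>R\<close>, where the linear extension vanishes.\<close>

lemma lift_coset:
  assumes "cvs U" "R \<subseteq> carrier (free_space S)" "descends S R U \<phi>" "f \<in> carrier (free_space S)"
  shows "lift U \<phi> (lin_span (free_space S) R +>\<^bsub>free_space S\<^esub> f) = lin_ext U \<phi> f"
proof -
  note sub = lin_span_submodule[OF cvs_free_space assms(2)]
  have lin: "linear_map (free_space S) U (lin_ext U \<phi>)"
    by (rule lin_ext_linear[OF assms(1)]) (use assms(3) in \<open>simp add: descends_def\<close>)
  let ?A = "lin_span (free_space S) R +>\<^bsub>free_space S\<^esub> f"
  have A: "?A \<in> carrier (quot_space (free_space S) (lin_span (free_space S) R))"
    using assms(4) by (simp only: carrier_quot_space[OF cvs_free_space sub] imageI)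
  note r = rep_coset[OF cvs_free_space sub A]
  have d: "rep ?A \<ominus>\<^bsub>free_space S\<^esub> f \<in> lin_span (free_space S) R"
    by (rule rep_coset_diff[OF cvs_free_space sub assms(4)])
  have "lin_ext U \<phi> (rep ?A \<ominus>\<^bsub>free_space S\<^esub> f) \<in> {\<zero>\<^bsub>U\<^esub>}"
    by (rule linear_map_span[OF cvs_free_space assms(1) lin submodule_zero[OF assms(1)] assms(2) _ d])
      (use assms(3) in \<open>simp_all add: descends_def\<close>)
  moreover have "lin_ext U \<phi> (rep ?A \<ominus>\<^bsub>free_space S\<^esub> f) = lin_ext U \<phi> (rep ?A) \<ominus>\<^bsub>U\<^esub> lin_ext U \<phi> f"
    by (rule linear_map_diff[OF cvs_free_space assms(1) lin r(2) assms(4)])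
  ultimately show ?thesis
    using linear_mapD(1)[OF lin r(2)] linear_mapD(1)[OF lin assms(4)] assms(1) by (simp add: lift_def)
qed

lemma lift_linear:
  assumes "cvs U" "R \<subseteq> carrier (free_space S)" "descends S R U \<phi>"
  shows "linear_map (presented_space S R) U (lift U \<phi>)"
proof -
  note sub = lin_span_submodule[OF cvs_free_space assms(2)]
  note q = coset_linear[OF cvs_free_space sub]
  let ?\<pi> = "\<lambda>f. lin_span (free_space S) R +>\<^bsub>free_space S\<^esub> f"
  have lin: "linear_map (free_space S) U (lin_ext U \<phi>)"
    by (rule lin_ext_linear[OF assms(1)]) (use assms(3) in \<open>simp add: descends_def\<close>)
  have *: "\<exists>f\<in>carrier (free_space S). A = ?\<pi> f" if "A \<in> carrier (presented_space S R)" for A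
    using that carrier_quot_space[OF cvs_free_space sub] unfolding presented_space_def by blast
  show ?thesis
  proof (rule linear_mapI)
    fix A assume "A \<in> carrier (presented_space S R)"
    then obtain f where f: "f \<in> carrier (free_space S)" "A = ?\<pi> f" using * by blast
    show "lift U \<phi> A \<in> carrier U"
      using f linear_mapD(1)[OF lin f(1)] lift_coset[OF assms] by simp
    have "c \<odot>\<^bsub>presented_space S R\<^esub> A = ?\<pi> (c \<odot>\<^bsub>free_space S\<^esub> f)" for c
      unfolding presented_space_def f(2) using linear_mapD(3)[OF q f(1)] by simp
    then show "lift U \<phi> (c \<odot>\<^bsub>presented_space S R\<^esub> A) = c \<odot>\<^bsub>U\<^esub> lift U \<phi> A" for c
      using f(2) lift_coset[OF assms f(1)] lift_coset[OF assms cvs_smult_closed[OF cvs_free_space f(1)]]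
        linear_mapD(3)[OF lin f(1)] by metis
    fix B assume "B \<in> carrier (presented_space S R)"
    then obtain g where g: "g \<in> carrier (free_space S)" "B = ?\<pi> g" using * by blast
    have "A \<oplus>\<^bsub>presented_space S R\<^esub> B = ?\<pi> (f \<oplus>\<^bsub>free_space S\<^esub> g)"
      unfolding presented_space_def f(2) g(2) using linear_mapD(2)[OF q f(1) g(1)] by simp
    then show "lift U \<phi> (A \<oplus>\<^bsub>presented_space S R\<^esub> B) = lift U \<phi> A \<oplus>\<^bsub>U\<^esub> lift U \<phi> B"
      using f(2) g(2) lift_coset[OF assms f(1)] lift_coset[OF assms g(1)]
        lift_coset[OF assms cvs_add_closed[OF cvs_free_space f(1) g(1)]]
        linear_mapD(2)[OF lin f(1) g(1)] by metis
  qed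
qed

lemma lift_generator_class:
  assumes "cvs U" "R \<subseteq> carrier (free_space S)" "descends S R U \<phi>" "s \<in> S"
  shows "lift U \<phi> (generator_class S R s) = \<phi> s"
  using lift_coset[OF assms(1-3) gen_closed[OF assms(4)]] lin_ext_gen[OF assms(1) _ assms(4)] assms(3)
  by (simp add: generator_class_def descends_def)

section \<open>Bilinear maps and lifts in two variables\<close>

definition bilinear_map ::
    "(complex, 'v, 'm) module_scheme \<Rightarrow> (complex, 'w, 'n) module_scheme \<Rightarrow> (complex, 'u, 'k) module_scheme
       \<Rightarrow> ('v \<Rightarrow> 'w \<Rightarrow> 'u) \<Rightarrow> bool" where
  "bilinear_map V W U \<beta> \<longleftrightarrow>
     (\<forall>v\<in>carrier V. linear_map W U (\<beta> v)) \<and> (\<forall>w\<in>carrier W. linear_map V U (\<lambda>v. \<beta> v w))"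

lemma bilinear_mapD:
  assumes "bilinear_map V W U \<beta>"
  shows "v \<in> carrier V \<Longrightarrow> linear_map W U (\<beta> v)" "w \<in> carrier W \<Longrightarrow> linear_map V U (\<lambda>v. \<beta> v w)"
    "v \<in> carrier V \<Longrightarrow> w \<in> carrier W \<Longrightarrow> \<beta> v w \<in> carrier U"
  using assms by (auto simp: bilinear_map_def intro: linear_mapD(1)[of W U "\<beta> v"])

lemma bilinear_map_eq_on_span:
  assumes "cvs V" "cvs W" "cvs U" "bilinear_map V W U \<beta>" "bilinear_map V W U \<gamma>"
    "A \<subseteq> carrier V" "B \<subseteq> carrier W" "\<And>a b. a \<in> A \<Longrightarrow> b \<in> B \<Longrightarrow> \<beta> a b = \<gamma> a b"
    "v \<in> lin_span V A" "w \<in> lin_span W B"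
  shows "\<beta> v w = \<gamma> v w"
proof -
  have w: "w \<in> carrier W" using lin_span_subset[OF assms(2,7)] assms(10) by blast
  have "\<beta> a w = \<gamma> a w" if "a \<in> A" for a
  proof -
    have a: "a \<in> carrier V" using that assms(6) by blast
    show ?thesis
      by (rule linear_map_eq_on_span[OF assms(2,3) bilinear_mapD(1)[OF assms(4) a] bilinear_mapD(1)[OF assms(5) a]
            assms(7) assms(8)[OF that] assms(10)])
  qed
  then show ?thesis
    using linear_map_eq_on_span[OF assms(1,3) bilinear_mapD(2)[OF assms(4) w] bilinear_mapD(2)[OF assms(5) w] assms(6) _ assms(9)]
    by blast
qed

text \<open>For fixed relation \<open>r\<close>, the value of the linear extension on \<open>r\<close> is a linear function of
  \<open>B\<close>, so that it suffices to test it on generators \<open>B\<close>.\<close>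

lemma lift_descends:
  assumes "cvs U" "R \<subseteq> carrier (free_space S)" "R' \<subseteq> carrier (free_space S')"
    "\<And>s. s \<in> S \<Longrightarrow> descends S' R' U (\<beta> s)" "\<And>s'. s' \<in> S' \<Longrightarrow> descends S R U (\<lambda>s. \<beta> s s')"
    "B \<in> carrier (presented_space S' R')"
  shows "descends S R U (\<lambda>s. lift U (\<beta> s) B)"
  unfolding descends_def
proof (intro conjI ballI)
  have lin: "linear_map (presented_space S' R') U (lift U (\<beta> s))" if "s \<in> S" for s
    by (rule lift_linear[OF assms(1,3) assms(4)[OF that]])
  show "(\<lambda>s. lift U (\<beta> s) B) \<in> S \<rightarrow> carrier U"
    using linear_mapD(1)[OF lin] assms(6) by auto
  fix r assume r: "r \<in> R"
  have supp: "finite {s. r s \<noteq> 0}" "{s. r s \<noteq> 0} \<subseteq> S" using r assms(2) by (auto simp: free_space_carrier subset_iff)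
  let ?h = "\<lambda>B. lin_ext U (\<lambda>s. lift U (\<beta> s) B) r"
  have h: "linear_map (presented_space S' R') U ?h"
    unfolding lin_ext_def
    by (intro linear_map_sum_fun linear_map_scale cvs_presented_space lin assms(1,3) supp(1)) (use supp(2) in auto)
  have z: "?h (generator_class S' R' s') = \<zero>\<^bsub>U\<^esub>" if s': "s' \<in> S'" for s'
  proof -
    have "lift U (\<beta> s) (generator_class S' R' s') = \<beta> s s'" if "s \<in> S" for s
      by (rule lift_generator_class[OF assms(1,3) assms(4)[OF that] s'])
    moreover have "(\<lambda>s. \<beta> s s') \<in> S \<rightarrow> carrier U" using assms(5)[OF s'] by (simp add: descends_def)
    ultimately have "?h (generator_class S' R' s') = lin_ext U (\<lambda>s. \<beta> s s') r"
      unfolding lin_ext_def by (intro cvs_sum_cong) (use supp assms(1) in \<open>auto simp: Pi_iff subset_iff\<close>)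
    then show ?thesis using assms(5)[OF s'] r by (simp add: descends_def)
  qed
  show "?h B = \<zero>\<^bsub>U\<^esub>"
    by (rule linear_map_eq_on_span[OF cvs_presented_space[OF assms(3)] assms(1) h linear_map_const_zero[OF assms(1)],
          of "generator_class S' R' ` S'"])
      (use z generator_class_closed[OF assms(3)] generator_class_span[OF assms(3)] assms(6) in auto)
qed

text \<open>Linearity in the outer variable \<open>A\<close> is that of \<open>lift\<close>.
  Linearity in \<open>B\<close> is tested with a generator in place of \<open>A\<close>, where the
  outer \<open>lift\<close> evaluates and leaves the inner one, which is linear in
  \<open>B\<close>.\<close>

lemma lift_lift_bilinear:
  assumes "cvs U" "R \<subseteq> carrier (free_space S)" "R' \<subseteq> carrier (free_space S')"
    "\<And>s. s \<in> S \<Longrightarrow> descends S' R' U (\<beta> s)" "\<And>s'. s' \<in> S' \<Longrightarrow> descends S R U (\<lambda>s. \<beta> s s')"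
  shows "bilinear_map (presented_space S R) (presented_space S' R') U (\<lambda>A B. lift U (\<lambda>s. lift U (\<beta> s) B) A)"
proof -
  let ?b = "\<lambda>A B. lift U (\<lambda>s. lift U (\<beta> s) B) A"
  have resp: "descends S R U (\<lambda>s. lift U (\<beta> s) B)" if "B \<in> carrier (presented_space S' R')" for B
    by (rule lift_descends[OF assms that])
  have l1: "linear_map (presented_space S R) U (\<lambda>A. ?b A B)" if "B \<in> carrier (presented_space S' R')" for B
    by (rule lift_linear[OF assms(1,2) resp[OF that]])
  have gen: "?b (generator_class S R s) B = lift U (\<beta> s) B"
    if "B \<in> carrier (presented_space S' R')" "s \<in> S" for B s
    by (rule lift_generator_class[OF assms(1,2) resp[OF that(1)] that(2)])
  have c: "cvs (presented_space S R)" "cvs (presented_space S' R')"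
    using cvs_presented_space assms(2,3) by blast+
  have lin: "linear_map (presented_space S' R') U (lift U (\<beta> s))" if "s \<in> S" for s
    by (rule lift_linear[OF assms(1,3) assms(4)[OF that]])
  have gens: "generator_class S R ` S \<subseteq> carrier (presented_space S R)"
    "carrier (presented_space S R) = lin_span (presented_space S R) (generator_class S R ` S)"
    using generator_class_closed[OF assms(2)] generator_class_span[OF assms(2)] by auto
  have l2: "linear_map (presented_space S' R') U (?b A)" if A: "A \<in> carrier (presented_space S R)" for A
  proof (rule linear_mapI)
    fix B assume B: "B \<in> carrier (presented_space S' R')"
    show "?b A B \<in> carrier U" using linear_mapD(1)[OF l1[OF B] A] .
    have kB: "k \<odot>\<^bsub>presented_space S' R'\<^esub> B \<in> carrier (presented_space S' R')" for k
      using B c by simp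
    have "?b (generator_class S R s) (k \<odot>\<^bsub>presented_space S' R'\<^esub> B) = k \<odot>\<^bsub>U\<^esub> ?b (generator_class S R s) B"
      if "s \<in> S" for k s
      using gen[OF B that] gen[OF kB that] linear_mapD(3)[OF lin[OF that] B] by simp
    then show "?b A (k \<odot>\<^bsub>presented_space S' R'\<^esub> B) = k \<odot>\<^bsub>U\<^esub> ?b A B" for k
      using linear_map_eq_on_span[OF c(1) assms(1) l1[OF kB] linear_map_scale[OF assms(1) l1[OF B]] gens(1) _ A[unfolded gens(2)]]
      by blast
    fix B' assume B': "B' \<in> carrier (presented_space S' R')"
    have BB: "B \<oplus>\<^bsub>presented_space S' R'\<^esub> B' \<in> carrier (presented_space S' R')"
      using B B' c by simp
    have "?b (generator_class S R s) (B \<oplus>\<^bsub>presented_space S' R'\<^esub> B') =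
        ?b (generator_class S R s) B \<oplus>\<^bsub>U\<^esub> ?b (generator_class S R s) B'"
      if "s \<in> S" for s
      using gen[OF B that] gen[OF B' that] gen[OF BB that] linear_mapD(2)[OF lin[OF that] B B'] by simp
    then show "?b A (B \<oplus>\<^bsub>presented_space S' R'\<^esub> B') = ?b A B \<oplus>\<^bsub>U\<^esub> ?b A B'"
      using linear_map_eq_on_span[OF c(1) assms(1) l1[OF BB] linear_map_plus[OF assms(1) l1[OF B] l1[OF B']] gens(1) _ A[unfolded gens(2)]]
      by blast
  qed
  show ?thesis using l1 l2 by (simp add: bilinear_map_def)
qed

lemma lift_lift_generator:
  assumes "cvs U" "R \<subseteq> carrier (free_space S)" "R' \<subseteq> carrier (free_space S')"
    "\<And>s. s \<in> S \<Longrightarrow> descends S' R' U (\<beta> s)" "\<And>s'. s' \<in> S' \<Longrightarrow> descends S R U (\<lambda>s. \<beta> s s')"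
    "s \<in> S" "s' \<in> S'"
  shows "lift U (\<lambda>s. lift U (\<beta> s) (generator_class S' R' s')) (generator_class S R s) = \<beta> s s'"
  using lift_generator_class[OF assms(1,2) lift_descends[OF assms(1-5) generator_class_closed[OF assms(3,7)]] assms(6)]
    lift_generator_class[OF assms(1,3) assms(4)[OF assms(6)] assms(7)] by simp

section \<open>Bilinear and multilinear maps\<close>

text \<open>Each bilinear or multilinear relation has one of two shapes, additivity
  \<open>a - (b + c)\<close> or homogeneity \<open>a - k b\<close>. This lemma and the next say when
  a linear extension kills them.\<close>

lemma lin_ext_add_relation:
  assumes "cvs U" "\<phi> \<in> S \<rightarrow> carrier U" "a \<in> S" "b \<in> S" "c \<in> S" "\<phi> a = \<phi> b \<oplus>\<^bsub>U\<^esub> \<phi> c"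
  shows "lin_ext U \<phi> (gen a \<ominus>\<^bsub>free_space S\<^esub> (gen b \<oplus>\<^bsub>free_space S\<^esub> gen c)) = \<zero>\<^bsub>U\<^esub>"
proof -
  note lin = lin_ext_linear[OF assms(1,2)] and g = gen_closed[OF assms(3)] gen_closed[OF assms(4)] gen_closed[OF assms(5)]
  have c: "\<phi> b \<in> carrier U" "\<phi> c \<in> carrier U" using assms by auto
  show ?thesis
    using linear_map_diff[OF cvs_free_space assms(1) lin g(1) cvs_add_closed[OF cvs_free_space g(2,3)]]
      linear_mapD(2)[OF lin g(2,3)] lin_ext_gen[OF assms(1,2)] assms c
    by (metis cvs_add_closed cvs_diff_eq_zero)
qed

lemma lin_ext_smult_relation:
  assumes "cvs U" "\<phi> \<in> S \<rightarrow> carrier U" "a \<in> S" "b \<in> S" "\<phi> a = k \<odot>\<^bsub>U\<^esub> \<phi> b"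
  shows "lin_ext U \<phi> (gen a \<ominus>\<^bsub>free_space S\<^esub> (k \<odot>\<^bsub>free_space S\<^esub> gen b)) = \<zero>\<^bsub>U\<^esub>"
proof -
  note lin = lin_ext_linear[OF assms(1,2)] and g = gen_closed[OF assms(3)] gen_closed[OF assms(4)]
  have c: "\<phi> b \<in> carrier U" using assms by auto
  show ?thesis
    using linear_map_diff[OF cvs_free_space assms(1) lin g(1) cvs_smult_closed[OF cvs_free_space g(2)]]
      linear_mapD(3)[OF lin g(2)] lin_ext_gen[OF assms(1,2)] assms c
    by (metis cvs_smult_closed cvs_diff_eq_zero)
qed

lemma add_relation_closed:
  "a \<in> S \<Longrightarrow> b \<in> S \<Longrightarrow> c \<in> S \<Longrightarrow>
    gen a \<ominus>\<^bsub>free_space S\<^esub> (gen b \<oplus>\<^bsub>free_space S\<^esub> gen c) \<in> carrier (free_space S)"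
  by (intro cvs_diff_closed cvs_add_closed cvs_free_space gen_closed)

lemma smult_relation_closed:
  "a \<in> S \<Longrightarrow> b \<in> S \<Longrightarrow> gen a \<ominus>\<^bsub>free_space S\<^esub> (k \<odot>\<^bsub>free_space S\<^esub> gen b) \<in> carrier (free_space S)"
  by (intro cvs_diff_closed cvs_smult_closed cvs_free_space gen_closed)

text \<open>The reverse passage: a relation of the additive shape that belongs to \<open>R\<close>
  becomes an identity between classes. With its companion for scaling it yields the bilinearity of
  \<open>tens\<close> and the multilinearity of \<open>word\<close>.\<close>

lemma generator_class_add:
  assumes "R \<subseteq> carrier (free_space S)" "a \<in> S" "b \<in> S" "c \<in> S"
    "gen a \<ominus>\<^bsub>free_space S\<^esub> (gen b \<oplus>\<^bsub>free_space S\<^esub> gen c) \<in> R"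
  shows "generator_class S R a = generator_class S R b \<oplus>\<^bsub>presented_space S R\<^esub> generator_class S R c"
proof -
  note sub = lin_span_submodule[OF cvs_free_space assms(1)]
  note g = gen_closed[OF assms(2)] gen_closed[OF assms(3)] gen_closed[OF assms(4)]
  have "gen a \<ominus>\<^bsub>free_space S\<^esub> (gen b \<oplus>\<^bsub>free_space S\<^esub> gen c) \<in> lin_span (free_space S) R"
    by (rule subsetD[OF lin_span_superset[OF cvs_free_space] assms(5)])
  then have "generator_class S R a = lin_span (free_space S) R +>\<^bsub>free_space S\<^esub> (gen b \<oplus>\<^bsub>free_space S\<^esub> gen c)"
    unfolding generator_class_def
    by (rule coset_eq_iff[OF cvs_free_space sub g(1) cvs_add_closed[OF cvs_free_space g(2,3)], THEN iffD2])
  then show ?thesis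
    using linear_mapD(2)[OF coset_linear[OF cvs_free_space sub] g(2,3)]
    by (simp only: generator_class_def presented_space_def)
qed

lemma generator_class_smult:
  assumes "R \<subseteq> carrier (free_space S)" "a \<in> S" "b \<in> S"
    "gen a \<ominus>\<^bsub>free_space S\<^esub> (k \<odot>\<^bsub>free_space S\<^esub> gen b) \<in> R"
  shows "generator_class S R a = k \<odot>\<^bsub>presented_space S R\<^esub> generator_class S R b"
proof -
  note sub = lin_span_submodule[OF cvs_free_space assms(1)]
  note g = gen_closed[OF assms(2)] gen_closed[OF assms(3)]
  have "gen a \<ominus>\<^bsub>free_space S\<^esub> (k \<odot>\<^bsub>free_space S\<^esub> gen b) \<in> lin_span (free_space S) R"
    by (rule subsetD[OF lin_span_superset[OF cvs_free_space] assms(4)])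
  then have "generator_class S R a = lin_span (free_space S) R +>\<^bsub>free_space S\<^esub> (k \<odot>\<^bsub>free_space S\<^esub> gen b)"
    unfolding generator_class_def
    by (rule coset_eq_iff[OF cvs_free_space sub g(1) cvs_smult_closed[OF cvs_free_space g(2)], THEN iffD2])
  then show ?thesis
    using linear_mapD(3)[OF coset_linear[OF cvs_free_space sub] g(2)]
    by (simp only: generator_class_def presented_space_def)
qed

section \<open>The tensor product of two spaces\<close>

lemma tensor_presented: "tensor V W = presented_space (carrier V \<times> carrier W) (bilinear_relations V W)"
  by (simp add: tensor_def bilinear_null_def presented_space_def)

lemma tens_generator:
  "tens V W v w = generator_class (carrier V \<times> carrier W) (bilinear_relations V W) (v, w)"
  by (simp add: tens_def bilinear_null_def generator_class_def)

lemma bilinear_relations_cases: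
  assumes "r \<in> bilinear_relations V W"
  obtains (add_left) v v' w where "v \<in> carrier V" "v' \<in> carrier V" "w \<in> carrier W"
      "r = gen (v \<oplus>\<^bsub>V\<^esub> v', w) \<ominus>\<^bsub>free_space (carrier V \<times> carrier W)\<^esub>
        (gen (v, w) \<oplus>\<^bsub>free_space (carrier V \<times> carrier W)\<^esub> gen (v', w))"
  | (add_right) v w w' where "v \<in> carrier V" "w \<in> carrier W" "w' \<in> carrier W"
      "r = gen (v, w \<oplus>\<^bsub>W\<^esub> w') \<ominus>\<^bsub>free_space (carrier V \<times> carrier W)\<^esub>
        (gen (v, w) \<oplus>\<^bsub>free_space (carrier V \<times> carrier W)\<^esub> gen (v, w'))"
  | (smult_left) c v w where "v \<in> carrier V" "w \<in> carrier W"
      "r = gen (c \<odot>\<^bsub>V\<^esub> v, w) \<ominus>\<^bsub>free_space (carrier V \<times> carrier W)\<^esub>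
        (c \<odot>\<^bsub>free_space (carrier V \<times> carrier W)\<^esub> gen (v, w))"
  | (smult_right) c v w where "v \<in> carrier V" "w \<in> carrier W"
      "r = gen (v, c \<odot>\<^bsub>W\<^esub> w) \<ominus>\<^bsub>free_space (carrier V \<times> carrier W)\<^esub>
        (c \<odot>\<^bsub>free_space (carrier V \<times> carrier W)\<^esub> gen (v, w))"
  using assms unfolding bilinear_relations_def Let_def by blast

lemma bilinear_relations_closed:
  assumes "cvs V" "cvs W"
  shows "bilinear_relations V W \<subseteq> carrier (free_space (carrier V \<times> carrier W))"
proof
  fix r assume "r \<in> bilinear_relations V W"
  then show "r \<in> carrier (free_space (carrier V \<times> carrier W))"
  proof (cases rule: bilinear_relations_cases)
    case add_left
    then show ?thesis using assms by (simp only: add_relation_closed mem_Sigma_iff cvs_add_closed)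
  next
    case add_right
    then show ?thesis using assms by (simp only: add_relation_closed mem_Sigma_iff cvs_add_closed)
  next
    case smult_left
    then show ?thesis using assms by (simp only: smult_relation_closed mem_Sigma_iff cvs_smult_closed)
  next
    case smult_right
    then show ?thesis using assms by (simp only: smult_relation_closed mem_Sigma_iff cvs_smult_closed)
  qed
qed

lemma bilinear_map_descends:
  assumes "cvs V" "cvs W" "cvs U" "bilinear_map V W U \<beta>"
  shows "descends (carrier V \<times> carrier W) (bilinear_relations V W) U (\<lambda>(v, w). \<beta> v w)"
  unfolding descends_def
proof (intro conjI ballI)
  note b = bilinear_mapD[OF assms(4)]
  show c: "(\<lambda>(v, w). \<beta> v w) \<in> carrier V \<times> carrier W \<rightarrow> carrier U"
    using b(3) by auto
  fix r assume "r \<in> bilinear_relations V W"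
  then show "lin_ext U (\<lambda>(v, w). \<beta> v w) r = \<zero>\<^bsub>U\<^esub>"
  proof (cases rule: bilinear_relations_cases)
    case (add_left v v' w)
    show ?thesis unfolding add_left(4)
      by (rule lin_ext_add_relation[OF assms(3) c])
        (use add_left assms(1,2) linear_mapD(2)[OF b(2)[OF add_left(3)]] in auto)
  next
    case (add_right v w w')
    show ?thesis unfolding add_right(4)
      by (rule lin_ext_add_relation[OF assms(3) c])
        (use add_right assms(1,2) linear_mapD(2)[OF b(1)[OF add_right(1)]] in auto)
  next
    case (smult_left k v w)
    show ?thesis unfolding smult_left(3)
      by (rule lin_ext_smult_relation[OF assms(3) c])
        (use smult_left assms(1,2) linear_mapD(3)[OF b(2)[OF smult_left(2)]] in auto)
  next
    case (smult_right k v w)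
    show ?thesis unfolding smult_right(3)
      by (rule lin_ext_smult_relation[OF assms(3) c])
        (use smult_right assms(1,2) linear_mapD(3)[OF b(1)[OF smult_right(1)]] in auto)
  qed
qed

lemma cvs_tensor [simp]: "cvs V \<Longrightarrow> cvs W \<Longrightarrow> cvs (tensor V W)"
  unfolding tensor_presented by (intro cvs_presented_space bilinear_relations_closed)

lemma tens_closed [simp]:
  "cvs V \<Longrightarrow> cvs W \<Longrightarrow> v \<in> carrier V \<Longrightarrow> w \<in> carrier W \<Longrightarrow> tens V W v w \<in> carrier (tensor V W)"
  unfolding tensor_presented tens_generator
  by (rule generator_class_closed[OF bilinear_relations_closed]) auto

lemma tens_bilinear:
  assumes "cvs V" "cvs W"
  shows "bilinear_map V W (tensor V W) (tens V W)"
  unfolding bilinear_map_def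
proof (intro conjI ballI linear_mapI)
  note R = bilinear_relations_closed[OF assms]
  fix v w assume vw: "v \<in> carrier V" "w \<in> carrier W"
  show "tens V W v w \<in> carrier (tensor V W)" using assms vw by simp
  then show "tens V W v w \<in> carrier (tensor V W)" .
  show "tens V W v (k \<odot>\<^bsub>W\<^esub> w) = k \<odot>\<^bsub>tensor V W\<^esub> tens V W v w" for k
    unfolding tens_generator tensor_presented
    by (rule generator_class_smult[OF R]) (use assms vw in \<open>auto simp: bilinear_relations_def Let_def simp del: free_space_simps\<close>)
  show "tens V W (k \<odot>\<^bsub>V\<^esub> v) w = k \<odot>\<^bsub>tensor V W\<^esub> tens V W v w" for k
    unfolding tens_generator tensor_presented
    by (rule generator_class_smult[OF R]) (use assms vw in \<open>auto simp: bilinear_relations_def Let_def simp del: free_space_simps\<close>)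
  show "tens V W v (w \<oplus>\<^bsub>W\<^esub> w') = tens V W v w \<oplus>\<^bsub>tensor V W\<^esub> tens V W v w'" if "w' \<in> carrier W" for w'
    unfolding tens_generator tensor_presented
    by (rule generator_class_add[OF R]) (use assms vw that in \<open>auto simp: bilinear_relations_def Let_def simp del: free_space_simps\<close>)
  show "tens V W (v \<oplus>\<^bsub>V\<^esub> v') w = tens V W v w \<oplus>\<^bsub>tensor V W\<^esub> tens V W v' w" if "v' \<in> carrier V" for v'
    unfolding tens_generator tensor_presented
    by (rule generator_class_add[OF R]) (use assms vw that in \<open>auto simp: bilinear_relations_def Let_def simp del: free_space_simps\<close>)
qed

lemmas tens_linear_left = bilinear_mapD(2)[OF tens_bilinear]
lemmas tens_linear_right = bilinear_mapD(1)[OF tens_bilinear]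

lemma tens_zero [simp]:
  assumes "cvs V" "cvs W"
  shows "w \<in> carrier W \<Longrightarrow> tens V W \<zero>\<^bsub>V\<^esub> w = \<zero>\<^bsub>tensor V W\<^esub>"
    "v \<in> carrier V \<Longrightarrow> tens V W v \<zero>\<^bsub>W\<^esub> = \<zero>\<^bsub>tensor V W\<^esub>"
  using linear_map_zero[OF assms(1) cvs_tensor[OF assms] tens_linear_left[OF assms]]
    linear_map_zero[OF assms(2) cvs_tensor[OF assms] tens_linear_right[OF assms]] by auto

lemma tensor_span:
  assumes "cvs V" "cvs W"
  shows "lin_span (tensor V W) {tens V W v w | v w. v \<in> carrier V \<and> w \<in> carrier W} = carrier (tensor V W)"
proof -
  have "{tens V W v w | v w. v \<in> carrier V \<and> w \<in> carrier W} =
      generator_class (carrier V \<times> carrier W) (bilinear_relations V W) ` (carrier V \<times> carrier W)"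
    by (auto simp: tens_generator)
  then show ?thesis
    using generator_class_span[OF bilinear_relations_closed[OF assms]] by (simp add: tensor_presented)
qed

lemma tensor_linear_map_eqI:
  assumes "cvs V" "cvs W" "cvs U" "linear_map (tensor V W) U f" "linear_map (tensor V W) U g"
    "\<And>v w. v \<in> carrier V \<Longrightarrow> w \<in> carrier W \<Longrightarrow> f (tens V W v w) = g (tens V W v w)"
    "x \<in> carrier (tensor V W)"
  shows "f x = g x"
  by (rule linear_map_eq_on_span[OF cvs_tensor[OF assms(1,2)] assms(3-5) _ _ assms(7)[folded tensor_span[OF assms(1,2)]]])
    (use assms in auto)

lemma lift_tensor_linear:
  assumes "cvs V" "cvs W" "cvs U" "bilinear_map V W U \<beta>"
  shows "linear_map (tensor V W) U (lift U (\<lambda>(v, w). \<beta> v w))"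
  unfolding tensor_presented
  by (rule lift_linear[OF assms(3) bilinear_relations_closed[OF assms(1,2)] bilinear_map_descends[OF assms]])

lemma lift_tens:
  assumes "cvs V" "cvs W" "cvs U" "bilinear_map V W U \<beta>" "v \<in> carrier V" "w \<in> carrier W"
  shows "lift U (\<lambda>(v, w). \<beta> v w) (tens V W v w) = \<beta> v w"
  unfolding tens_generator
  using lift_generator_class[OF assms(3) bilinear_relations_closed[OF assms(1,2)] bilinear_map_descends[OF assms(1-4)],
      of "(v, w)"] assms(5,6) by simp

lemma bilinear_map_comp:
  assumes "bilinear_map V' W' U \<beta>" "linear_map V V' f" "linear_map W W' g"
  shows "bilinear_map V W U (\<lambda>v w. \<beta> (f v) (g w))"
  unfolding bilinear_map_def
  using linear_map_comp[OF bilinear_mapD(1)[OF assms(1) linear_mapD(1)[OF assms(2)]] assms(3)]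
    linear_map_comp[OF bilinear_mapD(2)[OF assms(1) linear_mapD(1)[OF assms(3)]] assms(2)] by simp

lemma linear_map_comp_bilinear:
  assumes "bilinear_map V W U \<beta>" "linear_map U U' h"
  shows "bilinear_map V W U' (\<lambda>v w. h (\<beta> v w))"
  unfolding bilinear_map_def
  using linear_map_comp[OF assms(2) bilinear_mapD(1)[OF assms(1)]] linear_map_comp[OF assms(2) bilinear_mapD(2)[OF assms(1)]]
  by simp

lemma bilinear_map_sum_fun:
  assumes "cvs V" "cvs W" "cvs U" "finite I" "\<And>i. i \<in> I \<Longrightarrow> bilinear_map V W U (\<beta> i)"
  shows "bilinear_map V W U (\<lambda>v w. \<Oplus>\<^bsub>U\<^esub>i\<in>I. \<beta> i v w)"
  unfolding bilinear_map_def
  by (intro conjI ballI linear_map_sum_fun assms bilinear_mapD(1) bilinear_mapD(2)) (use assms in auto)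

lemma tensor_map_linear:
  assumes "cvs V" "cvs W" "cvs V'" "cvs W'" "linear_map V V' f" "linear_map W W' g"
  shows "linear_map (tensor V W) (tensor V' W') (tensor_map V' W' f g)"
  unfolding tensor_map_def
  by (rule lift_tensor_linear[OF assms(1,2) cvs_tensor[OF assms(3,4)] bilinear_map_comp[OF tens_bilinear[OF assms(3,4)] assms(5,6)]])

lemma tensor_map_tens:
  assumes "cvs V" "cvs W" "cvs V'" "cvs W'" "linear_map V V' f" "linear_map W W' g" "v \<in> carrier V" "w \<in> carrier W"
  shows "tensor_map V' W' f g (tens V W v w) = tens V' W' (f v) (g w)"
  unfolding tensor_map_def
  by (rule lift_tens[OF assms(1,2) cvs_tensor[OF assms(3,4)] bilinear_map_comp[OF tens_bilinear[OF assms(3,4)] assms(5,6)] assms(7,8)])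

lemma tensor_map_comp:
  assumes "cvs V" "cvs W" "cvs V'" "cvs W'" "cvs V''" "cvs W''"
    "linear_map V V' f" "linear_map W W' g" "linear_map V' V'' f'" "linear_map W' W'' g'"
    "x \<in> carrier (tensor V W)"
  shows "tensor_map V'' W'' f' g' (tensor_map V' W' f g x) = tensor_map V'' W'' (\<lambda>v. f' (f v)) (\<lambda>w. g' (g w)) x"
proof -
  note 1 = tensor_map_linear[OF assms(1-4,7,8)]
  note 2 = tensor_map_linear[OF assms(3-6,9,10)]
  note 3 = linear_map_comp[OF assms(9,7)] linear_map_comp[OF assms(10,8)]
  note 4 = tensor_map_linear[OF assms(1,2,5,6) 3]
  show ?thesis
  proof (rule tensor_linear_map_eqI[OF assms(1,2) cvs_tensor[OF assms(5,6)] linear_map_comp[OF 2 1] 4 _ assms(11)])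
    fix v w assume vw: "v \<in> carrier V" "w \<in> carrier W"
    show "tensor_map V'' W'' f' g' (tensor_map V' W' f g (tens V W v w)) =
        tensor_map V'' W'' (\<lambda>v. f' (f v)) (\<lambda>w. g' (g w)) (tens V W v w)"
      using tensor_map_tens[OF assms(1-4,7,8) vw] tensor_map_tens[OF assms(1,2,5,6) 3 vw]
        tensor_map_tens[OF assms(3-6,9,10) linear_mapD(1)[OF assms(7) vw(1)] linear_mapD(1)[OF assms(8) vw(2)]]
      by simp
  qed
qed

lemma tensor_map_cong:
  assumes "cvs V" "cvs W" "cvs V'" "cvs W'" "linear_map V V' f" "linear_map W W' g"
    "\<And>v. v \<in> carrier V \<Longrightarrow> f v = f' v" "\<And>w. w \<in> carrier W \<Longrightarrow> g w = g' w" "x \<in> carrier (tensor V W)"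
  shows "tensor_map V' W' f g x = tensor_map V' W' f' g' x"
proof -
  have l: "linear_map V V' f'" "linear_map W W' g'"
    using linear_map_cong assms by blast+
  show ?thesis
    by (rule tensor_linear_map_eqI[OF assms(1,2) cvs_tensor[OF assms(3,4)] tensor_map_linear[OF assms(1-6)]
          tensor_map_linear[OF assms(1-4) l] _ assms(9)])
      (simp add: tensor_map_tens[OF assms(1-6)] tensor_map_tens[OF assms(1-4) l] assms(7,8))
qed

text \<open>This is the shape of \<open>braided_mult\<close>, a \<open>lift\<close> over the second
  tensor nested in one over the first. The kernel in four variables has to be bilinear in each of
  the two pairs with the other pair fixed.\<close>

lemma lift_lift_tensor:
  assumes "cvs V" "cvs W" "cvs V'" "cvs W'" "cvs U"
    "\<And>a b. a \<in> carrier V \<Longrightarrow> b \<in> carrier W \<Longrightarrow> bilinear_map V' W' U (\<beta> a b)"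
    "\<And>c d. c \<in> carrier V' \<Longrightarrow> d \<in> carrier W' \<Longrightarrow> bilinear_map V W U (\<lambda>a b. \<beta> a b c d)"
  shows "bilinear_map (tensor V W) (tensor V' W') U (\<lambda>P Q. lift U (\<lambda>(a, b). lift U (\<lambda>(c, d). \<beta> a b c d) Q) P)"
    and "a \<in> carrier V \<Longrightarrow> b \<in> carrier W \<Longrightarrow> c \<in> carrier V' \<Longrightarrow> d \<in> carrier W' \<Longrightarrow>
      lift U (\<lambda>(a, b). lift U (\<lambda>(c, d). \<beta> a b c d) (tens V' W' c d)) (tens V W a b) = \<beta> a b c d"
proof -
  \<comment> \<open>Uncurrying twice turns the nested case abstractions into a kernel on two
    generators, as the two-variable lift expects.\<close>
  define \<gamma> where "\<gamma> = (\<lambda>(a, b) (c, d). \<beta> a b c d)"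
  have eq: "(\<lambda>(a, b). lift U (\<lambda>(c, d). \<beta> a b c d) Q) = (\<lambda>s. lift U (\<gamma> s) Q)" for Q
    by (auto simp: \<gamma>_def fun_eq_iff)
  have 1: "descends (carrier V' \<times> carrier W') (bilinear_relations V' W') U (\<gamma> s)" if "s \<in> carrier V \<times> carrier W" for s
    using bilinear_map_descends[OF assms(3-5) assms(6)] that by (cases s) (simp add: \<gamma>_def)
  have 2: "descends (carrier V \<times> carrier W) (bilinear_relations V W) U (\<lambda>s. \<gamma> s s')" if "s' \<in> carrier V' \<times> carrier W'" for s'
  proof -
    obtain c d where s': "s' = (c, d)" by (cases s')
    have "(\<lambda>s. \<gamma> s s') = (\<lambda>(a, b). \<beta> a b c d)" by (auto simp: \<gamma>_def s' fun_eq_iff)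
    then show ?thesis using bilinear_map_descends[OF assms(1,2,5) assms(7)] that s' by simp
  qed
  note R = bilinear_relations_closed[OF assms(1,2)] bilinear_relations_closed[OF assms(3,4)]
  show "bilinear_map (tensor V W) (tensor V' W') U (\<lambda>P Q. lift U (\<lambda>(a, b). lift U (\<lambda>(c, d). \<beta> a b c d) Q) P)"
    unfolding eq tensor_presented by (rule lift_lift_bilinear[OF assms(5) R 1 2])
  show "lift U (\<lambda>(a, b). lift U (\<lambda>(c, d). \<beta> a b c d) (tens V' W' c d)) (tens V W a b) = \<beta> a b c d"
    if "a \<in> carrier V" "b \<in> carrier W" "c \<in> carrier V'" "d \<in> carrier W'"
    unfolding eq tens_generator
    using lift_lift_generator[OF assms(5) R 1 2, of "(a, b)" "(c, d)"] that by (simp add: \<gamma>_def)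
qed

text \<open>The construction looks only at carrier, addition and scaling. Hence the tensor squares
  of \<open>tensor_algebra\<close> and \<open>tensor_hopf\<close> are literally that of
  \<open>tensor_space\<close>.\<close>

lemma tensor_cong:
  assumes "carrier V = carrier V'" "add V = add V'" "module.smult V = module.smult V'"
    "carrier W = carrier W'" "add W = add W'" "module.smult W = module.smult W'"
  shows "tensor V W = tensor V' W'" "tens V W = tens V' W'"
proof -
  have "bilinear_relations V W = bilinear_relations V' W'" by (simp add: bilinear_relations_def assms)
  then show "tensor V W = tensor V' W'" "tens V W = tens V' W'"
    by (auto simp: tensor_def tens_def bilinear_null_def assms fun_eq_iff)
qed

section \<open>Multilinear functions of words and the tensor algebra as a space\<close>

definition multilinear_map ::
    "(complex, 'v, 'm) module_scheme \<Rightarrow> (complex, 'u, 'n) module_scheme \<Rightarrow> ('v list \<Rightarrow> 'u) \<Rightarrow> bool" where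
  "multilinear_map M U \<phi> \<longleftrightarrow>
     \<phi> \<in> lists (carrier M) \<rightarrow> carrier U \<and>
     (\<forall>xs\<in>lists (carrier M). \<forall>ys\<in>lists (carrier M). linear_map M U (\<lambda>a. \<phi> (xs @ [a] @ ys)))"

lemma multilinear_relations_cases:
  assumes "r \<in> multilinear_relations M"
  obtains (add) xs a b ys where "xs \<in> lists (carrier M)" "a \<in> carrier M" "b \<in> carrier M" "ys \<in> lists (carrier M)"
      "r = gen (xs @ [a \<oplus>\<^bsub>M\<^esub> b] @ ys) \<ominus>\<^bsub>free_space (lists (carrier M))\<^esub>
        (gen (xs @ [a] @ ys) \<oplus>\<^bsub>free_space (lists (carrier M))\<^esub> gen (xs @ [b] @ ys))"
  | (smult) xs c a ys where "xs \<in> lists (carrier M)" "a \<in> carrier M" "ys \<in> lists (carrier M)"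
      "r = gen (xs @ [c \<odot>\<^bsub>M\<^esub> a] @ ys) \<ominus>\<^bsub>free_space (lists (carrier M))\<^esub>
        (c \<odot>\<^bsub>free_space (lists (carrier M))\<^esub> gen (xs @ [a] @ ys))"
  using assms unfolding multilinear_relations_def Let_def by blast

lemma append_in_lists: "xs \<in> lists A \<Longrightarrow> a \<in> A \<Longrightarrow> ys \<in> lists A \<Longrightarrow> xs @ [a] @ ys \<in> lists A"
  by auto

lemma multilinear_relations_closed:
  assumes "cvs M"
  shows "multilinear_relations M \<subseteq> carrier (free_space (lists (carrier M)))"
proof
  fix r assume "r \<in> multilinear_relations M"
  then show "r \<in> carrier (free_space (lists (carrier M)))"
    by (cases rule: multilinear_relations_cases)
      (simp_all only: add_relation_closed smult_relation_closed append_in_lists cvs_add_closed[OF assms] cvs_smult_closed[OF assms])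
qed

lemma multilinear_map_descends:
  assumes "cvs M" "cvs U" "multilinear_map M U \<phi>"
  shows "descends (lists (carrier M)) (multilinear_relations M) U \<phi>"
  unfolding descends_def
proof (intro conjI ballI)
  show c: "\<phi> \<in> lists (carrier M) \<rightarrow> carrier U" using assms(3) by (simp only: multilinear_map_def)
  have lin: "linear_map M U (\<lambda>a. \<phi> (xs @ [a] @ ys))" if "xs \<in> lists (carrier M)" "ys \<in> lists (carrier M)" for xs ys
    using assms(3) that unfolding multilinear_map_def by blast
  fix r assume "r \<in> multilinear_relations M"
  then show "lin_ext U \<phi> r = \<zero>\<^bsub>U\<^esub>"
  proof (cases rule: multilinear_relations_cases)
    case (add xs a b ys)
    show ?thesis unfolding add(5)
      by (rule lin_ext_add_relation[OF assms(2) c])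
        (use add linear_mapD(2)[OF lin[OF add(1,4)] add(2,3)] in
          \<open>simp_all only: append_in_lists cvs_add_closed[OF assms(1)]\<close>)
  next
    case (smult xs k a ys)
    show ?thesis unfolding smult(4)
      by (rule lin_ext_smult_relation[OF assms(2) c])
        (use smult linear_mapD(3)[OF lin[OF smult(1,3)] smult(2)] in
          \<open>simp_all only: append_in_lists cvs_smult_closed[OF assms(1)]\<close>)
  qed
qed

lemma tensor_space_presented: "tensor_space M = presented_space (lists (carrier M)) (multilinear_relations M)"
  by (simp add: tensor_space_def multilinear_null_def presented_space_def)

lemma word_generator: "word M = generator_class (lists (carrier M)) (multilinear_relations M)"
  by (simp add: word_def multilinear_null_def generator_class_def fun_eq_iff)

lemma cvs_tensor_space [simp]: "cvs M \<Longrightarrow> cvs (tensor_space M)"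
  unfolding tensor_space_presented by (intro cvs_presented_space multilinear_relations_closed)

lemma word_closed [simp]: "cvs M \<Longrightarrow> w \<in> lists (carrier M) \<Longrightarrow> word M w \<in> carrier (tensor_space M)"
  unfolding tensor_space_presented word_generator
  by (rule generator_class_closed[OF multilinear_relations_closed])

lemma word_multilinear:
  assumes "cvs M"
  shows "multilinear_map M (tensor_space M) (word M)"
  unfolding multilinear_map_def
proof (intro conjI ballI linear_mapI)
  show "word M \<in> lists (carrier M) \<rightarrow> carrier (tensor_space M)" using assms by auto
  note R = multilinear_relations_closed[OF assms]
  fix xs ys a assume xy: "xs \<in> lists (carrier M)" "ys \<in> lists (carrier M)" and a: "a \<in> carrier M"
  show "word M (xs @ [a] @ ys) \<in> carrier (tensor_space M)"
    using assms xy a by (intro word_closed append_in_lists)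
  show "word M (xs @ [k \<odot>\<^bsub>M\<^esub> a] @ ys) = k \<odot>\<^bsub>tensor_space M\<^esub> word M (xs @ [a] @ ys)" for k
    unfolding tensor_space_presented word_generator
  proof (rule generator_class_smult[OF R])
    show "gen (xs @ [k \<odot>\<^bsub>M\<^esub> a] @ ys) \<ominus>\<^bsub>free_space (lists (carrier M))\<^esub>
        (k \<odot>\<^bsub>free_space (lists (carrier M))\<^esub> gen (xs @ [a] @ ys)) \<in> multilinear_relations M"
      unfolding multilinear_relations_def Let_def using xy a by blast
  qed (intro append_in_lists xy a cvs_smult_closed assms)+
  show "word M (xs @ [a \<oplus>\<^bsub>M\<^esub> b] @ ys) = word M (xs @ [a] @ ys) \<oplus>\<^bsub>tensor_space M\<^esub> word M (xs @ [b] @ ys)"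
    if b: "b \<in> carrier M" for b
    unfolding tensor_space_presented word_generator
  proof (rule generator_class_add[OF R])
    show "gen (xs @ [a \<oplus>\<^bsub>M\<^esub> b] @ ys) \<ominus>\<^bsub>free_space (lists (carrier M))\<^esub>
        (gen (xs @ [a] @ ys) \<oplus>\<^bsub>free_space (lists (carrier M))\<^esub> gen (xs @ [b] @ ys)) \<in> multilinear_relations M"
      unfolding multilinear_relations_def Let_def using xy a b by blast
  qed (intro append_in_lists xy a b cvs_add_closed assms)+
qed

lemma words_closed: "cvs M \<Longrightarrow> word M ` lists (carrier M) \<subseteq> carrier (tensor_space M)"
  by (rule image_subsetI) (rule word_closed)

lemma word_span: "cvs M \<Longrightarrow> lin_span (tensor_space M) (word M ` lists (carrier M)) = carrier (tensor_space M)"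
  unfolding tensor_space_presented word_generator
  by (rule generator_class_span[OF multilinear_relations_closed])

lemma tensor_space_linear_map_eqI:
  assumes "cvs M" "cvs U" "linear_map (tensor_space M) U f" "linear_map (tensor_space M) U g"
    "\<And>w. w \<in> lists (carrier M) \<Longrightarrow> f (word M w) = g (word M w)" "x \<in> carrier (tensor_space M)"
  shows "f x = g x"
  by (rule linear_map_eq_on_span[OF cvs_tensor_space[OF assms(1)] assms(2-4) words_closed[OF assms(1)] _
        assms(6)[folded word_span[OF assms(1)]]])
    (use assms(5) in blast)

lemma tensor_space_bilinear_map_eqI:
  assumes "cvs M" "cvs N" "cvs U" "bilinear_map (tensor_space M) (tensor_space N) U \<beta>"
    "bilinear_map (tensor_space M) (tensor_space N) U \<gamma>"
    "\<And>v w. v \<in> lists (carrier M) \<Longrightarrow> w \<in> lists (carrier N) \<Longrightarrow> \<beta> (word M v) (word N w) = \<gamma> (word M v) (word N w)"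
    "x \<in> carrier (tensor_space M)" "y \<in> carrier (tensor_space N)"
  shows "\<beta> x y = \<gamma> x y"
  by (rule bilinear_map_eq_on_span[OF cvs_tensor_space[OF assms(1)] cvs_tensor_space[OF assms(2)] assms(3-5)
        words_closed[OF assms(1)] words_closed[OF assms(2)] _
        assms(7)[folded word_span[OF assms(1)]] assms(8)[folded word_span[OF assms(2)]]])
    (use assms(6) in blast)

lemma lift_word_linear:
  "cvs M \<Longrightarrow> cvs U \<Longrightarrow> multilinear_map M U \<phi> \<Longrightarrow> linear_map (tensor_space M) U (lift U \<phi>)"
  unfolding tensor_space_presented
  by (rule lift_linear[OF _ multilinear_relations_closed multilinear_map_descends])

lemma lift_word:
  "cvs M \<Longrightarrow> cvs U \<Longrightarrow> multilinear_map M U \<phi> \<Longrightarrow> w \<in> lists (carrier M) \<Longrightarrow> lift U \<phi> (word M w) = \<phi> w"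
  unfolding word_generator
  by (rule lift_generator_class[OF _ multilinear_relations_closed multilinear_map_descends])

text \<open>This matches the nested \<open>lift\<close> in \<open>tensor_mult\<close>, where the
  kernel is multilinear in each of two words.\<close>

lemma lift_lift_word:
  assumes "cvs M" "cvs U"
    "\<And>v. v \<in> lists (carrier M) \<Longrightarrow> multilinear_map M U (\<beta> v)"
    "\<And>w. w \<in> lists (carrier M) \<Longrightarrow> multilinear_map M U (\<lambda>v. \<beta> v w)"
  shows "bilinear_map (tensor_space M) (tensor_space M) U (\<lambda>A B. lift U (\<lambda>v. lift U (\<beta> v) B) A)"
    and "v \<in> lists (carrier M) \<Longrightarrow> w \<in> lists (carrier M) \<Longrightarrow>
      lift U (\<lambda>v. lift U (\<beta> v) (word M w)) (word M v) = \<beta> v w"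
proof -
  note R = multilinear_relations_closed[OF assms(1)]
  note d = multilinear_map_descends[OF assms(1,2,3)] multilinear_map_descends[OF assms(1,2,4)]
  show "bilinear_map (tensor_space M) (tensor_space M) U (\<lambda>A B. lift U (\<lambda>v. lift U (\<beta> v) B) A)"
    unfolding tensor_space_presented by (rule lift_lift_bilinear[OF assms(2) R R d])
  show "lift U (\<lambda>v. lift U (\<beta> v) (word M w)) (word M v) = \<beta> v w"
    if "v \<in> lists (carrier M)" "w \<in> lists (carrier M)"
    unfolding word_generator by (rule lift_lift_generator[OF assms(2) R R d that])
qed

lemma multilinear_map_map:
  assumes "multilinear_map N U \<phi>" "linear_map M N f"
  shows "multilinear_map M U (\<lambda>w. \<phi> (map f w))"
proof -
  have map: "map f w \<in> lists (carrier N)" if "w \<in> lists (carrier M)" for w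
    using that linear_mapD(1)[OF assms(2)] by (auto simp: in_lists_conv_set)
  have "\<phi> (map f w) \<in> carrier U" if "w \<in> lists (carrier M)" for w
    using assms(1) map[OF that] unfolding multilinear_map_def by blast
  moreover have "linear_map M U (\<lambda>a. \<phi> (map f (xs @ [a] @ ys)))" if "xs \<in> lists (carrier M)" "ys \<in> lists (carrier M)" for xs ys
  proof -
    have "linear_map N U (\<lambda>a. \<phi> (map f xs @ [a] @ map f ys))"
      using assms(1) map that unfolding multilinear_map_def by blast
    then show ?thesis using linear_map_comp[OF _ assms(2)] by fastforce
  qed
  ultimately show ?thesis unfolding multilinear_map_def by blast
qed

lemma multilinear_map_append:
  assumes "multilinear_map M U \<phi>"
  shows "v \<in> lists (carrier M) \<Longrightarrow> multilinear_map M U (\<lambda>w. \<phi> (v @ w))"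
    and "w \<in> lists (carrier M) \<Longrightarrow> multilinear_map M U (\<lambda>v. \<phi> (v @ w))"
proof -
  have c: "\<phi> u \<in> carrier U" if "u \<in> lists (carrier M)" for u
    using assms that unfolding multilinear_map_def by blast
  have l: "linear_map M U (\<lambda>a. \<phi> (xs @ a # ys))" if "xs \<in> lists (carrier M)" "ys \<in> lists (carrier M)" for xs ys
    using assms that unfolding multilinear_map_def by fastforce
  show "multilinear_map M U (\<lambda>w. \<phi> (v @ w))" if v: "v \<in> lists (carrier M)"
    unfolding multilinear_map_def
    using c l[of "v @ _"] v by (auto simp del: append_assoc simp: append_assoc[symmetric])
  show "multilinear_map M U (\<lambda>v. \<phi> (v @ w))" if w: "w \<in> lists (carrier M)"
    unfolding multilinear_map_def
    using c l[of _ "_ @ w"] w by auto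
qed

text \<open>\<open>word_comult\<close> and \<open>word_antipode\<close> peel off the first letter
  and apply a bilinear step. A first letter enters through the first argument of the step; a later
  letter enters through the value on the tail, so its linearity is inherited by induction on the
  prefix.\<close>

lemma multilinear_map_rec:
  assumes "cvs M" "cvs U" "\<phi> [] \<in> carrier U" "bilinear_map M U U \<Psi>"
    "\<And>x w. x \<in> carrier M \<Longrightarrow> w \<in> lists (carrier M) \<Longrightarrow> \<phi> (x # w) = \<Psi> x (\<phi> w)"
  shows "multilinear_map M U \<phi>"
proof -
  note b = bilinear_mapD[OF assms(4)]
  have c: "\<phi> w \<in> carrier U" if "w \<in> lists (carrier M)" for w
    using that by (induction w) (auto simp: assms(3,5) b(3))
  have "linear_map M U (\<lambda>a. \<phi> (xs @ [a] @ ys))" if "xs \<in> lists (carrier M)" "ys \<in> lists (carrier M)" for xs ys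
    using that(1)
  proof (induction xs)
    case Nil
    have "linear_map M U (\<lambda>a. \<Psi> a (\<phi> ys))" by (rule b(2)[OF c[OF that(2)]])
    then have "linear_map M U (\<lambda>a. \<phi> (a # ys))"
      by (rule linear_map_cong) (use assms(1,5) that(2) in auto)
    then show ?case by simp
  next
    case (Cons x xs)
    then have x: "x \<in> carrier M" "xs \<in> lists (carrier M)" by auto
    have "linear_map M U (\<lambda>a. \<Psi> x (\<phi> (xs @ [a] @ ys)))"
      using linear_map_comp[OF b(1)[OF x(1)] Cons.IH] .
    then have "linear_map M U (\<lambda>a. \<phi> (x # (xs @ [a] @ ys)))"
      by (rule linear_map_cong) (use assms(1,5) x that(2) in auto)
    then show ?case by simp
  qed
  then show ?thesis using c unfolding multilinear_map_def by blast
qed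

section \<open>The tensor algebra of a Yetter-Drinfeld module\<close>

lemma bilinear_map_flip: "bilinear_map V W U \<beta> \<Longrightarrow> bilinear_map W V U (\<lambda>w v. \<beta> v w)"
  by (auto simp: bilinear_map_def)

text \<open>Sums and differences over \<open>tensor_algebra\<close> or \<open>tensor_hopf\<close>
  are formally different constants from those over \<open>tensor_space\<close>; since the underlying
  fields agree, so do these derived operations.\<close>

lemma finsum_cong_structure:
  assumes "carrier V = carrier V'" "add V = add V'" "\<zero>\<^bsub>V\<^esub> = \<zero>\<^bsub>V'\<^esub>"
  shows "finsum V = finsum V'" "a_inv V = a_inv V'" "a_minus V = a_minus V'"
proof -
  show "finsum V = finsum V'"
    by (auto simp: finsum_def finprod_def assms fun_eq_iff)
  show "a_inv V = a_inv V'"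
    by (auto simp: a_inv_def m_inv_def assms fun_eq_iff)
  then show "a_minus V = a_minus V'"
    by (auto simp: a_minus_def assms fun_eq_iff)
qed

lemma submodule_cong_structure:
  assumes "cvs V" "carrier V' = carrier V" "add V' = add V" "\<zero>\<^bsub>V'\<^esub> = \<zero>\<^bsub>V\<^esub>" "module.smult V' = module.smult V"
  shows "submodule W \<C> V' \<longleftrightarrow> submodule W \<C> V" "lin_span V' = lin_span V"
proof -
  note V' = cvs_cong[OF assms]
  show *: "submodule W \<C> V' \<longleftrightarrow> submodule W \<C> V" for W
    unfolding submodule_iff[OF assms(1)] submodule_iff[OF V'] assms(2-) ..
  then show "lin_span V' = lin_span V" by (simp add: lin_span_def fun_eq_iff)
qed

lemma quot_space_cong_structure:
  assumes "carrier V' = carrier V" "add V' = add V" "module.smult V' = module.smult V"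
  shows "a_r_coset V' = a_r_coset V" "quot_space V' = quot_space V"
proof -
  show c: "a_r_coset V' = a_r_coset V" by (simp add: fun_eq_iff a_r_coset_def' assms)
  have "set_add V' = set_add V" by (simp add: fun_eq_iff set_add_def' assms)
  then show "quot_space V' = quot_space V"
    by (simp add: fun_eq_iff quot_space_def A_RCOSETS_def' c assms)
qed

lemma tensor_algebra_simps [simp]:
  "carrier (tensor_algebra G M) = carrier (tensor_space M)"
  "monoid.mult (tensor_algebra G M) = tensor_mult M"
  "\<one>\<^bsub>tensor_algebra G M\<^esub> = word M []"
  "\<zero>\<^bsub>tensor_algebra G M\<^esub> = \<zero>\<^bsub>tensor_space M\<^esub>"
  "add (tensor_algebra G M) = add (tensor_space M)"
  "module.smult (tensor_algebra G M) = module.smult (tensor_space M)"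
  by (simp_all add: tensor_algebra_def)

lemma tensor_hopf_simps [simp]:
  "carrier (tensor_hopf G M) = carrier (tensor_space M)"
  "monoid.mult (tensor_hopf G M) = tensor_mult M"
  "\<one>\<^bsub>tensor_hopf G M\<^esub> = word M []"
  "\<zero>\<^bsub>tensor_hopf G M\<^esub> = \<zero>\<^bsub>tensor_space M\<^esub>"
  "add (tensor_hopf G M) = add (tensor_space M)"
  "module.smult (tensor_hopf G M) = module.smult (tensor_space M)"
  "action (tensor_hopf G M) = action (tensor_algebra G M)"
  "coact (tensor_hopf G M) = coact (tensor_algebra G M)"
  by (simp_all add: tensor_hopf_def Let_def)

lemma tensor_tensor_algebra [simp]:
  "tensor (tensor_algebra G M) (tensor_algebra G M) = tensor (tensor_space M) (tensor_space M)"
  "tens (tensor_algebra G M) (tensor_algebra G M) = tens (tensor_space M) (tensor_space M)"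
  "tensor (tensor_hopf G M) (tensor_hopf G M) = tensor (tensor_space M) (tensor_space M)"
  "tens (tensor_hopf G M) (tensor_hopf G M) = tens (tensor_space M) (tensor_space M)"
  by (simp_all add: tensor_cong[of "tensor_algebra G M" "tensor_space M" "tensor_algebra G M" "tensor_space M"]
      tensor_cong[of "tensor_hopf G M" "tensor_space M" "tensor_hopf G M" "tensor_space M"])

lemma finsum_tensor_algebra [simp]:
  "finsum (tensor_algebra G M) = finsum (tensor_space M)"
  "a_inv (tensor_algebra G M) = a_inv (tensor_space M)"
  by (rule finsum_cong_structure; simp)+

text \<open>The ground field as a vector space. The record \<open>\<C>\<close> has no scaling field,
  and the counit needs a target for which \<open>linear_map\<close> and \<open>lift\<close> make
  sense.\<close>

definition complex_space :: "(complex, complex) module" where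
  "complex_space = \<lparr>carrier = UNIV, monoid.mult = undefined, one = undefined,
     ring.zero = 0, add = (+), module.smult = (*)\<rparr>"

lemma complex_space_simps [simp]:
  "carrier complex_space = UNIV" "\<zero>\<^bsub>complex_space\<^esub> = 0" "add complex_space = (+)" "module.smult complex_space = (*)"
  by (simp_all add: complex_space_def)

lemma cvs_complex_space [simp]: "cvs complex_space"
  by (rule cvsI) (auto simp: algebra_simps)

text \<open>Linearity of the action and of the coaction components makes all structure maps of the
  tensor algebra well defined on classes of words. The arrow module is placed in this locale, the
  class module in the stronger \<open>yd\<close>.\<close>

locale linear_yd =
  fixes G :: "('g, 'm) monoid_scheme" and M :: "('g, 'v) yd_module"
  assumes group_G: "group G" and finite_G: "finite (carrier G)" and cvs_M: "cvs M"
    and action_linear: "h \<in> carrier G \<Longrightarrow> linear_map M M (action M h)"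
    and coact_linear: "h \<in> carrier G \<Longrightarrow> linear_map M M (\<lambda>x. coact M x h)"
begin

abbreviation "T \<equiv> tensor_space M"
abbreviation "TT \<equiv> tensor (tensor_space M) (tensor_space M)"
abbreviation "mul \<equiv> tensor_mult M"
abbreviation "act \<equiv> action (tensor_algebra G M)"
abbreviation "coa \<equiv> coact (tensor_algebra G M)"
abbreviation "ten \<equiv> tens (tensor_space M) (tensor_space M)"
abbreviation "bmul \<equiv> braided_mult G (tensor_algebra G M)"
abbreviation "Delta \<equiv> comult (tensor_hopf G M)"
abbreviation "anti \<equiv> antipode (tensor_hopf G M)"
abbreviation "eps \<equiv> counit (tensor_hopf G M)"

lemma cvs_T: "cvs T"
  using cvs_M by simp

lemma cvs_TT: "cvs TT"
  using cvs_T by simp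

lemma one_closed: "\<one>\<^bsub>G\<^esub> \<in> carrier G"
  using group_G by (simp add: group.is_monoid monoid.one_closed)

lemma mul_bilinear: "bilinear_map T T T mul"
  and mul_word: "v \<in> lists (carrier M) \<Longrightarrow> w \<in> lists (carrier M) \<Longrightarrow> mul (word M v) (word M w) = word M (v @ w)"
proof -
  have eq: "mul = (\<lambda>A B. lift T (\<lambda>v. lift T ((\<lambda>v w. word M (v @ w)) v) B) A)"
    by (simp add: fun_eq_iff tensor_mult_def)
  note 1 = multilinear_map_append[OF word_multilinear[OF cvs_M]]
  show "bilinear_map T T T mul"
    unfolding eq by (rule lift_lift_word(1)[OF cvs_M cvs_T 1])
  show "v \<in> lists (carrier M) \<Longrightarrow> w \<in> lists (carrier M) \<Longrightarrow> mul (word M v) (word M w) = word M (v @ w)"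
    unfolding eq by (rule lift_lift_word(2)[OF cvs_M cvs_T 1])
qed

lemmas mul_linear_right = bilinear_mapD(1)[OF mul_bilinear]
lemmas mul_linear_left = bilinear_mapD(2)[OF mul_bilinear]
lemmas mul_closed [simp] = bilinear_mapD(3)[OF mul_bilinear]

lemma word_cl: "w \<in> lists (carrier M) \<Longrightarrow> word M w \<in> carrier T"
  using cvs_M by (rule word_closed)

lemma unit_closed [simp]: "word M [] \<in> carrier T"
  by (rule word_cl) simp

lemma letter_closed [simp]: "x \<in> carrier M \<Longrightarrow> word M [x] \<in> carrier T"
  by (rule word_cl) simp

lemma letter_linear: "linear_map M T (\<lambda>x. word M [x])"
proof -
  have "linear_map M T (\<lambda>a. word M ([] @ [a] @ []))"
    using word_multilinear[OF cvs_M] unfolding multilinear_map_def by blast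
  then show ?thesis by simp
qed

lemma mul_unit_left [simp]: "a \<in> carrier T \<Longrightarrow> mul (word M []) a = a"
  by (rule tensor_space_linear_map_eqI[OF cvs_M cvs_T mul_linear_right linear_map_id])
    (simp_all add: mul_word del: in_lists_conv_set)

lemma mul_unit_right [simp]: "a \<in> carrier T \<Longrightarrow> mul a (word M []) = a"
  by (rule tensor_space_linear_map_eqI[OF cvs_M cvs_T mul_linear_left linear_map_id])
    (simp_all add: mul_word del: in_lists_conv_set)

text \<open>On words this is associativity of \<open>@\<close>. It is extended linearly in the last
  argument with words in the first two, and then bilinearly in those two.\<close>

lemma mul_assoc:
  assumes "a \<in> carrier T" "b \<in> carrier T" "c \<in> carrier T"
  shows "mul (mul a b) c = mul a (mul b c)"
proof -
  have w: "mul (mul (word M u) (word M v)) c = mul (word M u) (mul (word M v) c)"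
    if "u \<in> lists (carrier M)" "v \<in> lists (carrier M)" for u v
  proof -
    have cl: "word M u \<in> carrier T" "word M v \<in> carrier T" "mul (word M u) (word M v) \<in> carrier T"
      using that word_cl by simp_all
    show ?thesis
      by (rule tensor_space_linear_map_eqI[OF cvs_M cvs_T mul_linear_right[OF cl(3)]
            linear_map_comp[OF mul_linear_right[OF cl(1)] mul_linear_right[OF cl(2)]] _ assms(3)])
        (use that in \<open>simp add: mul_word append_in_lists_conv del: in_lists_conv_set\<close>)
  qed
  show ?thesis
    by (rule tensor_space_bilinear_map_eqI[OF cvs_M cvs_M cvs_T
          linear_map_comp_bilinear[OF mul_bilinear mul_linear_left[OF assms(3)]]
          bilinear_map_comp[OF mul_bilinear linear_map_id mul_linear_left[OF assms(3)]] w assms(1,2)])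
qed

text \<open>The ring laws give access to the facts on generated ideals \<open>Idl\<close>, in terms
  of which \<open>nichols_ideals\<close> is defined.\<close>

lemma ring_tensor_hopf: "ring (tensor_hopf G M)"
proof (rule ringI)
  have "cvs (tensor_hopf G M)" by (rule cvs_cong[OF cvs_T]) simp_all
  then show "abelian_group (tensor_hopf G M)" by (rule cvs_abelian_group)
  show "monoid (tensor_hopf G M)"
    by (rule monoidI) (simp_all add: mul_assoc)
qed (use linear_mapD(2)[OF mul_linear_left] linear_mapD(2)[OF mul_linear_right] in simp_all)

lemma act_eq: "act h A = lift T (\<lambda>w. word M (map (action M h) w)) A"
  by (simp add: tensor_algebra_def)

lemma coa_eq: "coa A h = lift T (\<lambda>w. word_coact G M w h) A"
  by (simp add: tensor_algebra_def)

lemma map_action_lists: "h \<in> carrier G \<Longrightarrow> w \<in> lists (carrier M) \<Longrightarrow> map (action M h) w \<in> lists (carrier M)"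
  using linear_mapD(1)[OF action_linear] by auto

lemma act_linear: "h \<in> carrier G \<Longrightarrow> linear_map T T (act h)"
  and act_word: "h \<in> carrier G \<Longrightarrow> w \<in> lists (carrier M) \<Longrightarrow> act h (word M w) = word M (map (action M h) w)"
proof -
  assume h: "h \<in> carrier G"
  note m = multilinear_map_map[OF word_multilinear[OF cvs_M] action_linear[OF h]]
  show "linear_map T T (act h)"
    by (rule linear_map_cong[OF lift_word_linear[OF cvs_M cvs_T m] _ cvs_T]) (simp add: act_eq)
  show "w \<in> lists (carrier M) \<Longrightarrow> act h (word M w) = word M (map (action M h) w)"
    unfolding act_eq by (rule lift_word[OF cvs_M cvs_T m])
qed

lemmas act_closed [simp] = linear_mapD(1)[OF act_linear]

lemma act_unit [simp]: "h \<in> carrier G \<Longrightarrow> act h (word M []) = word M []"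
  by (simp add: act_word)

lemma act_mul:
  assumes "h \<in> carrier G" "a \<in> carrier T" "b \<in> carrier T"
  shows "act h (mul a b) = mul (act h a) (act h b)"
  by (rule tensor_space_bilinear_map_eqI[OF cvs_M cvs_M cvs_T linear_map_comp_bilinear[OF mul_bilinear act_linear[OF assms(1)]]
        bilinear_map_comp[OF mul_bilinear act_linear[OF assms(1)] act_linear[OF assms(1)]] _ assms(2,3)])
    (use assms(1) map_action_lists in \<open>simp add: mul_word act_word append_in_lists_conv del: in_lists_conv_set\<close>)

lemma coact_closed: "x \<in> carrier M \<Longrightarrow> h \<in> carrier G \<Longrightarrow> coact M x h \<in> carrier M"
  using linear_mapD(1)[OF coact_linear] .

lemma word_coact_closed:
  "w \<in> lists (carrier M) \<Longrightarrow> h \<in> carrier G \<Longrightarrow> word_coact G M w h \<in> carrier T"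
proof (induction w arbitrary: h)
  case Nil
  then show ?case using cvs_T by simp
next
  case (Cons x w)
  interpret group G by (rule group_G)
  show ?case
    unfolding word_coact.simps
    by (rule cvs_sum_closed[OF cvs_T]) (use Cons coact_closed in auto)
qed

text \<open>The recursion of \<open>word_coact\<close> evaluates the tail at the shifted element
  \<open>inv g \<otimes> h\<close>, so the induction on the prefix is done for all \<open>h\<close>
  simultaneously.\<close>

lemma word_coact_multilinear:
  assumes "h \<in> carrier G"
  shows "multilinear_map M T (\<lambda>w. word_coact G M w h)"
proof -
  interpret group G by (rule group_G)
  have "linear_map M T (\<lambda>a. word_coact G M (xs @ [a] @ ys) h)"
    if "xs \<in> lists (carrier M)" "ys \<in> lists (carrier M)" "h \<in> carrier G" for xs ys h
    using that(1,3)
  proof (induction xs arbitrary: h)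
    case Nil
    have "linear_map M T (\<lambda>a. \<Oplus>\<^bsub>T\<^esub>g\<in>carrier G. mul (word M [coact M a g]) (word_coact G M ys (inv\<^bsub>G\<^esub> g \<otimes>\<^bsub>G\<^esub> h)))"
      by (intro linear_map_sum_fun cvs_M cvs_T finite_G linear_map_comp[OF mul_linear_left]
          linear_map_comp[OF letter_linear coact_linear] word_coact_closed that(2)) (use Nil in auto)
    then show ?case by simp
  next
    case (Cons x xs)
    have "linear_map M T (\<lambda>a. \<Oplus>\<^bsub>T\<^esub>g\<in>carrier G. mul (word M [coact M x g]) (word_coact G M (xs @ [a] @ ys) (inv\<^bsub>G\<^esub> g \<otimes>\<^bsub>G\<^esub> h)))"
      by (intro linear_map_sum_fun cvs_M cvs_T finite_G linear_map_comp[OF mul_linear_right])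
        (use Cons coact_closed in auto)
    then show ?case by simp
  qed
  then show ?thesis using word_coact_closed assms unfolding multilinear_map_def by blast
qed

lemma coa_linear: "h \<in> carrier G \<Longrightarrow> linear_map T T (\<lambda>a. coa a h)"
  unfolding coa_eq by (intro lift_word_linear cvs_M cvs_T word_coact_multilinear)

lemmas coa_closed [simp] = linear_mapD(1)[OF coa_linear]

lemma coa_word: "h \<in> carrier G \<Longrightarrow> w \<in> lists (carrier M) \<Longrightarrow> coa (word M w) h = word_coact G M w h"
  unfolding coa_eq by (intro lift_word cvs_M cvs_T word_coact_multilinear)

section \<open>Braided product, comultiplication, antipode and counit of the tensor algebra\<close>

definition "bterm a b c d = (\<Oplus>\<^bsub>TT\<^esub>g\<in>carrier G. ten (mul a (act g c)) (mul (coa b g) d))"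

lemma bmul_eq: "bmul P Q = lift TT (\<lambda>(a, b). lift TT (\<lambda>(c, d). bterm a b c d) Q) P"
  by (simp add: braided_mult_def bterm_def)

lemma bterm_bilinear:
  shows "a \<in> carrier T \<Longrightarrow> b \<in> carrier T \<Longrightarrow> bilinear_map T T TT (bterm a b)"
    and "c \<in> carrier T \<Longrightarrow> d \<in> carrier T \<Longrightarrow> bilinear_map T T TT (\<lambda>a b. bterm a b c d)"
  unfolding bterm_def
  by (intro bilinear_map_sum_fun cvs_T cvs_TT finite_G bilinear_map_comp[OF tens_bilinear]
      linear_map_comp[OF mul_linear_right] act_linear mul_linear_right coa_closed; assumption)
    (intro bilinear_map_sum_fun cvs_T cvs_TT finite_G bilinear_map_comp[OF tens_bilinear]
      linear_map_comp[OF mul_linear_left] coa_linear mul_linear_left act_closed; assumption)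

lemma bmul_bilinear: "bilinear_map TT TT TT bmul"
  unfolding bmul_eq by (rule lift_lift_tensor(1)[OF cvs_T cvs_T cvs_T cvs_T cvs_TT bterm_bilinear])

lemma bmul_tens:
  "a \<in> carrier T \<Longrightarrow> b \<in> carrier T \<Longrightarrow> c \<in> carrier T \<Longrightarrow> d \<in> carrier T \<Longrightarrow>
    bmul (ten a b) (ten c d) = bterm a b c d"
  unfolding bmul_eq by (rule lift_lift_tensor(2)[OF cvs_T cvs_T cvs_T cvs_T cvs_TT bterm_bilinear])

lemma ten_closed [simp]: "a \<in> carrier T \<Longrightarrow> b \<in> carrier T \<Longrightarrow> ten a b \<in> carrier TT"
  using cvs_T by simp

definition "primitive x = ten (word M [x]) (word M []) \<oplus>\<^bsub>TT\<^esub> ten (word M []) (word M [x])"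

lemma primitive_linear: "linear_map M TT primitive"
  unfolding primitive_def
  by (intro linear_map_plus cvs_TT linear_map_comp[OF tens_linear_left letter_linear]
      linear_map_comp[OF tens_linear_right letter_linear] cvs_T unit_closed)

lemmas primitive_closed [simp] = linear_mapD(1)[OF primitive_linear]

lemma word_comult_Cons: "word_comult G M (x # w) = bmul (primitive x) (word_comult G M w)"
  by (simp add: Let_def primitive_def)

lemma word_comult_multilinear: "multilinear_map M TT (word_comult G M)"
  by (rule multilinear_map_rec[OF cvs_M cvs_TT _ bilinear_map_comp[OF bmul_bilinear primitive_linear linear_map_id]])
    (simp_all add: word_comult_Cons del: word_comult.simps(2))

lemma Delta_eq: "Delta = lift TT (word_comult G M)"
  by (simp add: tensor_hopf_def Let_def)

lemma Delta_linear: "linear_map T TT Delta"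
  unfolding Delta_eq by (rule lift_word_linear[OF cvs_M cvs_TT word_comult_multilinear])

lemmas Delta_closed [simp] = linear_mapD(1)[OF Delta_linear]

lemma Delta_word: "w \<in> lists (carrier M) \<Longrightarrow> Delta (word M w) = word_comult G M w"
  unfolding Delta_eq by (rule lift_word[OF cvs_M cvs_TT word_comult_multilinear])

text \<open>The recursion step of \<open>word_antipode\<close>, isolated as a bilinear map of the
  first letter and of the antipode of the tail.\<close>

definition "anti_step x A = \<ominus>\<^bsub>T\<^esub> (\<Oplus>\<^bsub>T\<^esub>g\<in>carrier G. mul (act g A) (word M [coact M x g]))"

lemma anti_step_bilinear: "bilinear_map M T T anti_step"
  unfolding anti_step_def
  by (intro linear_map_comp_bilinear[OF _ linear_map_uminus[OF cvs_T linear_map_id]]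
      bilinear_map_sum_fun cvs_M cvs_T finite_G
      bilinear_map_comp[OF bilinear_map_flip[OF mul_bilinear]] linear_map_comp[OF letter_linear coact_linear] act_linear)

lemma word_antipode_Cons: "word_antipode G M (x # w) = anti_step x (word_antipode G M w)"
  by (simp add: Let_def anti_step_def)

lemma word_antipode_multilinear: "multilinear_map M T (word_antipode G M)"
  by (rule multilinear_map_rec[OF cvs_M cvs_T _ anti_step_bilinear])
    (simp_all add: word_antipode_Cons del: word_antipode.simps(2))

lemma anti_eq: "anti = lift T (word_antipode G M)"
  by (simp add: tensor_hopf_def Let_def lift_def lin_ext_def fun_eq_iff)

lemma anti_linear: "linear_map T T anti"
  unfolding anti_eq by (rule lift_word_linear[OF cvs_M cvs_T word_antipode_multilinear])

lemmas anti_closed [simp] = linear_mapD(1)[OF anti_linear]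

lemma anti_word: "w \<in> lists (carrier M) \<Longrightarrow> anti (word M w) = word_antipode G M w"
  unfolding anti_eq by (rule lift_word[OF cvs_M cvs_T word_antipode_multilinear])

lemma empty_word_multilinear: "multilinear_map M complex_space (\<lambda>w. if w = [] then 1 else 0)"
  using linear_map_const_zero[OF cvs_complex_space, of M] by (simp add: multilinear_map_def)

text \<open>The counit reads a coefficient off \<open>rep A\<close>. As the lift of the indicator of
  the empty word it is visibly linear. The two cases are whether the empty word lies in the support
  over which \<open>lin_ext\<close> sums.\<close>

lemma eps_eq_lift:
  assumes "A \<in> carrier T"
  shows "eps A = lift complex_space (\<lambda>w. if w = [] then 1 else 0) A"
proof -
  have "rep A \<in> carrier (free_space (lists (carrier M)))"
    by (rule rep_coset(2)[OF cvs_free_space lin_span_submodule[OF cvs_free_space multilinear_relations_closed[OF cvs_M]]])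
      (use assms in \<open>simp add: tensor_space_def multilinear_null_def\<close>)
  then have f: "finite {w. rep A w \<noteq> 0}" by (simp add: free_space_carrier)
  show ?thesis
  proof (cases "rep A [] = 0")
    case True
    then have "lin_ext complex_space (\<lambda>w. if w = [] then 1 else 0) (rep A) = 0"
      unfolding lin_ext_def using cvs_sum_zero[OF cvs_complex_space, of "{w. rep A w \<noteq> 0}"] by fastforce
    then show ?thesis using True by (simp add: tensor_hopf_def Let_def lift_def)
  next
    case False
    have "lin_ext complex_space (\<lambda>w. if w = [] then 1 else 0) (rep A) = rep A []"
      unfolding lin_ext_def
      by (subst cvs_sum_delta[OF cvs_complex_space f, of "[]"]) (use False in auto)
    then show ?thesis by (simp add: tensor_hopf_def Let_def lift_def)
  qed
qed

lemma eps_linear: "linear_map T complex_space eps"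
  by (rule linear_map_cong[OF lift_word_linear[OF cvs_M cvs_complex_space empty_word_multilinear] _ cvs_T])
    (simp add: eps_eq_lift)

lemma eps_word: "w \<in> lists (carrier M) \<Longrightarrow> eps (word M w) = (if w = [] then 1 else 0)"
  using lift_word[OF cvs_M cvs_complex_space empty_word_multilinear] eps_eq_lift[OF word_cl] by simp

lemma complex_mult_bilinear: "bilinear_map complex_space complex_space complex_space (*)"
  by (auto simp: bilinear_map_def linear_map_def algebra_simps)

lemma eps_mul:
  assumes "a \<in> carrier T" "b \<in> carrier T"
  shows "eps (mul a b) = eps a * eps b"
  by (rule tensor_space_bilinear_map_eqI[OF cvs_M cvs_M cvs_complex_space linear_map_comp_bilinear[OF mul_bilinear eps_linear]
        bilinear_map_comp[OF complex_mult_bilinear eps_linear eps_linear] _ assms])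
    (simp add: mul_word eps_word append_in_lists_conv del: in_lists_conv_set)

lemma submodule_tensor_hopf: "submodule W \<C> (tensor_hopf G M) \<longleftrightarrow> submodule W \<C> T"
  by (rule submodule_cong_structure(1)[OF cvs_T]) simp_all

lemma lin_span_tensor_hopf: "lin_span (tensor_hopf G M) = lin_span T"
  by (rule submodule_cong_structure(2)[OF cvs_T]) simp_all

lemma coset_tensor_hopf: "a_r_coset (tensor_hopf G M) = a_r_coset T"
  and quot_space_tensor_hopf: "quot_space (tensor_hopf G M) = quot_space T"
  by (rule quot_space_cong_structure; simp)+

lemma hdeg_eq: "hdeg (tensor_hopf G M) n = lin_span T {word M w | w. w \<in> lists (carrier M) \<and> length w = n}"
proof -
  have "lin_span (tensor_algebra G M) = lin_span T"
    by (rule submodule_cong_structure(2)[OF cvs_T]) simp_all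
  then show ?thesis by (simp add: tensor_hopf_def Let_def)
qed

end

section \<open>The antipode preserves Nichols ideals\<close>

text \<open>The last condition is the Yetter-Drinfeld condition in components: \<open>h\<close>
  moves the component of degree \<open>g\<close> to degree \<open>h g h^-1\<close>.\<close>

locale yd = linear_yd +
  assumes action_one: "x \<in> carrier M \<Longrightarrow> action M \<one>\<^bsub>G\<^esub> x = x"
    and action_mult: "g \<in> carrier G \<Longrightarrow> h \<in> carrier G \<Longrightarrow> x \<in> carrier M \<Longrightarrow>
      action M (g \<otimes>\<^bsub>G\<^esub> h) x = action M g (action M h x)"
    and coact_action: "g \<in> carrier G \<Longrightarrow> h \<in> carrier G \<Longrightarrow> x \<in> carrier M \<Longrightarrow>
      coact M (action M h x) (h \<otimes>\<^bsub>G\<^esub> g \<otimes>\<^bsub>G\<^esub> inv\<^bsub>G\<^esub> h) = action M h (coact M x g)"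
begin

section \<open>Equivariance of the antipode\<close>

lemma act_one [simp]: "a \<in> carrier T \<Longrightarrow> act \<one>\<^bsub>G\<^esub> a = a"
proof (rule tensor_space_linear_map_eqI[OF cvs_M cvs_T act_linear[OF one_closed] linear_map_id])
  fix w assume w: "w \<in> lists (carrier M)"
  have "map (action M \<one>\<^bsub>G\<^esub>) w = w" by (rule map_idI) (use w action_one in auto)
  then show "act \<one>\<^bsub>G\<^esub> (word M w) = word M w" using act_word[OF one_closed w] by simp
qed

lemma act_act:
  assumes "g \<in> carrier G" "h \<in> carrier G" "a \<in> carrier T"
  shows "act g (act h a) = act (g \<otimes>\<^bsub>G\<^esub> h) a"
proof -
  interpret group G by (rule group_G)
  show ?thesis
  proof (rule tensor_space_linear_map_eqI[OF cvs_M cvs_T linear_map_comp[OF act_linear[OF assms(1)] act_linear[OF assms(2)]]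
        act_linear[OF m_closed[OF assms(1,2)]] _ assms(3)])
    fix w assume w: "w \<in> lists (carrier M)"
    have "map (action M g) (map (action M h) w) = map (action M (g \<otimes>\<^bsub>G\<^esub> h)) w"
      using w action_mult[OF assms(1,2)] by auto
    then show "act g (act h (word M w)) = act (g \<otimes>\<^bsub>G\<^esub> h) (word M w)"
      using act_word[OF assms(2) w] act_word[OF assms(1) map_action_lists[OF assms(2) w]]
        act_word[OF m_closed[OF assms(1,2)] w] by (simp del: map_map)
  qed
qed

lemma action_closed: "h \<in> carrier G \<Longrightarrow> x \<in> carrier M \<Longrightarrow> action M h x \<in> carrier M"
  using linear_mapD(1)[OF action_linear] .

text \<open>The sum over the group is reindexed by conjugation with \<open>h\<close>. Since
  \<open>(h g h^-1) h = h g\<close>, and the component of \<open>h x\<close> in degree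
  \<open>h g h^-1\<close> is \<open>h x_g\<close>, the action of \<open>h\<close> factors out of
  every summand.\<close>

lemma anti_step_act:
  assumes h: "h \<in> carrier G" and x: "x \<in> carrier M" and A: "A \<in> carrier T"
  shows "anti_step (action M h x) (act h A) = act h (anti_step x A)"
proof -
  interpret group G by (rule group_G)
  let ?c = "\<lambda>g. h \<otimes>\<^bsub>G\<^esub> g \<otimes>\<^bsub>G\<^esub> inv\<^bsub>G\<^esub> h"
  let ?F = "\<lambda>k. mul (act k (act h A)) (word M [coact M (action M h x) k])"
  let ?E = "\<lambda>g. mul (act g A) (word M [coact M x g])"
  have F: "?F \<in> carrier G \<rightarrow> carrier T"
    using h A coact_closed[OF action_closed[OF h x]] by auto
  have E: "?E \<in> carrier G \<rightarrow> carrier T"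
    using A coact_closed[OF x] by auto
  have inj: "inj_on ?c (carrier G)"
    by (rule inj_onI) (use h in \<open>metis l_cancel m_closed inv_closed r_cancel\<close>)
  have "k \<in> ?c ` carrier G" if k: "k \<in> carrier G" for k
  proof (rule image_eqI[of _ _ "inv\<^bsub>G\<^esub> h \<otimes>\<^bsub>G\<^esub> k \<otimes>\<^bsub>G\<^esub> h"])
    show "k = h \<otimes>\<^bsub>G\<^esub> (inv\<^bsub>G\<^esub> h \<otimes>\<^bsub>G\<^esub> k \<otimes>\<^bsub>G\<^esub> h) \<otimes>\<^bsub>G\<^esub> inv\<^bsub>G\<^esub> h"
      using h k by (simp add: m_assoc inv_solve_left')
        (metis h inv_closed k m_assoc r_inv l_one r_one)
  qed (use h k in simp)
  then have im: "?c ` carrier G = carrier G" using h by auto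
  have "(\<Oplus>\<^bsub>T\<^esub>k\<in>carrier G. ?F k) = (\<Oplus>\<^bsub>T\<^esub>g\<in>carrier G. ?F (?c g))"
    using cvs_sum_reindex[OF cvs_T inj, of ?F] F unfolding im by blast
  also have "\<dots> = (\<Oplus>\<^bsub>T\<^esub>g\<in>carrier G. act h (?E g))"
  proof (rule cvs_sum_cong[OF cvs_T refl])
    show "(\<lambda>g. act h (?E g)) \<in> carrier G \<rightarrow> carrier T" using E act_closed[OF h] by blast
    fix g assume g: "g \<in> carrier G"
    have "?c g \<otimes>\<^bsub>G\<^esub> h = h \<otimes>\<^bsub>G\<^esub> g" using g h by (simp add: m_assoc)
    then have "act (?c g) (act h A) = act h (act g A)"
      using act_act[of "?c g" h A] act_act[of h g A] g h A by simp
    moreover have "word M [coact M (action M h x) (?c g)] = act h (word M [coact M x g])"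
      using coact_action[OF g h x] act_word[OF h, of "[coact M x g]"] coact_closed[OF x g] by simp
    ultimately show "?F (?c g) = act h (?E g)"
      using act_mul[OF h act_closed[OF g A] letter_closed[OF coact_closed[OF x g]]] by simp
  qed
  also have "\<dots> = act h (\<Oplus>\<^bsub>T\<^esub>g\<in>carrier G. ?E g)"
    by (rule linear_map_sum[OF cvs_T cvs_T act_linear[OF h] finite_G E, symmetric])
  finally show ?thesis
    unfolding anti_step_def
    using linear_map_minus[OF cvs_T cvs_T act_linear[OF h] cvs_sum_closed[OF cvs_T E]] by simp
qed

text \<open>In the convolution of \<open>S\<close> with the identity the terms \<open>S(g a)\<close>
  appear, whereas the recursion of the antipode produces \<open>g S(a)\<close>; this lemma makes the
  two cancel.\<close>

lemma anti_act:
  assumes "h \<in> carrier G" "a \<in> carrier T"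
  shows "anti (act h a) = act h (anti a)"
proof (rule tensor_space_linear_map_eqI[OF cvs_M cvs_T linear_map_comp[OF anti_linear act_linear[OF assms(1)]]
      linear_map_comp[OF act_linear[OF assms(1)] anti_linear] _ assms(2)])
  fix w assume w: "w \<in> lists (carrier M)"
  have cl: "word_antipode G M w \<in> carrier T" if "w \<in> lists (carrier M)" for w
    using anti_word[OF that] anti_closed[OF word_cl[OF that]] by simp
  have "word_antipode G M (map (action M h) w) = act h (word_antipode G M w)"
    using w
  proof (induction w)
    case Nil
    show ?case using assms(1) by simp
  next
    case (Cons x w)
    then show ?case
      using anti_step_act[OF assms(1) _ cl, of x w] by (simp add: word_antipode_Cons del: word_antipode.simps(2))
  qed
  then show "anti (act h (word M w)) = act h (anti (word M w))"
    using act_word[OF assms(1) w] anti_word[OF w] anti_word[OF map_action_lists[OF assms(1) w]] by simp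
qed

lemma anti_letter:
  assumes "x \<in> carrier M" "a \<in> carrier T"
  shows "anti (mul (word M [x]) a) = anti_step x (anti a)"
proof (rule tensor_space_linear_map_eqI[OF cvs_M cvs_T linear_map_comp[OF anti_linear mul_linear_right[OF letter_closed[OF assms(1)]]]
      linear_map_comp[OF bilinear_mapD(1)[OF anti_step_bilinear assms(1)] anti_linear] _ assms(2)])
  fix w assume w: "w \<in> lists (carrier M)"
  have "mul (word M [x]) (word M w) = word M (x # w)" using mul_word[of "[x]" w] w assms(1) by simp
  moreover have "x # w \<in> lists (carrier M)" using w assms(1) by simp
  ultimately show "anti (mul (word M [x]) (word M w)) = anti_step x (anti (word M w))"
    using anti_word w by (simp add: word_antipode_Cons del: in_lists_conv_set word_antipode.simps(2))
qed

text \<open>The factor \<open>x \<otimes> 1\<close> passes without braiding, because the unit is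
  coinvariant, of degree \<open>\<one>\<close>. The factor \<open>1 \<otimes> x\<close> moves past
  \<open>a\<close> through its components \<open>x_g\<close>, letting \<open>g\<close> act on
  \<open>a\<close>.\<close>

lemma bmul_primitive:
  assumes x: "x \<in> carrier M" and a: "a \<in> carrier T" and b: "b \<in> carrier T"
  shows "bmul (primitive x) (ten a b) =
    ten (mul (word M [x]) a) b \<oplus>\<^bsub>TT\<^esub> (\<Oplus>\<^bsub>TT\<^esub>g\<in>carrier G. ten (act g a) (mul (word M [coact M x g]) b))"
proof -
  interpret group G by (rule group_G)
  have "bmul (primitive x) (ten a b) = bmul (ten (word M [x]) (word M [])) (ten a b) \<oplus>\<^bsub>TT\<^esub> bmul (ten (word M []) (word M [x])) (ten a b)"
    unfolding primitive_def
    by (rule linear_mapD(2)[OF bilinear_mapD(2)[OF bmul_bilinear]]) (use x a b in auto)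
  moreover have "bmul (ten (word M [x]) (word M [])) (ten a b) = ten (mul (word M [x]) a) b"
  proof -
    let ?f = "\<lambda>g. ten (mul (word M [x]) (act g a)) (mul (coa (word M []) g) b)"
    have "?f g = \<zero>\<^bsub>TT\<^esub>" if "g \<in> carrier G" "g \<noteq> \<one>\<^bsub>G\<^esub>" for g
    proof -
      have "coa (word M []) g = \<zero>\<^bsub>T\<^esub>" using that coa_word[of g "[]"] by simp
      moreover have "mul \<zero>\<^bsub>T\<^esub> b = \<zero>\<^bsub>T\<^esub>" by (rule linear_map_zero[OF cvs_T cvs_T mul_linear_left[OF b]])
      ultimately show ?thesis using that x a cvs_T by simp
    qed
    moreover have one: "?f \<one>\<^bsub>G\<^esub> = ten (mul (word M [x]) a) b"
      using coa_word[of "\<one>\<^bsub>G\<^esub>" "[]"] a b by simp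
    ultimately have "(\<Oplus>\<^bsub>TT\<^esub>g\<in>carrier G. ?f g) = ?f \<one>\<^bsub>G\<^esub>"
      using x a b by (intro cvs_sum_delta[OF cvs_TT finite_G]) auto
    then show ?thesis using one bmul_tens[of "word M [x]" "word M []" a b] x a b by (simp add: bterm_def)
  qed
  moreover have "bmul (ten (word M []) (word M [x])) (ten a b) =
      (\<Oplus>\<^bsub>TT\<^esub>g\<in>carrier G. ten (act g a) (mul (word M [coact M x g]) b))"
  proof -
    have coa1: "coa (word M [x]) g = word M [coact M x g]" if g: "g \<in> carrier G" for g
    proof -
      \<comment> \<open>The tail of a one-letter word is empty, so its coaction vanishes unless
        \<open>inv k \<otimes> g\<close> is the identity, that is, unless
        \<open>k = g\<close>.\<close>
      let ?f = "\<lambda>k. mul (word M [coact M x k]) (word_coact G M [] (inv\<^bsub>G\<^esub> k \<otimes>\<^bsub>G\<^esub> g))"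
      have "?f k = \<zero>\<^bsub>T\<^esub>" if k: "k \<in> carrier G" "k \<noteq> g" for k
      proof -
        have "inv\<^bsub>G\<^esub> k \<otimes>\<^bsub>G\<^esub> g \<noteq> \<one>\<^bsub>G\<^esub>" using k g by (metis inv_closed inv_equality inv_inv)
        then show ?thesis
          using linear_map_zero[OF cvs_T cvs_T mul_linear_right[OF letter_closed[OF coact_closed[OF x k(1)]]]] by simp
      qed
      moreover have "?f g = word M [coact M x g]" using g coact_closed[OF x g] by simp
      ultimately have "(\<Oplus>\<^bsub>T\<^esub>k\<in>carrier G. ?f k) = word M [coact M x g]"
        using g coact_closed[OF x g] by (subst cvs_sum_delta[OF cvs_T finite_G g]) auto
      then show ?thesis using coa_word[OF g, of "[x]"] x by simp
    qed
    have "bmul (ten (word M []) (word M [x])) (ten a b) = bterm (word M []) (word M [x]) a b"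
      using bmul_tens x a b by simp
    also have "\<dots> = (\<Oplus>\<^bsub>TT\<^esub>g\<in>carrier G. ten (act g a) (mul (word M [coact M x g]) b))"
      unfolding bterm_def by (rule cvs_sum_cong[OF cvs_TT refl]) (use coa1 a b coact_closed[OF x] in auto)
    finally show ?thesis .
  qed
  ultimately show ?thesis by simp
qed

text \<open>The component of total degree \<open>n\<close> in the tensor square. It bounds the left
  tensor factors in the coproduct of a word by the length of that word, which is what makes the
  iteration for the antipode terminate in each degree.\<close>

definition "degree_part n = lin_span TT {ten (word M u) (word M v) | u v.
  u \<in> lists (carrier M) \<and> v \<in> lists (carrier M) \<and> length u + length v = n}"

lemma degree_part_generators:
  "{ten (word M u) (word M v) | u v. u \<in> lists (carrier M) \<and> v \<in> lists (carrier M) \<and> length u + length v = n} \<subseteq> carrier TT"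
  using word_cl ten_closed by blast

lemma degree_part_submodule: "submodule (degree_part n) \<C> TT"
  unfolding degree_part_def by (rule lin_span_submodule[OF cvs_TT degree_part_generators])

lemma ten_word_degree_part:
  "u \<in> lists (carrier M) \<Longrightarrow> v \<in> lists (carrier M) \<Longrightarrow> length u + length v = n \<Longrightarrow> ten (word M u) (word M v) \<in> degree_part n"
  unfolding degree_part_def by (rule subsetD[OF lin_span_superset[OF cvs_TT]]) blast

text \<open>Actions and coaction components send letters to letters, so multiplying by
  \<open>primitive x\<close> raises the total length by exactly one in each term.\<close>

lemma word_comult_degree: "w \<in> lists (carrier M) \<Longrightarrow> word_comult G M w \<in> degree_part (length w)"
proof (induction w)
  case Nil
  then show ?case using ten_word_degree_part[of "[]" "[]" 0] by simp
next
  case (Cons x w)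
  then have x: "x \<in> carrier M" and w: "word_comult G M w \<in> degree_part (length w)" by auto
  note S = submoduleD[OF cvs_TT degree_part_submodule[of "Suc (length w)"]]
  show ?case
    unfolding word_comult_Cons list.size(4) add_Suc_right add_0_right
  proof (rule linear_map_span[OF cvs_TT cvs_TT bilinear_mapD(1)[OF bmul_bilinear primitive_closed[OF x]]
        degree_part_submodule degree_part_generators _ w[unfolded degree_part_def]])
    fix p assume "p \<in> {ten (word M u) (word M v) | u v.
      u \<in> lists (carrier M) \<and> v \<in> lists (carrier M) \<and> length u + length v = length w}"
    then obtain u v where uv: "u \<in> lists (carrier M)" "v \<in> lists (carrier M)" "length u + length v = length w"
      and p: "p = ten (word M u) (word M v)" by blast
    have "ten (mul (word M [x]) (word M u)) (word M v) \<in> degree_part (Suc (length w))"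
      using mul_word[of "[x]" u] x uv by (auto intro!: ten_word_degree_part)
    moreover have "ten (act g (word M u)) (mul (word M [coact M x g]) (word M v)) \<in> degree_part (Suc (length w))"
      if g: "g \<in> carrier G" for g
      using mul_word[of "[coact M x g]" v] coact_closed[OF x g] uv act_word[OF g uv(1)] map_action_lists[OF g uv(1)]
      by (auto intro!: ten_word_degree_part simp del: in_lists_conv_set simp: Cons_in_lists_iff)
    ultimately show "bmul (primitive x) p \<in> degree_part (Suc (length w))"
      unfolding p bmul_primitive[OF x word_cl[OF uv(1)] word_cl[OF uv(2)]]
      by (intro S(4) lin_span_sum[OF cvs_TT degree_part_submodule finite_G]) auto
  qed
qed

text \<open>Multiplication after \<open>f \<otimes> h\<close>; the convolution product is
  \<open>conv f h\<close> composed with \<open>Delta\<close>. Leaving \<open>Delta\<close> outside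
  lets identities be checked on arbitrary pure tensors.\<close>

definition "conv f h = lift T (\<lambda>(a, b). mul (f a) (h b))"

lemma conv_linear: "linear_map T T f \<Longrightarrow> linear_map T T h \<Longrightarrow> linear_map TT T (conv f h)"
  unfolding conv_def by (rule lift_tensor_linear[OF cvs_T cvs_T cvs_T bilinear_map_comp[OF mul_bilinear]])

lemma conv_tens:
  "linear_map T T f \<Longrightarrow> linear_map T T h \<Longrightarrow> a \<in> carrier T \<Longrightarrow> b \<in> carrier T \<Longrightarrow> conv f h (ten a b) = mul (f a) (h b)"
  unfolding conv_def by (rule lift_tens[OF cvs_T cvs_T cvs_T bilinear_map_comp[OF mul_bilinear]])

definition "unit_eps a = eps a \<odot>\<^bsub>T\<^esub> word M []"

lemma unit_eps_linear: "linear_map T T unit_eps"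
  unfolding unit_eps_def
  by (rule linear_mapI)
    (use linear_mapD[OF eps_linear] cvs_T in \<open>auto simp: cvs_add_smult cvs_smult_smult\<close>)

lemmas unit_eps_closed [simp] = linear_mapD(1)[OF unit_eps_linear]

lemma mul_unit_eps: "a \<in> carrier T \<Longrightarrow> b \<in> carrier T \<Longrightarrow> mul a (unit_eps b) = eps b \<odot>\<^bsub>T\<^esub> a"
  unfolding unit_eps_def using linear_mapD(3)[OF mul_linear_right] by simp

lemma mul_zero [simp]: "a \<in> carrier T \<Longrightarrow> mul a \<zero>\<^bsub>T\<^esub> = \<zero>\<^bsub>T\<^esub>" "a \<in> carrier T \<Longrightarrow> mul \<zero>\<^bsub>T\<^esub> a = \<zero>\<^bsub>T\<^esub>"
  using linear_map_zero[OF cvs_T cvs_T mul_linear_right] linear_map_zero[OF cvs_T cvs_T mul_linear_left] by auto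

text \<open>The coproduct of \<open>x w\<close> is \<open>primitive x\<close> times that of
  \<open>w\<close>, so this formula describes how a convolution changes when a letter is put in
  front.\<close>

lemma conv_primitive:
  assumes "linear_map T T f" "linear_map T T h" "x \<in> carrier M" "a \<in> carrier T" "b \<in> carrier T"
  shows "conv f h (bmul (primitive x) (ten a b)) =
    mul (f (mul (word M [x]) a)) (h b) \<oplus>\<^bsub>T\<^esub>
      (\<Oplus>\<^bsub>T\<^esub>g\<in>carrier G. mul (f (act g a)) (h (mul (word M [coact M x g]) b)))"
proof -
  have c: "word M [coact M x g] \<in> carrier T" if "g \<in> carrier G" for g
    using coact_closed[OF assms(3) that] by simp
  have F: "(\<lambda>g. ten (act g a) (mul (word M [coact M x g]) b)) \<in> carrier G \<rightarrow> carrier TT"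
    using c assms by auto
  have "conv f h (\<Oplus>\<^bsub>TT\<^esub>g\<in>carrier G. ten (act g a) (mul (word M [coact M x g]) b)) =
      (\<Oplus>\<^bsub>T\<^esub>g\<in>carrier G. conv f h (ten (act g a) (mul (word M [coact M x g]) b)))"
    by (rule linear_map_sum[OF cvs_TT cvs_T conv_linear[OF assms(1,2)] finite_G F])
  also have "\<dots> = (\<Oplus>\<^bsub>T\<^esub>g\<in>carrier G. mul (f (act g a)) (h (mul (word M [coact M x g]) b)))"
    by (rule cvs_sum_cong[OF cvs_T refl])
      (use c assms linear_mapD(1)[OF assms(1)] linear_mapD(1)[OF assms(2)] in \<open>auto simp: conv_tens\<close>)
  finally show ?thesis
    unfolding bmul_primitive[OF assms(3-5)]
    using linear_mapD(2)[OF conv_linear[OF assms(1,2)] _ cvs_sum_closed[OF cvs_TT F], of "ten (mul (word M [x]) a) b"] assms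
    by (simp add: conv_tens)
qed

text \<open>This is the right counit law \<open>(id \<otimes> \<epsilon>) \<Delta> = id\<close>,
  with \<open>f\<close> applied to the result. It is proved for the identity by induction on words;
  a general \<open>f\<close> then factors out, because the right tensor factor contributes only a
  scalar.\<close>

lemma conv_unit_eps:
  assumes f: "linear_map T T f" and a: "a \<in> carrier T"
  shows "conv f unit_eps (Delta a) = f a"
proof -
  have step: "conv (\<lambda>a. a) unit_eps (bmul (primitive x) P) = mul (word M [x]) (conv (\<lambda>a. a) unit_eps P)"
    if x: "x \<in> carrier M" and P: "P \<in> carrier TT" for x P
  proof (rule tensor_linear_map_eqI[OF cvs_T cvs_T cvs_T
        linear_map_comp[OF conv_linear[OF linear_map_id unit_eps_linear] bilinear_mapD(1)[OF bmul_bilinear primitive_closed[OF x]]]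
        linear_map_comp[OF mul_linear_right[OF letter_closed[OF x]] conv_linear[OF linear_map_id unit_eps_linear]] _ P])
    fix a b assume a: "a \<in> carrier T" and b: "b \<in> carrier T"
    have c: "word M [coact M x g] \<in> carrier T" if "g \<in> carrier G" for g
      using coact_closed[OF x that] by simp
    \<comment> \<open>A letter in front of \<open>b\<close> makes the counit vanish, so only the
      term keeping \<open>x\<close> in the left factor survives.\<close>
    have "unit_eps (mul (word M [coact M x g]) b) = \<zero>\<^bsub>T\<^esub>" if g: "g \<in> carrier G" for g
      using eps_mul[OF c[OF g] b] eps_word[of "[coact M x g]"] coact_closed[OF x g] cvs_T by (simp add: unit_eps_def)
    then have "(\<Oplus>\<^bsub>T\<^esub>g\<in>carrier G. mul (act g a) (unit_eps (mul (word M [coact M x g]) b))) = \<zero>\<^bsub>T\<^esub>"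
      using a by (intro cvs_sum_zero[OF cvs_T]) simp
    then show "conv (\<lambda>a. a) unit_eps (bmul (primitive x) (ten a b)) = mul (word M [x]) (conv (\<lambda>a. a) unit_eps (ten a b))"
      using conv_primitive[OF linear_map_id unit_eps_linear x a b] conv_tens[OF linear_map_id unit_eps_linear a b] x a b cvs_T
      by (simp add: mul_assoc)
  qed
  have id: "conv (\<lambda>a. a) unit_eps (Delta a) = a"
  proof (rule tensor_space_linear_map_eqI[OF cvs_M cvs_T
        linear_map_comp[OF conv_linear[OF linear_map_id unit_eps_linear] Delta_linear] linear_map_id _ a])
    fix w assume w: "w \<in> lists (carrier M)"
    then have "conv (\<lambda>a. a) unit_eps (word_comult G M w) = word M w"
    proof (induction w)
      case Nil
      then show ?case
        using conv_tens[OF linear_map_id unit_eps_linear unit_closed unit_closed] mul_unit_eps[OF unit_closed unit_closed]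
          eps_word[of "[]"] cvs_T by simp
    next
      case (Cons x w)
      then have x: "x \<in> carrier M" and w: "w \<in> lists (carrier M)" by auto
      have "word_comult G M w \<in> carrier TT" using Delta_word[OF w] Delta_closed[OF word_cl[OF w]] by simp
      then show ?case
        using step[OF x] Cons.IH mul_word[of "[x]" w] x w
        by (simp add: word_comult_Cons del: word_comult.simps(2) in_lists_conv_set)
    qed
    then show "conv (\<lambda>a. a) unit_eps (Delta (word M w)) = word M w" using Delta_word[OF w] by simp
  qed
  have "conv f unit_eps P = f (conv (\<lambda>a. a) unit_eps P)" if P: "P \<in> carrier TT" for P
  proof (rule tensor_linear_map_eqI[OF cvs_T cvs_T cvs_T conv_linear[OF f unit_eps_linear]
        linear_map_comp[OF f conv_linear[OF linear_map_id unit_eps_linear]] _ P])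
    fix a b assume a: "a \<in> carrier T" and b: "b \<in> carrier T"
    show "conv f unit_eps (ten a b) = f (conv (\<lambda>a. a) unit_eps (ten a b))"
      using conv_tens[OF f unit_eps_linear a b] conv_tens[OF linear_map_id unit_eps_linear a b]
        mul_unit_eps[OF a b] mul_unit_eps[OF linear_mapD(1)[OF f a] b] linear_mapD(3)[OF f a] by simp
  qed
  then show ?thesis using id a by simp
qed

text \<open>The term \<open>S(x a) b\<close> and the sum of the \<open>S(g a) x_g b\<close> cancel
  by the recursion of \<open>S\<close> and its equivariance. The cancellation holds on
  \<open>primitive x\<close> times any tensor \<open>P\<close>, so a case distinction on the word
  takes the place of an induction.\<close>

lemma conv_anti_id:
  assumes a: "a \<in> carrier T"
  shows "conv anti (\<lambda>a. a) (Delta a) = unit_eps a"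
proof (rule tensor_space_linear_map_eqI[OF cvs_M cvs_T
      linear_map_comp[OF conv_linear[OF anti_linear linear_map_id] Delta_linear] unit_eps_linear _ a])
  have step: "conv anti (\<lambda>a. a) (bmul (primitive x) P) = \<zero>\<^bsub>T\<^esub>"
    if x: "x \<in> carrier M" and P: "P \<in> carrier TT" for x P
  proof (rule tensor_linear_map_eqI[OF cvs_T cvs_T cvs_T
        linear_map_comp[OF conv_linear[OF anti_linear linear_map_id] bilinear_mapD(1)[OF bmul_bilinear primitive_closed[OF x]]]
        linear_map_const_zero[OF cvs_T] _ P])
    fix a b assume a: "a \<in> carrier T" and b: "b \<in> carrier T"
    have c: "word M [coact M x g] \<in> carrier T" if "g \<in> carrier G" for g
      using coact_closed[OF x that] by simp
    let ?E = "\<lambda>g. mul (act g (anti a)) (word M [coact M x g])"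
    have E: "?E \<in> carrier G \<rightarrow> carrier T" using a c by auto
    have "(\<Oplus>\<^bsub>T\<^esub>g\<in>carrier G. mul (anti (act g a)) (mul (word M [coact M x g]) b)) = (\<Oplus>\<^bsub>T\<^esub>g\<in>carrier G. mul (?E g) b)"
      by (rule cvs_sum_cong[OF cvs_T refl]) (use a b c in \<open>auto simp: anti_act mul_assoc\<close>)
    also have "\<dots> = mul (\<Oplus>\<^bsub>T\<^esub>g\<in>carrier G. ?E g) b"
      by (rule linear_map_sum[OF cvs_T cvs_T mul_linear_left[OF b] finite_G E, symmetric])
    finally have sum: "(\<Oplus>\<^bsub>T\<^esub>g\<in>carrier G. mul (anti (act g a)) (mul (word M [coact M x g]) b)) = mul (\<Oplus>\<^bsub>T\<^esub>g\<in>carrier G. ?E g) b" .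
    have Ec: "(\<Oplus>\<^bsub>T\<^esub>g\<in>carrier G. ?E g) \<in> carrier T" by (rule cvs_sum_closed[OF cvs_T E])
    have "mul (anti (mul (word M [x]) a)) b = \<ominus>\<^bsub>T\<^esub> mul (\<Oplus>\<^bsub>T\<^esub>g\<in>carrier G. ?E g) b"
      unfolding anti_letter[OF x a] anti_step_def by (rule linear_map_minus[OF cvs_T cvs_T mul_linear_left[OF b] Ec])
    then show "conv anti (\<lambda>a. a) (bmul (primitive x) (ten a b)) = \<zero>\<^bsub>T\<^esub>"
      using conv_primitive[OF anti_linear linear_map_id x a b] sum Ec b cvs_T by simp
  qed
  fix w assume w: "w \<in> lists (carrier M)"
  show "conv anti (\<lambda>a. a) (Delta (word M w)) = unit_eps (word M w)"
  proof (cases w)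
    case Nil
    then show ?thesis
      using conv_tens[OF anti_linear linear_map_id unit_closed unit_closed] Delta_word[of "[]"] eps_word[of "[]"]
        anti_word[of "[]"] cvs_T by (simp add: unit_eps_def)
  next
    case (Cons x v)
    then have x: "x \<in> carrier M" and v: "v \<in> lists (carrier M)" using w by auto
    have "word_comult G M v \<in> carrier TT" using Delta_word[OF v] Delta_closed[OF word_cl[OF v]] by simp
    then show ?thesis
      using step[OF x] Delta_word[OF w] eps_word[OF w] Cons cvs_T
      by (simp add: word_comult_Cons unit_eps_def del: word_comult.simps(2))
  qed
qed

lemma Delta_degree:
  assumes "w \<in> lists (carrier M)"
  shows "Delta (word M w) \<in> degree_part (length w)"
  using word_comult_degree Delta_word assms by simp

text \<open>The projection onto the augmentation ideal, the kernel of the counit, along the unit. It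
  kills the empty word and fixes every element of a Nichols ideal.\<close>

definition "aug a = a \<ominus>\<^bsub>T\<^esub> unit_eps a"

lemma aug_linear: "linear_map T T aug"
  unfolding aug_def by (rule linear_map_minus_fun[OF cvs_T linear_map_id unit_eps_linear])

definition "anti_iter f a = unit_eps a \<ominus>\<^bsub>T\<^esub> conv f aug (Delta a)"

lemma anti_iter_linear: "linear_map T T f \<Longrightarrow> linear_map T T (anti_iter f)"
  unfolding anti_iter_def
  by (rule linear_map_minus_fun[OF cvs_T unit_eps_linear linear_map_comp[OF conv_linear[OF _ aug_linear] Delta_linear]])

lemma anti_iter_anti:
  assumes a: "a \<in> carrier T"
  shows "anti_iter anti a = anti a"
proof -
  \<comment> \<open>Convolution is linear in its right factor; this distributes it over
    \<open>id - \<eta>\<epsilon>\<close>, where the two laws already proved evaluate the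
    parts.\<close>
  have "conv anti aug P = conv anti (\<lambda>a. a) P \<ominus>\<^bsub>T\<^esub> conv anti unit_eps P" if P: "P \<in> carrier TT" for P
  proof (rule tensor_linear_map_eqI[OF cvs_T cvs_T cvs_T conv_linear[OF anti_linear aug_linear]
        linear_map_minus_fun[OF cvs_T conv_linear[OF anti_linear linear_map_id] conv_linear[OF anti_linear unit_eps_linear]] _ P])
    fix a b assume "a \<in> carrier T" "b \<in> carrier T"
    then show "conv anti aug (ten a b) = conv anti (\<lambda>a. a) (ten a b) \<ominus>\<^bsub>T\<^esub> conv anti unit_eps (ten a b)"
      using conv_tens[OF anti_linear aug_linear] conv_tens[OF anti_linear linear_map_id] conv_tens[OF anti_linear unit_eps_linear]
        linear_map_diff[OF cvs_T cvs_T mul_linear_right] by (simp add: aug_def)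
  qed
  then have "conv anti aug (Delta a) = unit_eps a \<ominus>\<^bsub>T\<^esub> anti a"
    using conv_anti_id[OF a] conv_unit_eps[OF anti_linear a] a by simp
  moreover have "u \<ominus>\<^bsub>T\<^esub> (u \<ominus>\<^bsub>T\<^esub> v) = v" if "u \<in> carrier T" "v \<in> carrier T" for u v
  proof -
    have "u \<ominus>\<^bsub>T\<^esub> (u \<ominus>\<^bsub>T\<^esub> v) = u \<oplus>\<^bsub>T\<^esub> ((-1) \<odot>\<^bsub>T\<^esub> u \<oplus>\<^bsub>T\<^esub> v)"
      using that cvs_T by (simp add: cvs_diff cvs_smult_add cvs_smult_smult)
    also have "\<dots> = (u \<ominus>\<^bsub>T\<^esub> u) \<oplus>\<^bsub>T\<^esub> v" using that cvs_T by (simp add: cvs_diff cvs_add_ac)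
    also have "u \<ominus>\<^bsub>T\<^esub> u = \<zero>\<^bsub>T\<^esub>" using that cvs_T by (simp only: cvs_diff_eq_zero)
    finally show ?thesis using that cvs_T by simp
  qed
  ultimately show ?thesis using a by (simp add: anti_iter_def)
qed

text \<open>The component of \<open>\<Delta>(w)\<close> in \<open>T \<otimes> 1\<close> is killed by the augmentation, so \<open>anti_iter f\<close> on
  words of length \<open>n\<close> depends only on \<open>f\<close> on shorter words.\<close>

lemma anti_iter_cong:
  assumes f: "linear_map T T f" and eq: "\<And>w. w \<in> lists (carrier M) \<Longrightarrow> length w < n \<Longrightarrow> f (word M w) = anti (word M w)"
    and w: "w \<in> lists (carrier M)" and n: "length w \<le> n"
  shows "anti_iter f (word M w) = anti (word M w)"
proof -
  have "conv f aug (Delta (word M w)) = conv anti aug (Delta (word M w))"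
  proof (rule linear_map_eq_on_span[OF cvs_TT cvs_T conv_linear[OF f aug_linear] conv_linear[OF anti_linear aug_linear]
        degree_part_generators _ Delta_degree[OF w, unfolded degree_part_def]])
    fix p assume "p \<in> {ten (word M u) (word M v) | u v.
      u \<in> lists (carrier M) \<and> v \<in> lists (carrier M) \<and> length u + length v = length w}"
    then obtain u v where uv: "u \<in> lists (carrier M)" "v \<in> lists (carrier M)" "length u + length v = length w"
      and p: "p = ten (word M u) (word M v)" by blast
    have "mul (f (word M u)) (aug (word M v)) = mul (anti (word M u)) (aug (word M v))"
    proof (cases "v = []")
      case True
      then have "aug (word M v) = \<zero>\<^bsub>T\<^esub>" using eps_word[of "[]"] cvs_T by (simp add: aug_def unit_eps_def)
      then show ?thesis using word_cl[OF uv(1)] linear_mapD(1)[OF f] by simp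
    next
      case False
      then have "length u < n" using uv(3) n by (cases v) auto
      then show ?thesis using eq[OF uv(1)] by simp
    qed
    then show "conv f aug p = conv anti aug p"
      unfolding p using conv_tens[OF f aug_linear] conv_tens[OF anti_linear aug_linear] word_cl uv by simp
  qed
  then show ?thesis using anti_iter_anti[OF word_cl[OF w]] by (simp add: anti_iter_def)
qed

definition "anti_approx k = (anti_iter ^^ k) (\<lambda>_. \<zero>\<^bsub>T\<^esub>)"

lemma anti_approx_linear: "linear_map T T (anti_approx k)"
  by (induction k) (simp_all add: anti_approx_def linear_map_const_zero cvs_T anti_iter_linear)

lemma anti_approx_word:
  "w \<in> lists (carrier M) \<Longrightarrow> length w < k \<Longrightarrow> anti_approx k (word M w) = anti (word M w)"
proof (induction k arbitrary: w)
  case (Suc k)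
  \<comment> \<open>One more iteration gains one degree: agreement on words shorter than
    \<open>k\<close> gives agreement on words of length at most \<open>k\<close>.\<close>
  then have "anti_iter (anti_approx k) (word M w) = anti (word M w)"
    by (intro anti_iter_cong[OF anti_approx_linear, of k]) auto
  then show ?case by (simp add: anti_approx_def)
qed simp

text \<open>The necessary \<open>k\<close> depends on the lengths of the words in \<open>a\<close>.
  With equality demanded for all later iterates, the stabilising elements form a submodule (the
  larger of two bounds serves a sum), and it contains all words.\<close>

lemma anti_approx_eventually:
  assumes "a \<in> carrier T"
  shows "\<exists>k. \<forall>j\<ge>k. anti_approx j a = anti a"
proof -
  let ?W = "{a \<in> carrier T. \<exists>k. \<forall>j\<ge>k. anti_approx j a = anti a}"
  note l = linear_mapD[OF anti_approx_linear] and la = linear_mapD[OF anti_linear]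
  have "submodule ?W \<C> T"
  proof (rule cvs_submoduleI[OF cvs_T])
    show "\<zero>\<^bsub>T\<^esub> \<in> ?W"
      using linear_map_zero[OF cvs_T cvs_T anti_approx_linear] linear_map_zero[OF cvs_T cvs_T anti_linear] cvs_T by simp
    fix x y assume "x \<in> ?W" "y \<in> ?W"
    then obtain k k' where k: "x \<in> carrier T" "y \<in> carrier T"
      "\<And>j. j \<ge> k \<Longrightarrow> anti_approx j x = anti x" "\<And>j. j \<ge> k' \<Longrightarrow> anti_approx j y = anti y" by blast
    have "\<forall>j\<ge>max k k'. anti_approx j (x \<oplus>\<^bsub>T\<^esub> y) = anti (x \<oplus>\<^bsub>T\<^esub> y)"
      using k l(2) la(2) by simp
    moreover have "x \<oplus>\<^bsub>T\<^esub> y \<in> carrier T" using k(1,2) cvs_T by simp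
    ultimately show "x \<oplus>\<^bsub>T\<^esub> y \<in> ?W" by blast
  next
    fix c x assume "x \<in> ?W"
    then obtain k where k: "x \<in> carrier T" "\<And>j. j \<ge> k \<Longrightarrow> anti_approx j x = anti x" by blast
    have "\<forall>j\<ge>k. anti_approx j (c \<odot>\<^bsub>T\<^esub> x) = anti (c \<odot>\<^bsub>T\<^esub> x)"
      using k l(3) la(3) by simp
    moreover have "c \<odot>\<^bsub>T\<^esub> x \<in> carrier T" using k(1) cvs_T by simp
    ultimately show "c \<odot>\<^bsub>T\<^esub> x \<in> ?W" by blast
  qed blast
  moreover have "word M ` lists (carrier M) \<subseteq> ?W"
  proof (rule image_subsetI)
    fix w assume w: "w \<in> lists (carrier M)"
    then have "\<forall>j\<ge>Suc (length w). anti_approx j (word M w) = anti (word M w)" by (simp add: anti_approx_word)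
    then show "word M w \<in> ?W" using word_cl[OF w] by blast
  qed
  ultimately have "lin_span T (word M ` lists (carrier M)) \<subseteq> ?W" by (rule lin_span_minimal[OF cvs_T])
  then show ?thesis using assms word_span[OF cvs_M] by blast
qed

text \<open>The counit is multiplicative, so its kernel is an ideal; it contains every word of
  positive length, in particular the generators, whose degree is at least 2.\<close>

lemma nichols_ideal_eps:
  assumes "I \<in> nichols_ideals G M" "x \<in> I"
  shows "eps x = 0"
proof -
  interpret ring "tensor_hopf G M" by (rule ring_tensor_hopf)
  obtain A where A: "A \<subseteq> (\<Union>n\<in>{2..}. hdeg (tensor_hopf G M) n)" "I = Idl\<^bsub>tensor_hopf G M\<^esub> A"
    using assms(1) by (auto simp: nichols_ideals_def Let_def)
  let ?K = "{x \<in> carrier T. eps x = 0}"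
  have K: "submodule ?K \<C> T"
    using submodule_vimage[OF cvs_T cvs_complex_space eps_linear submodule_zero[OF cvs_complex_space]] by simp
  have "ideal ?K (tensor_hopf G M)"
  proof (rule idealI[OF ring_tensor_hopf])
    have "submodule ?K \<C> (tensor_hopf G M)" using K by (simp add: submodule_tensor_hopf)
    then show "subgroup ?K (add_monoid (tensor_hopf G M))" by (rule submodule.axioms(1))
  qed (simp_all add: eps_mul)
  moreover have "hdeg (tensor_hopf G M) n \<subseteq> ?K" if "n \<ge> 2" for n
    unfolding hdeg_eq using that word_cl eps_word by (intro lin_span_minimal[OF cvs_T K]) fastforce
  then have "A \<subseteq> ?K" using A(1) by fastforce
  ultimately have "I \<subseteq> ?K" unfolding A(2) by (rule genideal_minimal)
  then show ?thesis using assms(2) by blast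
qed

lemma nichols_ideal_anti:
  assumes I: "I \<in> nichols_ideals G M" and x: "x \<in> I"
  shows "anti x \<in> I"
proof -
  have id: "ideal I (tensor_hopf G M)" and sub: "submodule I \<C> T"
    and Delta: "\<And>x. x \<in> I \<Longrightarrow> Delta x \<in> lin_span TT {ten a b | a b. a \<in> carrier T \<and> b \<in> carrier T \<and> (a \<in> I \<or> b \<in> I)}"
    using I by (auto simp: nichols_ideals_def Let_def submodule_tensor_hopf)
  interpret ideal I "tensor_hopf G M" by (rule id)
  note S = submoduleD[OF cvs_T sub]
  have mulI: "mul a b \<in> I" if "a \<in> carrier T" "b \<in> carrier T" "a \<in> I \<or> b \<in> I" for a b
    using that I_l_closed[of b a] I_r_closed[of a b] by auto
  have step: "anti_iter f x \<in> I" if f: "linear_map T T f" "\<And>x. x \<in> I \<Longrightarrow> f x \<in> I" and x: "x \<in> I" for f x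
  proof -
    \<comment> \<open>The coideal condition writes the coproduct with one factor of each pure tensor
      in \<open>I\<close>. Both \<open>f\<close> and \<open>aug\<close> preserve \<open>I\<close>,
      and the ideal absorbs the product.\<close>
    have "conv f aug (Delta x) \<in> I"
    proof (rule linear_map_span[OF cvs_TT cvs_T conv_linear[OF f(1) aug_linear] sub _ _ Delta[OF x]])
      fix p assume "p \<in> {ten a b | a b. a \<in> carrier T \<and> b \<in> carrier T \<and> (a \<in> I \<or> b \<in> I)}"
      then obtain a b where ab: "a \<in> carrier T" "b \<in> carrier T" "a \<in> I \<or> b \<in> I" "p = ten a b" by blast
      \<comment> \<open>On \<open>I\<close> the counit is zero, so \<open>aug\<close> acts there as
        the identity.\<close>
      have "aug b \<in> I" if "b \<in> I"
        using that nichols_ideal_eps[OF I that] ab(2) cvs_T by (simp add: aug_def unit_eps_def)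
      then have "f a \<in> I \<or> aug b \<in> I" using ab(3) f(2) by blast
      then show "conv f aug p \<in> I"
        unfolding ab(4) using conv_tens[OF f(1) aug_linear ab(1,2)] mulI ab linear_mapD(1)[OF f(1)] linear_mapD(1)[OF aug_linear]
        by simp
    qed (use ten_closed in blast)
    moreover have "unit_eps x = \<zero>\<^bsub>T\<^esub>" using nichols_ideal_eps[OF I x] cvs_T by (simp add: unit_eps_def)
    ultimately show ?thesis
      using S cvs_T by (simp add: anti_iter_def cvs_diff)
  qed
  have "anti_approx k x \<in> I" if "x \<in> I" for k x
    using that
  proof (induction k arbitrary: x)
    case 0
    then show ?case using S(3) by (simp add: anti_approx_def)
  next
    case (Suc k)
    then show ?case using step[OF anti_approx_linear Suc.IH Suc.prems] by (simp add: anti_approx_def)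
  qed
  \<comment> \<open>For the given \<open>x\<close> a late enough iterate takes literally the value
    \<open>anti x\<close>, so membership in \<open>I\<close> passes over without any limit.\<close>
  then show ?thesis using anti_approx_eventually[OF S(2)[OF x]] x by (metis order_refl)
qed

section \<open>The sum of the Nichols ideals\<close>

abbreviation "nichols_kernel \<equiv> lin_span T (\<Union>(nichols_ideals G M))"

lemma nichols_idealD:
  assumes "I \<in> nichols_ideals G M"
  shows "ideal I (tensor_hopf G M)" "submodule I \<C> T"
    "g \<in> carrier G \<Longrightarrow> x \<in> I \<Longrightarrow> act g x \<in> I" "g \<in> carrier G \<Longrightarrow> x \<in> I \<Longrightarrow> coa x g \<in> I"
    "x \<in> I \<Longrightarrow> Delta x \<in> lin_span TT {ten a b | a b. a \<in> carrier T \<and> b \<in> carrier T \<and> (a \<in> I \<or> b \<in> I)}"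
  using assms by (auto simp: nichols_ideals_def Let_def submodule_tensor_hopf)

lemma nichols_ideals_closed: "\<Union>(nichols_ideals G M) \<subseteq> carrier T"
  using submoduleD(1)[OF cvs_T nichols_idealD(2)] by blast

lemma nichols_kernel_submodule: "submodule nichols_kernel \<C> T"
  by (rule lin_span_submodule[OF cvs_T nichols_ideals_closed])

lemma nichols_ideal_subset_kernel: "I \<in> nichols_ideals G M \<Longrightarrow> I \<subseteq> nichols_kernel"
  using lin_span_superset[OF cvs_T, of "\<Union>(nichols_ideals G M)"] by blast

text \<open>This reduces compatibility with the sum to each ideal separately. It is applied to the
  action, the coaction components, the antipode and multiplication by a fixed element.\<close>

lemma nichols_kernel_linear:
  assumes "linear_map T T f" "\<And>I x. I \<in> nichols_ideals G M \<Longrightarrow> x \<in> I \<Longrightarrow> f x \<in> I" "x \<in> nichols_kernel"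
  shows "f x \<in> nichols_kernel"
  by (rule linear_map_span[OF cvs_T cvs_T assms(1) nichols_kernel_submodule nichols_ideals_closed _ assms(3)])
    (use assms(2) nichols_ideal_subset_kernel in blast)

lemma nichols_kernel_mul:
  assumes "x \<in> nichols_kernel" "y \<in> carrier T"
  shows "mul x y \<in> nichols_kernel" "mul y x \<in> nichols_kernel"
proof -
  have "mul x y \<in> I" "mul y x \<in> I" if "I \<in> nichols_ideals G M" "x \<in> I" for I x
    using ideal.I_l_closed[OF nichols_idealD(1)[OF that(1)] that(2), of y]
      ideal.I_r_closed[OF nichols_idealD(1)[OF that(1)] that(2), of y] assms(2) by simp_all
  then show "mul x y \<in> nichols_kernel" "mul y x \<in> nichols_kernel"
    using nichols_kernel_linear[OF mul_linear_left[OF assms(2)] _ assms(1)]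
      nichols_kernel_linear[OF mul_linear_right[OF assms(2)] _ assms(1)] by blast+
qed

lemma nichols_kernel_eps:
  assumes "x \<in> nichols_kernel"
  shows "eps x = 0"
proof -
  have "eps x \<in> {\<zero>\<^bsub>complex_space\<^esub>}"
    by (rule linear_map_span[OF cvs_T cvs_complex_space eps_linear submodule_zero[OF cvs_complex_space] nichols_ideals_closed _ assms])
      (use nichols_ideal_eps in auto)
  then show ?thesis by simp
qed

text \<open>The coideal condition is used as vanishing in the tensor square of the quotient, since
  \<open>quot_hopf\<close> projects both factors of the coproduct. A pure tensor with a factor in
  one of the ideals becomes zero there.\<close>

lemma nichols_kernel_Delta:
  assumes "x \<in> nichols_kernel"
  defines "Q \<equiv> quot_space T nichols_kernel" and "\<pi> \<equiv> \<lambda>a. nichols_kernel +>\<^bsub>T\<^esub> a"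
  shows "tensor_map Q Q \<pi> \<pi> (Delta x) = \<zero>\<^bsub>tensor Q Q\<^esub>"
proof -
  have Q: "cvs Q" unfolding Q_def by (rule cvs_quot_space[OF cvs_T nichols_kernel_submodule])
  have \<pi>: "linear_map T Q \<pi>" unfolding Q_def \<pi>_def by (rule coset_linear[OF cvs_T nichols_kernel_submodule])
  note tm = tensor_map_linear[OF cvs_T cvs_T Q Q \<pi> \<pi>] tensor_map_tens[OF cvs_T cvs_T Q Q \<pi> \<pi>]
  have QQ: "cvs (tensor Q Q)" using Q by simp
  have zero: "\<pi> a = \<zero>\<^bsub>Q\<^esub>" if "I \<in> nichols_ideals G M" "a \<in> I" for I a
  proof -
    have "a \<in> nichols_kernel" using that nichols_ideal_subset_kernel by blast
    then show ?thesis
      unfolding \<pi>_def Q_def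
      using coset_eq_zero_iff[OF cvs_T nichols_kernel_submodule] submoduleD(2)[OF cvs_T nichols_kernel_submodule] by blast
  qed
  have "tensor_map Q Q \<pi> \<pi> (Delta x) \<in> {\<zero>\<^bsub>tensor Q Q\<^esub>}"
  proof (rule linear_map_span[OF cvs_T QQ linear_map_comp[OF tm(1) Delta_linear] submodule_zero[OF QQ] nichols_ideals_closed _ assms(1)])
    fix x assume "x \<in> \<Union>(nichols_ideals G M)"
    then obtain I where I: "I \<in> nichols_ideals G M" "x \<in> I" by blast
    show "tensor_map Q Q \<pi> \<pi> (Delta x) \<in> {\<zero>\<^bsub>tensor Q Q\<^esub>}"
    proof (rule linear_map_span[OF cvs_TT QQ tm(1) submodule_zero[OF QQ] _ _ nichols_idealD(5)[OF I]])
      fix p assume "p \<in> {ten a b | a b. a \<in> carrier T \<and> b \<in> carrier T \<and> (a \<in> I \<or> b \<in> I)}"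
      then obtain a b where ab: "a \<in> carrier T" "b \<in> carrier T" "a \<in> I \<or> b \<in> I" "p = ten a b" by blast
      have "tens Q Q (\<pi> a) (\<pi> b) = \<zero>\<^bsub>tensor Q Q\<^esub>"
        using ab(3) zero[OF I(1)] linear_mapD(1)[OF \<pi> ab(1)] linear_mapD(1)[OF \<pi> ab(2)] Q by auto
      then show "tensor_map Q Q \<pi> \<pi> p \<in> {\<zero>\<^bsub>tensor Q Q\<^esub>}" using tm(2)[OF ab(1,2)] ab(4) by simp
    qed (use ten_closed in blast)
  qed
  then show ?thesis by simp
qed

end

section \<open>Quotients of isomorphic braided Hopf algebras\<close>

text \<open>The conditions make every operation of \<open>quot_hopf\<close> independent of the
  representative. Coproducts are compared only after projecting both tensor factors, as this
  projection is part of the comultiplication of the quotient.\<close>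

locale hopf_congruence =
  fixes G :: "('g, 'm) monoid_scheme" and H :: "('g, 'v) braided_hopf" and I :: "'v set"
  assumes cvs_H: "cvs H" and sub: "submodule I \<C> H"
    and mult_closed: "a \<in> carrier H \<Longrightarrow> b \<in> carrier H \<Longrightarrow> a \<otimes>\<^bsub>H\<^esub> b \<in> carrier H"
    and one_closed: "\<one>\<^bsub>H\<^esub> \<in> carrier H"
    and action_closed: "h \<in> carrier G \<Longrightarrow> a \<in> carrier H \<Longrightarrow> action H h a \<in> carrier H"
    and coact_closed: "h \<in> carrier G \<Longrightarrow> a \<in> carrier H \<Longrightarrow> coact H a h \<in> carrier H"
    and comult_closed: "a \<in> carrier H \<Longrightarrow> comult H a \<in> carrier (tensor H H)"
    and antipode_closed: "a \<in> carrier H \<Longrightarrow> antipode H a \<in> carrier H"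
    and hdeg_closed: "hdeg H n \<subseteq> carrier H"
    and mult_cong: "a \<in> carrier H \<Longrightarrow> b \<in> carrier H \<Longrightarrow> a' \<in> carrier H \<Longrightarrow> b' \<in> carrier H \<Longrightarrow>
      a' \<ominus>\<^bsub>H\<^esub> a \<in> I \<Longrightarrow> b' \<ominus>\<^bsub>H\<^esub> b \<in> I \<Longrightarrow> a' \<otimes>\<^bsub>H\<^esub> b' \<ominus>\<^bsub>H\<^esub> a \<otimes>\<^bsub>H\<^esub> b \<in> I"
    and action_cong: "h \<in> carrier G \<Longrightarrow> a \<in> carrier H \<Longrightarrow> a' \<in> carrier H \<Longrightarrow> a' \<ominus>\<^bsub>H\<^esub> a \<in> I \<Longrightarrow>
      action H h a' \<ominus>\<^bsub>H\<^esub> action H h a \<in> I"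
    and coact_cong: "h \<in> carrier G \<Longrightarrow> a \<in> carrier H \<Longrightarrow> a' \<in> carrier H \<Longrightarrow> a' \<ominus>\<^bsub>H\<^esub> a \<in> I \<Longrightarrow>
      coact H a' h \<ominus>\<^bsub>H\<^esub> coact H a h \<in> I"
    and comult_cong: "a \<in> carrier H \<Longrightarrow> a' \<in> carrier H \<Longrightarrow> a' \<ominus>\<^bsub>H\<^esub> a \<in> I \<Longrightarrow>
      tensor_map (quot_space H I) (quot_space H I) (\<lambda>a. I +>\<^bsub>H\<^esub> a) (\<lambda>a. I +>\<^bsub>H\<^esub> a) (comult H a') =
      tensor_map (quot_space H I) (quot_space H I) (\<lambda>a. I +>\<^bsub>H\<^esub> a) (\<lambda>a. I +>\<^bsub>H\<^esub> a) (comult H a)"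
    and counit_cong: "a \<in> carrier H \<Longrightarrow> a' \<in> carrier H \<Longrightarrow> a' \<ominus>\<^bsub>H\<^esub> a \<in> I \<Longrightarrow> counit H a' = counit H a"
    and antipode_cong: "a \<in> carrier H \<Longrightarrow> a' \<in> carrier H \<Longrightarrow> a' \<ominus>\<^bsub>H\<^esub> a \<in> I \<Longrightarrow>
      antipode H a' \<ominus>\<^bsub>H\<^esub> antipode H a \<in> I"

lemma quot_hopf_simps [simp]:
  "carrier (quot_hopf H I) = carrier (quot_space H I)"
  "\<zero>\<^bsub>quot_hopf H I\<^esub> = \<zero>\<^bsub>quot_space H I\<^esub>"
  "add (quot_hopf H I) = add (quot_space H I)"
  "module.smult (quot_hopf H I) = module.smult (quot_space H I)"
  by (simp_all add: quot_hopf_def Let_def)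

lemma tensor_quot_hopf [simp]:
  "tensor (quot_hopf H I) (quot_hopf H I) = tensor (quot_space H I) (quot_space H I)"
  "tens (quot_hopf H I) (quot_hopf H I) = tens (quot_space H I) (quot_space H I)"
  by (rule tensor_cong; simp)+

lemma quot_hopf_ops:
  "A \<otimes>\<^bsub>quot_hopf H I\<^esub> B = I +>\<^bsub>H\<^esub> (rep A \<otimes>\<^bsub>H\<^esub> rep B)"
  "\<one>\<^bsub>quot_hopf H I\<^esub> = I +>\<^bsub>H\<^esub> \<one>\<^bsub>H\<^esub>"
  "action (quot_hopf H I) h A = I +>\<^bsub>H\<^esub> action H h (rep A)"
  "coact (quot_hopf H I) A h = I +>\<^bsub>H\<^esub> coact H (rep A) h"
  "comult (quot_hopf H I) A =
    tensor_map (quot_space H I) (quot_space H I) (\<lambda>a. I +>\<^bsub>H\<^esub> a) (\<lambda>a. I +>\<^bsub>H\<^esub> a) (comult H (rep A))"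
  "counit (quot_hopf H I) A = counit H (rep A)"
  "antipode (quot_hopf H I) A = I +>\<^bsub>H\<^esub> antipode H (rep A)"
  "hdeg (quot_hopf H I) n = (\<lambda>a. I +>\<^bsub>H\<^esub> a) ` hdeg H n"
  by (simp_all add: quot_hopf_def Let_def)

text \<open>Images of cosets avoid choosing representatives for the induced map; the congruence conditions
  are needed only because the structure maps of \<open>quot_hopf\<close> use \<open>rep\<close>, which does not commute
  with the isomorphism.\<close>

lemma (in hopf_congruence) quot_hopf_iso:
  assumes H': "cvs H'" and iso: "graded_braided_hopf_iso G H H' \<phi>"
  shows "graded_braided_hopf_iso G (quot_hopf H I) (quot_hopf H' (\<phi> ` I)) (\<lambda>A. \<phi> ` A)"
proof -
  let ?I' = "\<phi> ` I" and ?Q = "quot_space H I" and ?Q' = "quot_space H' (\<phi> ` I)"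
  let ?\<pi> = "\<lambda>a. I +>\<^bsub>H\<^esub> a" and ?\<pi>' = "\<lambda>a. \<phi> ` I +>\<^bsub>H'\<^esub> a" and ?\<psi> = "\<lambda>A. \<phi> ` A"
  have \<phi>: "linear_map H H' \<phi>" and bij: "bij_betw \<phi> (carrier H) (carrier H')"
    and \<phi>_action: "\<And>h x. h \<in> carrier G \<Longrightarrow> x \<in> carrier H \<Longrightarrow> \<phi> (action H h x) = action H' h (\<phi> x)"
    and \<phi>_coact: "\<And>h x. h \<in> carrier G \<Longrightarrow> x \<in> carrier H \<Longrightarrow> \<phi> (coact H x h) = coact H' (\<phi> x) h"
    and \<phi>_mult: "\<And>x y. x \<in> carrier H \<Longrightarrow> y \<in> carrier H \<Longrightarrow> \<phi> (x \<otimes>\<^bsub>H\<^esub> y) = \<phi> x \<otimes>\<^bsub>H'\<^esub> \<phi> y"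
    and \<phi>_one: "\<phi> \<one>\<^bsub>H\<^esub> = \<one>\<^bsub>H'\<^esub>"
    and \<phi>_comult: "\<And>x. x \<in> carrier H \<Longrightarrow> tensor_map H' H' \<phi> \<phi> (comult H x) = comult H' (\<phi> x)"
    and \<phi>_counit: "\<And>x. x \<in> carrier H \<Longrightarrow> counit H x = counit H' (\<phi> x)"
    and \<phi>_antipode: "\<And>x. x \<in> carrier H \<Longrightarrow> \<phi> (antipode H x) = antipode H' (\<phi> x)"
    and \<phi>_hdeg: "\<And>n. \<phi> ` hdeg H n = hdeg H' n"
    using iso by (simp_all add: graded_braided_hopf_iso_def)
  have inj: "inj_on \<phi> (carrier H)" and im: "\<phi> ` carrier H = carrier H'"
    using bij by (auto simp: bij_betw_def)
  note \<phi>_closed = linear_mapD(1)[OF \<phi>]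
  have sub': "submodule ?I' \<C> H'" by (rule submodule_image[OF cvs_H H' \<phi> sub])
  note S = submoduleD[OF cvs_H sub]
  have Q: "cvs ?Q" "cvs ?Q'" using cvs_quot_space[OF cvs_H sub] cvs_quot_space[OF H' sub'] .
  have \<pi>: "linear_map H ?Q ?\<pi>" and \<pi>': "linear_map H' ?Q' ?\<pi>'"
    using coset_linear[OF cvs_H sub] coset_linear[OF H' sub'] .
  note carrier = carrier_quot_space[OF cvs_H sub] and carrier' = carrier_quot_space[OF H' sub']
  have \<psi>\<pi>: "?\<psi> (?\<pi> a) = ?\<pi>' (\<phi> a)" if a: "a \<in> carrier H" for a
  proof -
    have "?\<psi> (?\<pi> a) = (\<lambda>x. \<phi> (x \<oplus>\<^bsub>H\<^esub> a)) ` I" by (auto simp: a_r_coset_def')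
    also have "\<dots> = (\<lambda>x. \<phi> x \<oplus>\<^bsub>H'\<^esub> \<phi> a) ` I"
      by (rule image_cong) (use S(2) a linear_mapD(2)[OF \<phi>] in auto)
    also have "\<dots> = ?\<pi>' (\<phi> a)" by (auto simp: a_r_coset_def')
    finally show ?thesis .
  qed
  have ind: "\<exists>a\<in>carrier H. A = ?\<pi> a" if "A \<in> carrier ?Q" for A
    using that carrier by blast
  have \<psi>: "linear_map ?Q ?Q' ?\<psi>"
  proof (rule linear_mapI)
    fix A assume "A \<in> carrier ?Q"
    then obtain a where a: "a \<in> carrier H" "A = ?\<pi> a" using ind by blast
    show "?\<psi> A \<in> carrier ?Q'" using a \<psi>\<pi>[OF a(1)] linear_mapD(1)[OF \<pi>' \<phi>_closed[OF a(1)]] by simp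
    show "?\<psi> (c \<odot>\<^bsub>?Q\<^esub> A) = c \<odot>\<^bsub>?Q'\<^esub> ?\<psi> A" for c
    proof -
      have "?\<psi> (c \<odot>\<^bsub>?Q\<^esub> A) = ?\<psi> (?\<pi> (c \<odot>\<^bsub>H\<^esub> a))" using linear_mapD(3)[OF \<pi> a(1)] a(2) by simp
      also have "\<dots> = ?\<pi>' (c \<odot>\<^bsub>H'\<^esub> \<phi> a)" using \<psi>\<pi>[of "c \<odot>\<^bsub>H\<^esub> a"] a(1) cvs_H linear_mapD(3)[OF \<phi> a(1)] by simp
      also have "\<dots> = c \<odot>\<^bsub>?Q'\<^esub> ?\<psi> A" using linear_mapD(3)[OF \<pi>' \<phi>_closed[OF a(1)]] a(2) \<psi>\<pi>[OF a(1)] by simp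
      finally show ?thesis .
    qed
    fix B assume "B \<in> carrier ?Q"
    then obtain b where b: "b \<in> carrier H" "B = ?\<pi> b" using ind by blast
    have "?\<psi> (A \<oplus>\<^bsub>?Q\<^esub> B) = ?\<psi> (?\<pi> (a \<oplus>\<^bsub>H\<^esub> b))" using linear_mapD(2)[OF \<pi> a(1) b(1)] a(2) b(2) by simp
    also have "\<dots> = ?\<pi>' (\<phi> a \<oplus>\<^bsub>H'\<^esub> \<phi> b)" using \<psi>\<pi>[of "a \<oplus>\<^bsub>H\<^esub> b"] a(1) b(1) cvs_H linear_mapD(2)[OF \<phi> a(1) b(1)] by simp
    also have "\<dots> = ?\<psi> A \<oplus>\<^bsub>?Q'\<^esub> ?\<psi> B"
      using linear_mapD(2)[OF \<pi>' \<phi>_closed[OF a(1)] \<phi>_closed[OF b(1)]] a(2) b(2) \<psi>\<pi>[OF a(1)] \<psi>\<pi>[OF b(1)] by simp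
    finally show "?\<psi> (A \<oplus>\<^bsub>?Q\<^esub> B) = ?\<psi> A \<oplus>\<^bsub>?Q'\<^esub> ?\<psi> B" .
  qed
  have A_sub: "A \<subseteq> carrier H" if A: "A \<in> carrier ?Q" for A
  proof -
    obtain a where a: "a \<in> carrier H" "A = ?\<pi> a" using ind[OF A] by blast
    show ?thesis using coset_memD(1)[OF cvs_H sub a(1)] a(2) by blast
  qed
  have bij\<psi>: "bij_betw ?\<psi> (carrier ?Q) (carrier ?Q')"
    unfolding bij_betw_def
  proof
    show "inj_on ?\<psi> (carrier ?Q)"
      by (rule inj_onI) (use inj_on_image_eq_iff[OF inj] A_sub in blast)
    have "?\<psi> ` carrier ?Q = (\<lambda>a. ?\<psi> (?\<pi> a)) ` carrier H" unfolding carrier by blast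
    also have "\<dots> = (\<lambda>a. ?\<pi>' (\<phi> a)) ` carrier H" by (rule image_cong) (use \<psi>\<pi> in auto)
    also have "\<dots> = carrier ?Q'" unfolding carrier' im[symmetric] by blast
    finally show "?\<psi> ` carrier ?Q = carrier ?Q'" .
  qed
  have rep: "rep A \<in> carrier H" if "A \<in> carrier ?Q" for A
    by (rule rep_coset(2)[OF cvs_H sub that])
  \<comment> \<open>The representative chosen in the image coset is \<open>\<phi> a\<close> for some
    \<open>a\<close> in \<open>A\<close>. It may differ from \<open>\<phi> (rep A)\<close>, but
    \<open>a\<close> and \<open>rep A\<close> differ by an element of \<open>I\<close>, which the
    congruence conditions absorb.\<close>
  have rep': "\<exists>a\<in>carrier H. rep (?\<psi> A) = \<phi> a \<and> a \<ominus>\<^bsub>H\<^esub> rep A \<in> I" if A: "A \<in> carrier ?Q" for A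
  proof -
    have "rep (?\<psi> A) \<in> ?\<psi> A" by (rule rep_coset(1)[OF H' sub' linear_mapD(1)[OF \<psi> A]])
    then obtain a where a: "a \<in> A" "rep (?\<psi> A) = \<phi> a" by blast
    have "a \<in> I +>\<^bsub>H\<^esub> rep A" using a(1) rep_coset(3)[OF cvs_H sub A] by simp
    then have "a \<in> carrier H" "a \<ominus>\<^bsub>H\<^esub> rep A \<in> I" using coset_mem_iff[OF cvs_H sub rep[OF A]] by auto
    then show ?thesis using a(2) by blast
  qed
  have \<pi>_eq: "?\<pi>' (\<phi> a) = ?\<psi> (?\<pi> b)" if "a \<in> carrier H" "b \<in> carrier H" "a \<ominus>\<^bsub>H\<^esub> b \<in> I" for a b
    using that coset_eq_iff[OF cvs_H sub that(1,2)] \<psi>\<pi>[OF that(1)] by simp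
  show ?thesis
    unfolding graded_braided_hopf_iso_def
  proof (intro conjI ballI allI)
    show "linear_map (quot_hopf H I) (quot_hopf H' ?I') ?\<psi>"
      using \<psi> by (simp add: linear_map_def)
    show "bij_betw ?\<psi> (carrier (quot_hopf H I)) (carrier (quot_hopf H' ?I'))" using bij\<psi> by simp
    show "?\<psi> \<one>\<^bsub>quot_hopf H I\<^esub> = \<one>\<^bsub>quot_hopf H' ?I'\<^esub>"
      unfolding quot_hopf_ops \<phi>_one[symmetric] by (rule \<psi>\<pi>[OF one_closed])
    show "?\<psi> ` hdeg (quot_hopf H I) n = hdeg (quot_hopf H' ?I') n" for n
    proof -
      have "?\<psi> ` ?\<pi> ` hdeg H n = (\<lambda>a. ?\<pi>' (\<phi> a)) ` hdeg H n"
        unfolding image_image by (rule image_cong) (use \<psi>\<pi> hdeg_closed in auto)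
      then show ?thesis unfolding quot_hopf_ops \<phi>_hdeg[symmetric] image_image .
    qed
    fix A assume "A \<in> carrier (quot_hopf H I)"
    then have A: "A \<in> carrier ?Q" by simp
    obtain a where a: "a \<in> carrier H" "rep (?\<psi> A) = \<phi> a" "a \<ominus>\<^bsub>H\<^esub> rep A \<in> I" using rep'[OF A] by blast
    show "?\<psi> (action (quot_hopf H I) h A) = action (quot_hopf H' ?I') h (?\<psi> A)" if h: "h \<in> carrier G" for h
      unfolding quot_hopf_ops a(2) \<phi>_action[OF h a(1), symmetric]
      by (rule \<pi>_eq[OF action_closed[OF h a(1)] action_closed[OF h rep[OF A]] action_cong[OF h rep[OF A] a(1,3)], symmetric])
    show "?\<psi> (coact (quot_hopf H I) A h) = coact (quot_hopf H' ?I') (?\<psi> A) h" if h: "h \<in> carrier G" for h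
      unfolding quot_hopf_ops a(2) \<phi>_coact[OF h a(1), symmetric]
      by (rule \<pi>_eq[OF coact_closed[OF h a(1)] coact_closed[OF h rep[OF A]] coact_cong[OF h rep[OF A] a(1,3)], symmetric])
    show "?\<psi> (antipode (quot_hopf H I) A) = antipode (quot_hopf H' ?I') (?\<psi> A)"
      unfolding quot_hopf_ops a(2) \<phi>_antipode[OF a(1), symmetric]
      by (rule \<pi>_eq[OF antipode_closed[OF a(1)] antipode_closed[OF rep[OF A]] antipode_cong[OF rep[OF A] a(1,3)], symmetric])
    show "counit (quot_hopf H I) A = counit (quot_hopf H' ?I') (?\<psi> A)"
      unfolding quot_hopf_ops a(2) \<phi>_counit[OF a(1), symmetric]
      by (rule counit_cong[OF rep[OF A] a(1,3), symmetric])
    show "?\<psi> (A \<otimes>\<^bsub>quot_hopf H I\<^esub> B) = ?\<psi> A \<otimes>\<^bsub>quot_hopf H' ?I'\<^esub> ?\<psi> B" if "B \<in> carrier (quot_hopf H I)" for B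
    proof -
      have B: "B \<in> carrier ?Q" using that by simp
      obtain b where b: "b \<in> carrier H" "rep (?\<psi> B) = \<phi> b" "b \<ominus>\<^bsub>H\<^esub> rep B \<in> I" using rep'[OF B] by blast
      show ?thesis
        unfolding quot_hopf_ops a(2) b(2) \<phi>_mult[OF a(1) b(1), symmetric]
        by (rule \<pi>_eq[OF mult_closed[OF a(1) b(1)] mult_closed[OF rep[OF A] rep[OF B]]
              mult_cong[OF rep[OF A] rep[OF B] a(1) b(1) a(3) b(3)], symmetric])
    qed
    show "tensor_map (quot_hopf H' ?I') (quot_hopf H' ?I') ?\<psi> ?\<psi> (comult (quot_hopf H I) A) = comult (quot_hopf H' ?I') (?\<psi> A)"
    proof -
      have tm: "tensor_map (quot_hopf H' ?I') (quot_hopf H' ?I') ?\<psi> ?\<psi> = tensor_map ?Q' ?Q' ?\<psi> ?\<psi>"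
        by (simp add: tensor_map_def lift_def lin_ext_def fun_eq_iff)
      have "comult (quot_hopf H' ?I') (?\<psi> A) = tensor_map ?Q' ?Q' ?\<pi>' ?\<pi>' (tensor_map H' H' \<phi> \<phi> (comult H a))"
        unfolding quot_hopf_ops a(2) \<phi>_comult[OF a(1)] ..
      also have "\<dots> = tensor_map ?Q' ?Q' (\<lambda>a. ?\<pi>' (\<phi> a)) (\<lambda>a. ?\<pi>' (\<phi> a)) (comult H a)"
        by (rule tensor_map_comp[OF cvs_H cvs_H H' H' Q(2,2) \<phi> \<phi> \<pi>' \<pi>' comult_closed[OF a(1)]])
      also have "\<dots> = tensor_map ?Q' ?Q' (\<lambda>a. ?\<psi> (?\<pi> a)) (\<lambda>a. ?\<psi> (?\<pi> a)) (comult H a)"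
        by (rule tensor_map_cong[OF cvs_H cvs_H Q(2,2) linear_map_comp[OF \<pi>' \<phi>] linear_map_comp[OF \<pi>' \<phi>] _ _ comult_closed[OF a(1)]])
          (simp_all add: \<psi>\<pi>)
      also have "\<dots> = tensor_map ?Q' ?Q' ?\<psi> ?\<psi> (tensor_map ?Q ?Q ?\<pi> ?\<pi> (comult H a))"
        by (rule tensor_map_comp[OF cvs_H cvs_H Q(1,1) Q(2,2) \<pi> \<pi> \<psi> \<psi> comult_closed[OF a(1)], symmetric])
      also have "\<dots> = tensor_map ?Q' ?Q' ?\<psi> ?\<psi> (comult (quot_hopf H I) A)"
        unfolding quot_hopf_ops comult_cong[OF rep[OF A] a(1,3)] ..
      finally show ?thesis unfolding tm ..
    qed
  qed
qed

lemma (in yd) hopf_congruence_nichols_kernel: "hopf_congruence G (tensor_hopf G M) nichols_kernel"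
proof -
  note K = nichols_kernel_submodule
  have diff: "f a' \<ominus>\<^bsub>T\<^esub> f a \<in> nichols_kernel"
    if "linear_map T T f" "\<And>I x. I \<in> nichols_ideals G M \<Longrightarrow> x \<in> I \<Longrightarrow> f x \<in> I"
      "a \<in> carrier T" "a' \<in> carrier T" "a' \<ominus>\<^bsub>T\<^esub> a \<in> nichols_kernel" for f a a'
    using nichols_kernel_linear[OF that(1,2,5)] linear_map_diff[OF cvs_T cvs_T that(1) that(4,3)] by simp
  have minus: "a_minus (tensor_hopf G M) = a_minus T" by (rule finsum_cong_structure) simp_all
  have eq: "f a' = f a" if "linear_map T U f" "cvs U" "f (a' \<ominus>\<^bsub>T\<^esub> a) = \<zero>\<^bsub>U\<^esub>" "a \<in> carrier T" "a' \<in> carrier T"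
    for U :: "(complex, 'u) module" and f a a'
    using that linear_map_diff[OF cvs_T that(2,1,5,4)] linear_mapD(1)[OF that(1)] by simp
  show ?thesis
  \<comment> \<open>The locale speaks of \<open>tensor_hopf\<close>; the rewriting moves all goals
    to \<open>tensor_space\<close>, where the preceding facts are stated.\<close>
  proof (rule hopf_congruence.intro, unfold tensor_tensor_algebra tensor_hopf_simps minus coset_tensor_hopf quot_space_tensor_hopf
      submodule_tensor_hopf)
    show "cvs (tensor_hopf G M)" by (rule cvs_cong[OF cvs_T]) simp_all
    show "hdeg (tensor_hopf G M) n \<subseteq> carrier T" for n
      unfolding hdeg_eq by (rule lin_span_subset[OF cvs_T]) (use word_cl in blast)
    show "act h a' \<ominus>\<^bsub>T\<^esub> act h a \<in> nichols_kernel"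
      if "h \<in> carrier G" "a \<in> carrier T" "a' \<in> carrier T" "a' \<ominus>\<^bsub>T\<^esub> a \<in> nichols_kernel" for h a a'
      using diff[OF act_linear[OF that(1)] nichols_idealD(3)[OF _ that(1)] that(2-4)] .
    show "coa a' h \<ominus>\<^bsub>T\<^esub> coa a h \<in> nichols_kernel"
      if "h \<in> carrier G" "a \<in> carrier T" "a' \<in> carrier T" "a' \<ominus>\<^bsub>T\<^esub> a \<in> nichols_kernel" for h a a'
      using diff[OF coa_linear[OF that(1)] nichols_idealD(4)[OF _ that(1)] that(2-4)] .
    show "anti a' \<ominus>\<^bsub>T\<^esub> anti a \<in> nichols_kernel"
      if "a \<in> carrier T" "a' \<in> carrier T" "a' \<ominus>\<^bsub>T\<^esub> a \<in> nichols_kernel" for a a'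
      using diff[OF anti_linear nichols_ideal_anti that] .
    show "eps a' = eps a" if "a \<in> carrier T" "a' \<in> carrier T" "a' \<ominus>\<^bsub>T\<^esub> a \<in> nichols_kernel" for a a'
      by (rule eq[OF eps_linear cvs_complex_space _ that(1,2)]) (simp add: nichols_kernel_eps[OF that(3)])
    show "mul a' b' \<ominus>\<^bsub>T\<^esub> mul a b \<in> nichols_kernel"
      if c: "a \<in> carrier T" "b \<in> carrier T" "a' \<in> carrier T" "b' \<in> carrier T"
        "a' \<ominus>\<^bsub>T\<^esub> a \<in> nichols_kernel" "b' \<ominus>\<^bsub>T\<^esub> b \<in> nichols_kernel" for a b a' b'
    proof -
      \<comment> \<open>The telescoping \<open>a' b' - a b = (a' - a) b' + a (b' - b)\<close> uses
        the two-sided ideal property once on each side.\<close>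
      have "mul (a' \<ominus>\<^bsub>T\<^esub> a) b' \<oplus>\<^bsub>T\<^esub> mul a (b' \<ominus>\<^bsub>T\<^esub> b) \<in> nichols_kernel"
        by (rule submoduleD(4)[OF cvs_T K nichols_kernel_mul(1)[OF c(5,4)] nichols_kernel_mul(2)[OF c(6,1)]])
      moreover have "mul (a' \<ominus>\<^bsub>T\<^esub> a) b' \<oplus>\<^bsub>T\<^esub> mul a (b' \<ominus>\<^bsub>T\<^esub> b) = mul a' b' \<ominus>\<^bsub>T\<^esub> mul a b"
      proof -
        have 1: "mul (a' \<ominus>\<^bsub>T\<^esub> a) b' = mul a' b' \<ominus>\<^bsub>T\<^esub> mul a b'"
          by (rule linear_map_diff[OF cvs_T cvs_T mul_linear_left[OF c(4)] c(3,1)])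
        have 2: "mul a (b' \<ominus>\<^bsub>T\<^esub> b) = mul a b' \<ominus>\<^bsub>T\<^esub> mul a b"
          by (rule linear_map_diff[OF cvs_T cvs_T mul_linear_right[OF c(1)] c(4,2)])
        have "(u \<ominus>\<^bsub>T\<^esub> v) \<oplus>\<^bsub>T\<^esub> (v \<ominus>\<^bsub>T\<^esub> w) = u \<ominus>\<^bsub>T\<^esub> w"
          if "u \<in> carrier T" "v \<in> carrier T" "w \<in> carrier T" for u v w
        proof -
          have "(u \<ominus>\<^bsub>T\<^esub> v) \<oplus>\<^bsub>T\<^esub> (v \<ominus>\<^bsub>T\<^esub> w) = (v \<ominus>\<^bsub>T\<^esub> v) \<oplus>\<^bsub>T\<^esub> (u \<ominus>\<^bsub>T\<^esub> w)"
            using that cvs_T by (simp add: cvs_diff cvs_add_ac)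
          also have "v \<ominus>\<^bsub>T\<^esub> v = \<zero>\<^bsub>T\<^esub>" using that cvs_T by (simp only: cvs_diff_eq_zero)
          finally show ?thesis using that cvs_T by simp
        qed
        then show ?thesis unfolding 1 2 using c by simp
      qed
      ultimately show ?thesis by simp
    qed
    show "tensor_map (quot_space T nichols_kernel) (quot_space T nichols_kernel)
        (\<lambda>a. nichols_kernel +>\<^bsub>T\<^esub> a) (\<lambda>a. nichols_kernel +>\<^bsub>T\<^esub> a) (Delta a') =
      tensor_map (quot_space T nichols_kernel) (quot_space T nichols_kernel)
        (\<lambda>a. nichols_kernel +>\<^bsub>T\<^esub> a) (\<lambda>a. nichols_kernel +>\<^bsub>T\<^esub> a) (Delta a)"
      if "a \<in> carrier T" "a' \<in> carrier T" "a' \<ominus>\<^bsub>T\<^esub> a \<in> nichols_kernel" for a a'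
    proof -
      note Q = cvs_quot_space[OF cvs_T K] and \<pi> = coset_linear[OF cvs_T K]
      show ?thesis
        by (rule eq[OF linear_map_comp[OF tensor_map_linear[OF cvs_T cvs_T Q Q \<pi> \<pi>] Delta_linear] cvs_tensor[OF Q Q]
              nichols_kernel_Delta[OF that(3)] that(1,2)])
    qed
  qed (use K in simp_all)
qed

section \<open>Functoriality of the Nichols algebra\<close>

definition tensor_space_map :: "(complex, 'w, 'n) module_scheme \<Rightarrow> ('v \<Rightarrow> 'w) \<Rightarrow> ('v list \<Rightarrow> complex) set \<Rightarrow> ('w list \<Rightarrow> complex) set" where
  "tensor_space_map N f = lift (tensor_space N) (\<lambda>w. word N (map f w))"

lemma tensor_space_map_linear:
  "cvs M \<Longrightarrow> cvs N \<Longrightarrow> linear_map M N f \<Longrightarrow> linear_map (tensor_space M) (tensor_space N) (tensor_space_map N f)"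
  unfolding tensor_space_map_def
  by (rule lift_word_linear[OF _ cvs_tensor_space multilinear_map_map[OF word_multilinear]])

lemma tensor_space_map_word:
  "cvs M \<Longrightarrow> cvs N \<Longrightarrow> linear_map M N f \<Longrightarrow> w \<in> lists (carrier M) \<Longrightarrow> tensor_space_map N f (word M w) = word N (map f w)"
  unfolding tensor_space_map_def
  by (rule lift_word[OF _ cvs_tensor_space multilinear_map_map[OF word_multilinear]])

lemma map_in_lists: "linear_map M N f \<Longrightarrow> w \<in> lists (carrier M) \<Longrightarrow> map f w \<in> lists (carrier N)"
  by (auto simp: linear_mapD(1))

lemma tensor_space_map_inverse:
  assumes "cvs M" "cvs N" "linear_map M N f" "linear_map N M f'" "\<And>x. x \<in> carrier M \<Longrightarrow> f' (f x) = x"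
    "a \<in> carrier (tensor_space M)"
  shows "tensor_space_map M f' (tensor_space_map N f a) = a"
proof (rule tensor_space_linear_map_eqI[OF assms(1) cvs_tensor_space[OF assms(1)]
      linear_map_comp[OF tensor_space_map_linear[OF assms(2,1,4)] tensor_space_map_linear[OF assms(1-3)]] linear_map_id _ assms(6)])
  fix w assume w: "w \<in> lists (carrier M)"
  have "map (\<lambda>x. f' (f x)) w = w" by (rule map_idI) (use w assms(5) in auto)
  then show "tensor_space_map M f' (tensor_space_map N f (word M w)) = word M w"
    using tensor_space_map_word[OF assms(1-3) w] tensor_space_map_word[OF assms(2,1,4) map_in_lists[OF assms(3) w]]
    by (simp add: comp_def)
qed

lemma tensor_bilinear_map_eqI:
  assumes "cvs V" "cvs W" "cvs V'" "cvs W'" "cvs U" "bilinear_map (tensor V W) (tensor V' W') U \<beta>"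
    "bilinear_map (tensor V W) (tensor V' W') U \<gamma>"
    "\<And>a b c d. a \<in> carrier V \<Longrightarrow> b \<in> carrier W \<Longrightarrow> c \<in> carrier V' \<Longrightarrow> d \<in> carrier W' \<Longrightarrow>
      \<beta> (tens V W a b) (tens V' W' c d) = \<gamma> (tens V W a b) (tens V' W' c d)"
    "x \<in> carrier (tensor V W)" "y \<in> carrier (tensor V' W')"
  shows "\<beta> x y = \<gamma> x y"
  by (rule bilinear_map_eq_on_span[OF cvs_tensor[OF assms(1,2)] cvs_tensor[OF assms(3,4)] assms(5-7) _ _ _
        assms(9)[folded tensor_span[OF assms(1,2)]] assms(10)[folded tensor_span[OF assms(3,4)]]])
    (use assms(8) tens_closed[OF assms(1,2)] tens_closed[OF assms(3,4)] in blast)+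

context linear_yd
begin

lemma ideal_tensor_hopfI:
  assumes "submodule I \<C> T" "\<And>x y. x \<in> I \<Longrightarrow> y \<in> carrier T \<Longrightarrow> mul x y \<in> I" "\<And>x y. x \<in> I \<Longrightarrow> y \<in> carrier T \<Longrightarrow> mul y x \<in> I"
  shows "ideal I (tensor_hopf G M)"
proof (rule idealI[OF ring_tensor_hopf])
  have "submodule I \<C> (tensor_hopf G M)" using assms(1) by (simp add: submodule_tensor_hopf)
  then show "subgroup I (add_monoid (tensor_hopf G M))" by (rule submodule.axioms(1))
qed (use assms(2,3) in simp_all)

text \<open>A ring-theoretic ideal knows nothing of scalars; closure under scaling comes from
  multiplying by the multiple \<open>c 1\<close> of the unit.\<close>

lemma ideal_tensor_hopfD:
  assumes "ideal I (tensor_hopf G M)"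
  shows "submodule I \<C> T" "x \<in> I \<Longrightarrow> y \<in> carrier T \<Longrightarrow> mul x y \<in> I" "x \<in> I \<Longrightarrow> y \<in> carrier T \<Longrightarrow> mul y x \<in> I"
proof -
  interpret ideal I "tensor_hopf G M" by (rule assms)
  show l: "mul x y \<in> I" "mul y x \<in> I" if "x \<in> I" "y \<in> carrier T" for x y
    using I_l_closed[of x y] I_r_closed[of x y] that by simp_all
  have I: "I \<subseteq> carrier T" using a_subset by simp
  show "submodule I \<C> T"
  proof (rule cvs_submoduleI[OF cvs_T I])
    show "\<zero>\<^bsub>T\<^esub> \<in> I" using additive_subgroup.zero_closed[OF is_additive_subgroup] by simp
    show "x \<oplus>\<^bsub>T\<^esub> y \<in> I" if "x \<in> I" "y \<in> I" for x y using additive_subgroup.a_closed[OF is_additive_subgroup that] by simp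
    show "c \<odot>\<^bsub>T\<^esub> x \<in> I" if x: "x \<in> I" for c x
    proof -
      have "mul (c \<odot>\<^bsub>T\<^esub> word M []) x = c \<odot>\<^bsub>T\<^esub> x"
        using linear_mapD(3)[OF mul_linear_left[of x] unit_closed] x I by auto
      then show ?thesis using l(2)[OF x, of "c \<odot>\<^bsub>T\<^esub> word M []"] cvs_T by simp
    qed
  qed
qed

end

section \<open>Naturality of all structure maps in the module\<close>

locale yd_morphism = M: linear_yd G M + N: linear_yd G N
  for G :: "('g, 'm) monoid_scheme" and M :: "('g, 'v) yd_module" and N :: "('g, 'w) yd_module" +
  fixes f :: "'v \<Rightarrow> 'w"
  assumes f_linear: "linear_map M N f"
    and f_action: "h \<in> carrier G \<Longrightarrow> x \<in> carrier M \<Longrightarrow> f (action M h x) = action N h (f x)"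
    and f_coact: "h \<in> carrier G \<Longrightarrow> x \<in> carrier M \<Longrightarrow> f (coact M x h) = coact N (f x) h"
begin

abbreviation "F \<equiv> tensor_space_map N f"
abbreviation "FF \<equiv> tensor_map N.T N.T F F"

lemmas F_linear = tensor_space_map_linear[OF M.cvs_M N.cvs_M f_linear]
lemmas F_word = tensor_space_map_word[OF M.cvs_M N.cvs_M f_linear]
lemmas F_closed [simp] = linear_mapD(1)[OF F_linear]
lemmas f_closed = linear_mapD(1)[OF f_linear]
lemmas FF_linear = tensor_map_linear[OF M.cvs_T M.cvs_T N.cvs_T N.cvs_T F_linear F_linear]
lemmas FF_tens = tensor_map_tens[OF M.cvs_T M.cvs_T N.cvs_T N.cvs_T F_linear F_linear]

lemma map_f_lists: "w \<in> lists (carrier M) \<Longrightarrow> map f w \<in> lists (carrier N)"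
  by (rule map_in_lists[OF f_linear])

lemma F_unit [simp]: "F (word M []) = word N []"
  using F_word[of "[]"] by simp

lemma F_mul:
  assumes "a \<in> carrier M.T" "b \<in> carrier M.T"
  shows "F (M.mul a b) = N.mul (F a) (F b)"
  by (rule tensor_space_bilinear_map_eqI[OF M.cvs_M M.cvs_M N.cvs_T linear_map_comp_bilinear[OF M.mul_bilinear F_linear]
        bilinear_map_comp[OF N.mul_bilinear F_linear F_linear] _ assms])
    (use map_f_lists in \<open>simp add: M.mul_word N.mul_word F_word append_in_lists_conv del: in_lists_conv_set\<close>)

lemma F_act:
  assumes h: "h \<in> carrier G" and a: "a \<in> carrier M.T"
  shows "F (M.act h a) = N.act h (F a)"
proof (rule tensor_space_linear_map_eqI[OF M.cvs_M N.cvs_T linear_map_comp[OF F_linear M.act_linear[OF h]]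
      linear_map_comp[OF N.act_linear[OF h] F_linear] _ a])
  fix w assume w: "w \<in> lists (carrier M)"
  have "map f (map (action M h) w) = map (action N h) (map f w)"
    using w f_action[OF h] by auto
  then show "F (M.act h (word M w)) = N.act h (F (word M w))"
    using M.act_word[OF h w] F_word[OF w] F_word[OF M.map_action_lists[OF h w]] N.act_word[OF h map_f_lists[OF w]]
    by (simp del: map_map)
qed

lemma F_word_coact:
  "w \<in> lists (carrier M) \<Longrightarrow> h \<in> carrier G \<Longrightarrow> F (word_coact G M w h) = word_coact G N (map f w) h"
proof (induction w arbitrary: h)
  case Nil
  show ?case using linear_map_zero[OF M.cvs_T N.cvs_T F_linear] by simp
next
  case (Cons x w)
  interpret group G by (rule M.group_G)
  have x: "x \<in> carrier M" and w: "w \<in> lists (carrier M)" using Cons.prems by auto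
  have wc: "word_coact G M w (inv\<^bsub>G\<^esub> g \<otimes>\<^bsub>G\<^esub> h) \<in> carrier M.T" if "g \<in> carrier G" for g
    using M.word_coact_closed[OF w] that Cons.prems by simp
  have lc: "word M [coact M x g] \<in> carrier M.T" if "g \<in> carrier G" for g
    using M.coact_closed[OF x that] by simp
  have "F (word_coact G M (x # w) h) =
      (\<Oplus>\<^bsub>N.T\<^esub>g\<in>carrier G. F (M.mul (word M [coact M x g]) (word_coact G M w (inv\<^bsub>G\<^esub> g \<otimes>\<^bsub>G\<^esub> h))))"
    unfolding word_coact.simps
    by (rule linear_map_sum[OF M.cvs_T N.cvs_T F_linear M.finite_G]) (use wc lc in auto)
  also have "\<dots> = word_coact G N (map f (x # w)) h"
    unfolding word_coact.simps list.map(2)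
  proof (rule cvs_sum_cong[OF N.cvs_T refl])
    show "(\<lambda>g. N.mul (word N [coact N (f x) g]) (word_coact G N (map f w) (inv\<^bsub>G\<^esub> g \<otimes>\<^bsub>G\<^esub> h))) \<in> carrier G \<rightarrow> carrier N.T"
      using N.coact_closed[OF f_closed[OF x]] N.word_coact_closed[OF map_f_lists[OF w]] Cons.prems by auto
    fix g assume g: "g \<in> carrier G"
    have "F (word M [coact M x g]) = word N [coact N (f x) g]"
      using F_word[of "[coact M x g]"] M.coact_closed[OF x g] f_coact[OF g x] by simp
    moreover have "F (word_coact G M w (inv\<^bsub>G\<^esub> g \<otimes>\<^bsub>G\<^esub> h)) = word_coact G N (map f w) (inv\<^bsub>G\<^esub> g \<otimes>\<^bsub>G\<^esub> h)"
      using Cons.IH[OF w, of "inv\<^bsub>G\<^esub> g \<otimes>\<^bsub>G\<^esub> h"] g Cons.prems by simp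
    ultimately show "F (M.mul (word M [coact M x g]) (word_coact G M w (inv\<^bsub>G\<^esub> g \<otimes>\<^bsub>G\<^esub> h))) =
        N.mul (word N [coact N (f x) g]) (word_coact G N (map f w) (inv\<^bsub>G\<^esub> g \<otimes>\<^bsub>G\<^esub> h))"
      using F_mul[OF lc[OF g] wc[OF g]] by simp
  qed
  finally show ?case .
qed

lemma F_coa:
  assumes h: "h \<in> carrier G" and a: "a \<in> carrier M.T"
  shows "F (M.coa a h) = N.coa (F a) h"
  by (rule tensor_space_linear_map_eqI[OF M.cvs_M N.cvs_T linear_map_comp[OF F_linear M.coa_linear[OF h]]
      linear_map_comp[OF N.coa_linear[OF h] F_linear] _ a])
    (use h map_f_lists in \<open>simp add: M.coa_word F_word N.coa_word F_word_coact del: in_lists_conv_set\<close>)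

lemma FF_bmul:
  assumes "P \<in> carrier M.TT" "Q \<in> carrier M.TT"
  shows "FF (M.bmul P Q) = N.bmul (FF P) (FF Q)"
proof (rule tensor_bilinear_map_eqI[OF M.cvs_T M.cvs_T M.cvs_T M.cvs_T N.cvs_TT
      linear_map_comp_bilinear[OF M.bmul_bilinear FF_linear] bilinear_map_comp[OF N.bmul_bilinear FF_linear FF_linear] _ assms])
  fix a b c d assume *: "a \<in> carrier M.T" "b \<in> carrier M.T" "c \<in> carrier M.T" "d \<in> carrier M.T"
  let ?t = "\<lambda>g. M.ten (M.mul a (M.act g c)) (M.mul (M.coa b g) d)"
  have "FF (\<Oplus>\<^bsub>M.TT\<^esub>g\<in>carrier G. ?t g) = (\<Oplus>\<^bsub>N.TT\<^esub>g\<in>carrier G. FF (?t g))"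
    by (rule linear_map_sum[OF M.cvs_TT N.cvs_TT FF_linear M.finite_G]) (use * in auto)
  also have "\<dots> = (\<Oplus>\<^bsub>N.TT\<^esub>g\<in>carrier G. N.ten (N.mul (F a) (N.act g (F c))) (N.mul (N.coa (F b) g) (F d)))"
    by (rule cvs_sum_cong[OF N.cvs_TT refl]) (use * in \<open>auto simp: FF_tens F_mul F_act F_coa\<close>)
  finally show "FF (M.bmul (M.ten a b) (M.ten c d)) = N.bmul (FF (M.ten a b)) (FF (M.ten c d))"
    using * by (simp add: M.bmul_tens N.bmul_tens FF_tens M.bterm_def N.bterm_def)
qed

lemma F_letter: "x \<in> carrier M \<Longrightarrow> F (word M [x]) = word N [f x]"
  using F_word[of "[x]"] by simp

lemma FF_primitive:
  assumes x: "x \<in> carrier M"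
  shows "FF (M.primitive x) = N.primitive (f x)"
  unfolding M.primitive_def N.primitive_def
  using linear_mapD(2)[OF FF_linear, of "M.ten (word M [x]) (word M [])" "M.ten (word M []) (word M [x])"] x
  by (simp add: FF_tens F_letter)

lemma FF_Delta:
  assumes a: "a \<in> carrier M.T"
  shows "FF (M.Delta a) = N.Delta (F a)"
proof (rule tensor_space_linear_map_eqI[OF M.cvs_M N.cvs_TT linear_map_comp[OF FF_linear M.Delta_linear]
      linear_map_comp[OF N.Delta_linear F_linear] _ a])
  fix w assume w: "w \<in> lists (carrier M)"
  have "FF (word_comult G M w) = word_comult G N (map f w)"
    using w
  proof (induction w)
    case Nil
    then show ?case by (simp add: FF_tens)
  next
    case (Cons x w)
    then have "word_comult G M w \<in> carrier M.TT" using M.Delta_word M.Delta_closed M.word_cl by metis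
    then show ?case
      using Cons FF_bmul FF_primitive
      by (simp add: M.word_comult_Cons N.word_comult_Cons del: word_comult.simps(2))
  qed
  then show "FF (M.Delta (word M w)) = N.Delta (F (word M w))"
    using M.Delta_word[OF w] N.Delta_word[OF map_f_lists[OF w]] F_word[OF w] by simp
qed

lemma F_anti_step:
  assumes x: "x \<in> carrier M" and a: "a \<in> carrier M.T"
  shows "F (M.anti_step x a) = N.anti_step (f x) (F a)"
proof -
  let ?t = "\<lambda>g. M.mul (M.act g a) (word M [coact M x g])"
  have t: "?t \<in> carrier G \<rightarrow> carrier M.T" using a M.coact_closed[OF x] by auto
  have "F (\<Oplus>\<^bsub>M.T\<^esub>g\<in>carrier G. ?t g) = (\<Oplus>\<^bsub>N.T\<^esub>g\<in>carrier G. F (?t g))"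
    by (rule linear_map_sum[OF M.cvs_T N.cvs_T F_linear M.finite_G t])
  also have "\<dots> = (\<Oplus>\<^bsub>N.T\<^esub>g\<in>carrier G. N.mul (N.act g (F a)) (word N [coact N (f x) g]))"
    by (rule cvs_sum_cong[OF N.cvs_T refl])
      (use x a M.coact_closed[OF x] N.coact_closed[OF f_closed[OF x]] in \<open>auto simp: F_mul F_act F_letter f_coact\<close>)
  finally show ?thesis
    unfolding M.anti_step_def N.anti_step_def
    using linear_map_minus[OF M.cvs_T N.cvs_T F_linear cvs_sum_closed[OF M.cvs_T t]] by simp
qed

lemma F_anti:
  assumes a: "a \<in> carrier M.T"
  shows "F (M.anti a) = N.anti (F a)"
proof (rule tensor_space_linear_map_eqI[OF M.cvs_M N.cvs_T linear_map_comp[OF F_linear M.anti_linear]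
      linear_map_comp[OF N.anti_linear F_linear] _ a])
  fix w assume w: "w \<in> lists (carrier M)"
  have "F (word_antipode G M w) = word_antipode G N (map f w)"
    using w
  proof (induction w)
    case (Cons x w)
    then have "word_antipode G M w \<in> carrier M.T" using M.anti_word M.anti_closed M.word_cl by metis
    then show ?case
      using Cons F_anti_step
      by (simp add: M.word_antipode_Cons N.word_antipode_Cons del: word_antipode.simps(2))
  qed simp
  then show "F (M.anti (word M w)) = N.anti (F (word M w))"
    using M.anti_word[OF w] N.anti_word[OF map_f_lists[OF w]] F_word[OF w] by simp
qed

lemma F_eps:
  assumes a: "a \<in> carrier M.T"
  shows "M.eps a = N.eps (F a)"
  by (rule tensor_space_linear_map_eqI[OF M.cvs_M cvs_complex_space M.eps_linear linear_map_comp[OF N.eps_linear F_linear] _ a])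
    (use map_f_lists in \<open>simp add: M.eps_word N.eps_word F_word del: in_lists_conv_set\<close>)

lemma F_hdeg: "F ` hdeg (tensor_hopf G M) n \<subseteq> hdeg (tensor_hopf G N) n"
proof -
  have gM: "{word M w | w. w \<in> lists (carrier M) \<and> length w = n} \<subseteq> carrier M.T"
    and gN: "{word N w | w. w \<in> lists (carrier N) \<and> length w = n} \<subseteq> carrier N.T"
    using M.word_cl N.word_cl by blast+
  show ?thesis
    unfolding M.hdeg_eq N.hdeg_eq linear_map_image_span[OF M.cvs_T N.cvs_T F_linear gM]
  proof (rule lin_span_mono[OF N.cvs_T gN], rule subsetI)
    fix y assume "y \<in> F ` {word M w | w. w \<in> lists (carrier M) \<and> length w = n}"
    then obtain w where w: "w \<in> lists (carrier M)" "length w = n" "y = word N (map f w)"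
      using F_word by blast
    then have "y \<in> {word N w | w. w \<in> lists (carrier N) \<and> length w = n}"
      using map_f_lists[OF w(1)] by (intro CollectI exI[of _ "map f w"]) simp
    then show "y \<in> lin_span N.T {word N w | w. w \<in> lists (carrier N) \<and> length w = n}"
      by (rule subsetD[OF lin_span_superset[OF N.cvs_T]])
  qed
qed

end

section \<open>Isomorphisms identify the Nichols ideals\<close>

locale yd_isomorphism = yd_morphism +
  assumes f_bij: "bij_betw f (carrier M) (carrier N)"
begin

abbreviation "f' \<equiv> inv_into (carrier M) f"

lemma f'_f: "x \<in> carrier M \<Longrightarrow> f' (f x) = x"
  using f_bij by (simp add: bij_betw_def)

lemma f_f': "y \<in> carrier N \<Longrightarrow> f (f' y) = y"
  using f_bij by (simp add: bij_betw_def f_inv_into_f)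

lemma f'_closed: "y \<in> carrier N \<Longrightarrow> f' y \<in> carrier M"
  using f_bij by (metis bij_betw_def inv_into_into)

lemma f'_eqI: "x \<in> carrier M \<Longrightarrow> f x = y \<Longrightarrow> f' y = x"
  using f'_f by blast

text \<open>With the inverse in the same locale, the inclusions proved for \<open>F\<close> on
  degrees and on Nichols ideals apply in the other direction too and become equalities.\<close>

lemma inverse_isomorphism: "yd_isomorphism G N M f'"
proof (rule yd_isomorphism.intro)
  have "linear_map N M f'"
  proof (rule linear_mapI)
    fix x y assume xy: "x \<in> carrier N" "y \<in> carrier N"
    show "f' (x \<oplus>\<^bsub>N\<^esub> y) = f' x \<oplus>\<^bsub>M\<^esub> f' y"
      using xy f'_closed M.cvs_M linear_mapD(2)[OF f_linear] f_f' by (intro f'_eqI) auto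
  next
    fix c x assume x: "x \<in> carrier N"
    show "f' (c \<odot>\<^bsub>N\<^esub> x) = c \<odot>\<^bsub>M\<^esub> f' x"
      using x f'_closed M.cvs_M linear_mapD(3)[OF f_linear] f_f' by (intro f'_eqI) auto
  qed (rule f'_closed)
  moreover have "f' (action N h x) = action M h (f' x)" if "h \<in> carrier G" "x \<in> carrier N" for h x
    using that f'_closed f_f' f_action linear_mapD(1)[OF M.action_linear] by (intro f'_eqI) auto
  moreover have "f' (coact N x h) = coact M (f' x) h" if "h \<in> carrier G" "x \<in> carrier N" for h x
    using that f'_closed f_f' f_coact linear_mapD(1)[OF M.coact_linear] by (intro f'_eqI) auto
  ultimately show "yd_morphism G N M f'"
    by (intro yd_morphism.intro yd_morphism_axioms.intro N.linear_yd_axioms M.linear_yd_axioms)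
  show "yd_isomorphism_axioms N M f'"
    using bij_betw_inv_into[OF f_bij] by (rule yd_isomorphism_axioms.intro)
qed

abbreviation "F' \<equiv> tensor_space_map M f'"

lemma f'_linear: "linear_map N M f'"
  using inverse_isomorphism by (simp add: yd_isomorphism_def yd_morphism_def yd_morphism_axioms_def)

lemma F'_F: "a \<in> carrier M.T \<Longrightarrow> F' (F a) = a"
  by (rule tensor_space_map_inverse[OF M.cvs_M N.cvs_M f_linear f'_linear f'_f])

lemma F_F': "a \<in> carrier N.T \<Longrightarrow> F (F' a) = a"
  by (rule tensor_space_map_inverse[OF N.cvs_M M.cvs_M f'_linear f_linear f_f'])

lemma F'_closed: "a \<in> carrier N.T \<Longrightarrow> F' a \<in> carrier M.T"
  by (rule linear_mapD(1)[OF tensor_space_map_linear[OF N.cvs_M M.cvs_M f'_linear]])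

lemma F_bij: "bij_betw F (carrier M.T) (carrier N.T)"
  by (rule bij_betwI[of _ _ _ F']) (use F'_F F_F' F'_closed in auto)

lemma F_hdeg_eq: "F ` hdeg (tensor_hopf G M) n = hdeg (tensor_hopf G N) n"
proof
  interpret inv: yd_isomorphism G N M f' by (rule inverse_isomorphism)
  have N: "hdeg (tensor_hopf G N) n \<subseteq> carrier N.T"
    unfolding N.hdeg_eq by (rule lin_span_subset[OF N.cvs_T]) (use N.word_cl in blast)
  show "hdeg (tensor_hopf G N) n \<subseteq> F ` hdeg (tensor_hopf G M) n"
  proof
    fix y assume y: "y \<in> hdeg (tensor_hopf G N) n"
    have "y = F (F' y)" using F_F' subsetD[OF N y] by simp
    moreover have "F' y \<in> hdeg (tensor_hopf G M) n" by (rule subsetD[OF inv.F_hdeg imageI[OF y]])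
    ultimately show "y \<in> F ` hdeg (tensor_hopf G M) n" by (rule image_eqI)
  qed
qed (rule F_hdeg)

lemma tensor_hopf_iso: "graded_braided_hopf_iso G (tensor_hopf G M) (tensor_hopf G N) F"
proof -
  have "linear_map (tensor_hopf G M) (tensor_hopf G N) F"
    using F_linear by (simp add: linear_map_def)
  moreover have "tensor_map (tensor_hopf G N) (tensor_hopf G N) F F = FF"
    by (simp add: tensor_map_def lift_def lin_ext_def fun_eq_iff)
  ultimately show ?thesis
    unfolding graded_braided_hopf_iso_def
    using F_bij F_act F_coa F_mul F_unit FF_Delta F_eps F_anti F_hdeg_eq by simp
qed

lemma F_nichols_ideal:
  assumes I: "I \<in> nichols_ideals G M"
  shows "F ` I \<in> nichols_ideals G N"
proof -
  have id: "ideal I (tensor_hopf G M)" and sub: "submodule I \<C> M.T"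
    and act: "\<And>g x. g \<in> carrier G \<Longrightarrow> x \<in> I \<Longrightarrow> M.act g x \<in> I"
    and coa: "\<And>g x. g \<in> carrier G \<Longrightarrow> x \<in> I \<Longrightarrow> M.coa x g \<in> I"
    and Delta: "\<And>x. x \<in> I \<Longrightarrow> M.Delta x \<in> lin_span M.TT {M.ten a b | a b. a \<in> carrier M.T \<and> b \<in> carrier M.T \<and> (a \<in> I \<or> b \<in> I)}"
    using I by (auto simp: nichols_ideals_def Let_def M.submodule_tensor_hopf)
  obtain A where A: "A \<subseteq> (\<Union>n\<in>{2..}. hdeg (tensor_hopf G M) n)" "I = Idl\<^bsub>tensor_hopf G M\<^esub> A"
    using I by (auto simp: nichols_ideals_def Let_def)
  have IT: "I \<subseteq> carrier M.T" by (rule submoduleD(1)[OF M.cvs_T sub])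
  have subN: "submodule (F ` I) \<C> N.T" by (rule submodule_image[OF M.cvs_T N.cvs_T F_linear sub])
  have idN: "ideal (F ` I) (tensor_hopf G N)"
  proof (rule N.ideal_tensor_hopfI[OF subN])
    fix x y assume "x \<in> F ` I" and y: "y \<in> carrier N.T"
    then obtain z where z: "z \<in> I" "x = F z" by blast
    \<comment> \<open>Surjectivity of \<open>F\<close> turns multiplication by an arbitrary
      \<open>y\<close> into multiplication upstairs, where \<open>I\<close> is known to be an
      ideal.\<close>
    have y': "y = F (F' y)" "F' y \<in> carrier M.T" using F_F'[OF y] F'_closed[OF y] by auto
    have zT: "z \<in> carrier M.T" using z(1) IT by blast
    have "N.mul x y = F (M.mul z (F' y))" using F_mul[OF zT y'(2)] z(2) y'(1) by simp
    then show "N.mul x y \<in> F ` I" using M.ideal_tensor_hopfD(2)[OF id z(1) y'(2)] by blast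
    have "N.mul y x = F (M.mul (F' y) z)" using F_mul[OF y'(2) zT] z(2) y'(1) by simp
    then show "N.mul y x \<in> F ` I" using M.ideal_tensor_hopfD(3)[OF id z(1) y'(2)] by blast
  qed
  interpret RM: ring "tensor_hopf G M" by (rule M.ring_tensor_hopf)
  interpret RN: ring "tensor_hopf G N" by (rule N.ring_tensor_hopf)
  have hM: "hdeg (tensor_hopf G M) n \<subseteq> carrier M.T" for n
    unfolding M.hdeg_eq by (rule lin_span_subset[OF M.cvs_T]) (use M.word_cl in blast)
  have AT: "A \<subseteq> carrier (tensor_hopf G M)" using A(1) hM by auto
  have AI: "A \<subseteq> I" unfolding A(2) by (rule RM.genideal_self[OF AT])
  have FAT: "F ` A \<subseteq> carrier (tensor_hopf G N)" using AT by auto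
  have "F ` I = Idl\<^bsub>tensor_hopf G N\<^esub> (F ` A)"
  proof
    show "Idl\<^bsub>tensor_hopf G N\<^esub> (F ` A) \<subseteq> F ` I"
      by (rule RN.genideal_minimal[OF idN image_mono[OF AI]])
    let ?K = "Idl\<^bsub>tensor_hopf G N\<^esub> (F ` A)"
    have K: "ideal ?K (tensor_hopf G N)" by (rule RN.genideal_ideal[OF FAT])
    note Kd = N.ideal_tensor_hopfD[OF K]
    have "ideal {x \<in> carrier M.T. F x \<in> ?K} (tensor_hopf G M)"
      by (rule M.ideal_tensor_hopfI[OF submodule_vimage[OF M.cvs_T N.cvs_T F_linear Kd(1)]]) (auto simp: F_mul Kd(2,3))
    moreover have "A \<subseteq> {x \<in> carrier M.T. F x \<in> ?K}" using AT RN.genideal_self[OF FAT] by auto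
    ultimately have "I \<subseteq> {x \<in> carrier M.T. F x \<in> ?K}" unfolding A(2) by (rule RM.genideal_minimal)
    then show "F ` I \<subseteq> ?K" by blast
  qed
  moreover have "F ` A \<subseteq> (\<Union>n\<in>{2..}. hdeg (tensor_hopf G N) n)" using A(1) F_hdeg by blast
  moreover have "N.Delta x \<in> lin_span N.TT {N.ten a b | a b. a \<in> carrier N.T \<and> b \<in> carrier N.T \<and> (a \<in> F ` I \<or> b \<in> F ` I)}"
    if x: "x \<in> F ` I" for x
  proof -
    let ?gM = "{M.ten a b | a b. a \<in> carrier M.T \<and> b \<in> carrier M.T \<and> (a \<in> I \<or> b \<in> I)}"
    let ?gN = "{N.ten a b | a b. a \<in> carrier N.T \<and> b \<in> carrier N.T \<and> (a \<in> F ` I \<or> b \<in> F ` I)}"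
    have gM: "?gM \<subseteq> carrier M.TT" and gN: "?gN \<subseteq> carrier N.TT" using M.ten_closed N.ten_closed by blast+
    from x obtain z where z: "z \<in> I" "x = F z" by blast
    have "FF (M.Delta z) \<in> lin_span N.TT ?gN"
    proof (rule linear_map_span[OF M.cvs_TT N.cvs_TT FF_linear lin_span_submodule[OF N.cvs_TT gN] gM _ Delta[OF z(1)]])
      fix p assume "p \<in> ?gM"
      then obtain a b where ab: "a \<in> carrier M.T" "b \<in> carrier M.T" "a \<in> I \<or> b \<in> I" "p = M.ten a b" by blast
      have "FF p \<in> ?gN" using FF_tens[OF ab(1,2)] ab F_closed by blast
      then show "FF p \<in> lin_span N.TT ?gN" by (rule subsetD[OF lin_span_superset[OF N.cvs_TT]])
    qed
    then show ?thesis using FF_Delta[of z] z IT by auto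
  qed
  moreover have "N.act g x \<in> F ` I" "N.coa x g \<in> F ` I" if gx: "g \<in> carrier G" "x \<in> F ` I" for g x
  proof -
    from gx(2) obtain z where z: "z \<in> I" "x = F z" by blast
    have zT: "z \<in> carrier M.T" using z(1) IT by blast
    show "N.act g x \<in> F ` I" using F_act[OF gx(1) zT, symmetric] act[OF gx(1) z(1)] z(2) by simp
    show "N.coa x g \<in> F ` I" using F_coa[OF gx(1) zT, symmetric] coa[OF gx(1) z(1)] z(2) by simp
  qed
  ultimately show ?thesis
    unfolding nichols_ideals_def Let_def mem_Collect_eq tensor_tensor_algebra tensor_hopf_simps N.submodule_tensor_hopf
    using idN subN by (intro conjI ballI exI[of _ "F ` A"])
qed

lemma nichols_ideals_image: "(\<lambda>I. F ` I) ` nichols_ideals G M = nichols_ideals G N"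
proof
  show "(\<lambda>I. F ` I) ` nichols_ideals G M \<subseteq> nichols_ideals G N" using F_nichols_ideal by blast
  interpret inv: yd_isomorphism G N M f' by (rule inverse_isomorphism)
  show "nichols_ideals G N \<subseteq> (\<lambda>I. F ` I) ` nichols_ideals G M"
  proof
    fix I assume I: "I \<in> nichols_ideals G N"
    have "submodule I \<C> N.T" using I by (auto simp: nichols_ideals_def Let_def N.submodule_tensor_hopf)
    then have IT: "I \<subseteq> carrier N.T" by (rule submoduleD(1)[OF N.cvs_T])
    have "F ` F' ` I = (\<lambda>x. x) ` I"
      unfolding image_image by (rule image_cong) (use IT F_F' in auto)
    then have "I = F ` F' ` I" by simp
    then show "I \<in> (\<lambda>I. F ` I) ` nichols_ideals G M" using inv.F_nichols_ideal[OF I] by blast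
  qed
qed

end

text \<open>The ideals correspond under \<open>F\<close>, hence so do their unions and spans, and
  the quotient construction applies. The condition \<open>yd\<close> is placed on the source, where
  the congruence is established; the kernel of the target is its image.\<close>

lemma nichols_algebra_isomorphic:
  assumes "yd G M" "yd_isomorphism G M N f"
  shows "graded_braided_hopf_isomorphic G (nichols_algebra G M) (nichols_algebra G N)"
proof -
  interpret M: yd G M by (rule assms(1))
  interpret yd_isomorphism G M N f by (rule assms(2))
  have "F ` \<Union>(nichols_ideals G M) = \<Union>(nichols_ideals G N)"
    unfolding nichols_ideals_image[symmetric] by blast
  then have "F ` M.nichols_kernel = lin_span N.T (\<Union>(nichols_ideals G N))"
    using linear_map_image_span[OF M.cvs_T N.cvs_T F_linear M.nichols_ideals_closed] by simp
  moreover have "cvs (tensor_hopf G N)" by (rule cvs_cong[OF N.cvs_T]) simp_all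
  ultimately have "graded_braided_hopf_iso G (nichols_algebra G M) (nichols_algebra G N) (\<lambda>A. F ` A)"
    using hopf_congruence.quot_hopf_iso[OF M.hopf_congruence_nichols_kernel _ tensor_hopf_iso]
    by (simp add: nichols_algebra_def Let_def M.lin_span_tensor_hopf N.lin_span_tensor_hopf)
  then show ?thesis unfolding graded_braided_hopf_isomorphic_def by blast
qed

section \<open>The Yetter-Drinfeld module of a class\<close>

lemma linear_combination_span:
  assumes "cvs V" "finite J" "b \<in> J \<rightarrow> carrier V" "v \<in> lin_span V (b ` J)"
  shows "\<exists>k. v = (\<Oplus>\<^bsub>V\<^esub>j\<in>J. k j \<odot>\<^bsub>V\<^esub> b j)"
proof -
  let ?W = "{v. \<exists>k. v = (\<Oplus>\<^bsub>V\<^esub>j\<in>J. k j \<odot>\<^bsub>V\<^esub> b j)}"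
  have c: "(\<lambda>j. k j \<odot>\<^bsub>V\<^esub> b j) \<in> J \<rightarrow> carrier V" for k using assms by (auto simp: Pi_iff)
  have "submodule ?W \<C> V"
  proof (rule cvs_submoduleI[OF assms(1)])
    show "?W \<subseteq> carrier V" using cvs_sum_closed[OF assms(1) c] by blast
    have "\<zero>\<^bsub>V\<^esub> = (\<Oplus>\<^bsub>V\<^esub>j\<in>J. 0 \<odot>\<^bsub>V\<^esub> b j)"
      by (rule cvs_sum_zero[OF assms(1), symmetric]) (use assms in \<open>auto simp: Pi_iff\<close>)
    then show "\<zero>\<^bsub>V\<^esub> \<in> ?W" by (intro CollectI exI[of _ "\<lambda>_. 0"])
    fix x y assume "x \<in> ?W" "y \<in> ?W"
    then obtain k l where kl: "x = (\<Oplus>\<^bsub>V\<^esub>j\<in>J. k j \<odot>\<^bsub>V\<^esub> b j)" "y = (\<Oplus>\<^bsub>V\<^esub>j\<in>J. l j \<odot>\<^bsub>V\<^esub> b j)" by blast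
    have "x \<oplus>\<^bsub>V\<^esub> y = (\<Oplus>\<^bsub>V\<^esub>j\<in>J. k j \<odot>\<^bsub>V\<^esub> b j \<oplus>\<^bsub>V\<^esub> l j \<odot>\<^bsub>V\<^esub> b j)"
      unfolding kl by (rule cvs_sum_add[OF assms(1) c c, symmetric])
    also have "\<dots> = (\<Oplus>\<^bsub>V\<^esub>j\<in>J. (k j + l j) \<odot>\<^bsub>V\<^esub> b j)"
      by (rule cvs_sum_cong[OF assms(1) refl]) (use assms in \<open>auto simp: Pi_iff cvs_add_smult\<close>)
    finally show "x \<oplus>\<^bsub>V\<^esub> y \<in> ?W" by (intro CollectI exI[of _ "\<lambda>j. k j + l j"])
  next
    fix a x assume "x \<in> ?W"
    then obtain k where k: "x = (\<Oplus>\<^bsub>V\<^esub>j\<in>J. k j \<odot>\<^bsub>V\<^esub> b j)" by blast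
    have "a \<odot>\<^bsub>V\<^esub> x = (\<Oplus>\<^bsub>V\<^esub>j\<in>J. a \<odot>\<^bsub>V\<^esub> (k j \<odot>\<^bsub>V\<^esub> b j))"
      unfolding k by (rule cvs_sum_smult[OF assms(1,2) c, symmetric])
    also have "\<dots> = (\<Oplus>\<^bsub>V\<^esub>j\<in>J. (a * k j) \<odot>\<^bsub>V\<^esub> b j)"
      by (rule cvs_sum_cong[OF assms(1) refl]) (use assms in \<open>auto simp: Pi_iff cvs_smult_smult\<close>)
    finally show "a \<odot>\<^bsub>V\<^esub> x \<in> ?W" by (intro CollectI exI[of _ "\<lambda>j. a * k j"])
  qed
  moreover have "b ` J \<subseteq> ?W"
  proof (rule image_subsetI)
    fix j assume j: "j \<in> J"
    have bj: "b j \<in> carrier V" using assms(3) j by auto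
    have "(\<Oplus>\<^bsub>V\<^esub>i\<in>J. (if i = j then 1 else 0) \<odot>\<^bsub>V\<^esub> b i) = (if j = j then 1 else 0) \<odot>\<^bsub>V\<^esub> b j"
      by (rule cvs_sum_delta[OF assms(1,2) j]) (use assms(1,3) bj in \<open>auto simp: Pi_iff\<close>)
    then have "b j = (\<Oplus>\<^bsub>V\<^esub>i\<in>J. (if i = j then 1 else 0) \<odot>\<^bsub>V\<^esub> b i)" using assms(1) bj by simp
    then show "b j \<in> ?W" by (intro CollectI exI[of _ "\<lambda>i. if i = j then 1 else 0"])
  qed
  ultimately have "lin_span V (b ` J) \<subseteq> ?W" by (rule lin_span_minimal[OF assms(1)])
  then show ?thesis using assms(4) by blast
qed

text \<open>A relation with a nonzero coefficient at \<open>i\<close> is solved for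
  \<open>b i\<close> after dividing by that coefficient.\<close>

lemma linear_combination_zero:
  assumes V: "cvs V" "finite J" "b \<in> J \<rightarrow> carrier V" and zero: "(\<Oplus>\<^bsub>V\<^esub>j\<in>J. d j \<odot>\<^bsub>V\<^esub> b j) = \<zero>\<^bsub>V\<^esub>"
    and i: "i \<in> J" "d i \<noteq> 0"
  shows "b i \<in> lin_span V (b ` (J - {i}))"
proof -
  have bi: "b i \<in> carrier V" and bJ: "b ` (J - {i}) \<subseteq> carrier V" using V(3) i by auto
  note S = submoduleD[OF V(1) lin_span_submodule[OF V(1) bJ]]
  let ?r = "\<Oplus>\<^bsub>V\<^esub>j\<in>J - {i}. d j \<odot>\<^bsub>V\<^esub> b j"
  have r: "?r \<in> lin_span V (b ` (J - {i}))"
  proof (rule lin_span_sum[OF V(1) lin_span_submodule[OF V(1) bJ]])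
    show "(\<lambda>j. d j \<odot>\<^bsub>V\<^esub> b j) \<in> J - {i} \<rightarrow> lin_span V (b ` (J - {i}))"
      by (rule funcsetI, rule S(5), rule subsetD[OF lin_span_superset[OF V(1)]]) (rule imageI)
  qed (use V(2) in simp)
  have "insert i (J - {i}) = J" using i by blast
  then have "d i \<odot>\<^bsub>V\<^esub> b i \<oplus>\<^bsub>V\<^esub> ?r = \<zero>\<^bsub>V\<^esub>"
    using cvs_sum_insert[OF V(1), of "J - {i}" i "\<lambda>j. d j \<odot>\<^bsub>V\<^esub> b j"] V bi zero by (auto simp: Pi_iff)
  then have "(1 / d i) \<odot>\<^bsub>V\<^esub> (d i \<odot>\<^bsub>V\<^esub> b i \<oplus>\<^bsub>V\<^esub> ?r) = \<zero>\<^bsub>V\<^esub>" using V(1) by simp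
  then have "b i \<oplus>\<^bsub>V\<^esub> (1 / d i) \<odot>\<^bsub>V\<^esub> ?r = \<zero>\<^bsub>V\<^esub>"
    using i(2) bi S(2)[OF r] V(1) by (simp add: cvs_smult_add cvs_smult_smult)
  then have "(b i \<oplus>\<^bsub>V\<^esub> (1 / d i) \<odot>\<^bsub>V\<^esub> ?r) \<oplus>\<^bsub>V\<^esub> \<ominus>\<^bsub>V\<^esub> ((1 / d i) \<odot>\<^bsub>V\<^esub> ?r) = \<ominus>\<^bsub>V\<^esub> ((1 / d i) \<odot>\<^bsub>V\<^esub> ?r)"
    using S(2)[OF r] V(1) by simp
  then have "b i = \<ominus>\<^bsub>V\<^esub> ((1 / d i) \<odot>\<^bsub>V\<^esub> ?r)"
    using bi S(2)[OF r] V(1) by (simp add: cvs_add_ac(2))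
  then have "b i = (-1) \<odot>\<^bsub>V\<^esub> ((1 / d i) \<odot>\<^bsub>V\<^esub> ?r)" using S(2)[OF r] V(1) by (simp add: cvs_minus)
  moreover have "(-1) \<odot>\<^bsub>V\<^esub> ((1 / d i) \<odot>\<^bsub>V\<^esub> ?r) \<in> lin_span V (b ` (J - {i}))"
    by (intro S(5) r)
  ultimately show ?thesis by simp
qed

text \<open>A spanning set of least size is independent, since a vector in the span of the others
  could be dropped. Indexing by the numbers below \<open>n\<close> provides the natural number
  indices that the ramification system in the theorem uses.\<close>

lemma finite_basis_exists:
  assumes V: "cvs V" and A: "finite A" "A \<subseteq> carrier V" "lin_span V A = carrier V"
  shows "\<exists>n (b :: nat \<Rightarrow> _). is_finite_basis V {..<n} b"
proof -
  let ?P = "\<lambda>n. \<exists>A. finite A \<and> A \<subseteq> carrier V \<and> lin_span V A = carrier V \<and> card A = n"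
  have ex: "?P (card A)" using A by blast
  define n where "n = (LEAST n. ?P n)"
  have "?P n" unfolding n_def by (rule LeastI[of ?P, OF ex])
  then obtain B where B: "finite B" "B \<subseteq> carrier V" "lin_span V B = carrier V" "card B = n" by blast
  have minimal: "n \<le> card D" if "finite D" "D \<subseteq> carrier V" "lin_span V D = carrier V" for D
    unfolding n_def by (rule Least_le) (use that in blast)
  obtain b where b: "bij_betw b {..<n} B"
    using ex_bij_betw_nat_finite[OF B(1)] B(4) by (auto simp: atLeast0LessThan)
  have bim: "b ` {..<n} = B" and binj: "inj_on b {..<n}" using b by (auto simp: bij_betw_def)
  have bV: "b \<in> {..<n} \<rightarrow> carrier V" using bim B(2) by blast
  have indep: "d i = 0"
    if z: "(\<Oplus>\<^bsub>V\<^esub>j\<in>{..<n}. d j \<odot>\<^bsub>V\<^esub> b j) = \<zero>\<^bsub>V\<^esub>" and i: "i < n" for d i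
  proof (rule ccontr)
    assume "d i \<noteq> 0"
    then have bi: "b i \<in> lin_span V (b ` ({..<n} - {i}))"
      using linear_combination_zero[OF V finite_lessThan bV z] i by simp
    let ?D = "b ` ({..<n} - {i})"
    have D: "?D \<subseteq> carrier V" using bV by auto
    have BD: "B \<subseteq> lin_span V ?D"
    proof
      fix x assume "x \<in> B"
      then obtain j where j: "j < n" "x = b j" using bim by auto
      show "x \<in> lin_span V ?D"
      proof (cases "j = i")
        case False
        then have "x \<in> ?D" using j by blast
        then show ?thesis by (rule subsetD[OF lin_span_superset[OF V]])
      qed (use bi j in simp)
    qed
    have "lin_span V ?D = carrier V"
      using lin_span_mono[OF V D BD] lin_span_subset[OF V D] unfolding B(3) by (intro equalityI)
    then have "n \<le> card ?D" by (intro minimal D) simp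
    also have "\<dots> \<le> card ({..<n} - {i})" by (rule card_image_le) simp
    also have "\<dots> < n" using i by simp
    finally show False by simp
  qed
  have "is_finite_basis V {..<n} b"
    unfolding is_finite_basis_def
  proof (intro conjI ballI)
    fix v assume v: "v \<in> carrier V"
    have c: "(\<lambda>j. k j \<odot>\<^bsub>V\<^esub> b j) \<in> {..<n} \<rightarrow> carrier V" for k using V bV by (auto simp: Pi_iff)
    obtain k where k: "v = (\<Oplus>\<^bsub>V\<^esub>j\<in>{..<n}. k j \<odot>\<^bsub>V\<^esub> b j)"
      using linear_combination_span[OF V finite_lessThan bV, of v] v B(3) bim by auto
    show "\<exists>!k. k \<in> {..<n} \<rightarrow>\<^sub>E UNIV \<and> v = (\<Oplus>\<^bsub>V\<^esub>j\<in>{..<n}. k j \<odot>\<^bsub>V\<^esub> b j)"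
    \<comment> \<open>Uniqueness in \<open>is_finite_basis\<close> is among extensional families,
      hence the restriction to the index set.\<close>
    proof (rule ex1I[of _ "restrict k {..<n}"])
      have "v = (\<Oplus>\<^bsub>V\<^esub>j\<in>{..<n}. restrict k {..<n} j \<odot>\<^bsub>V\<^esub> b j)"
        unfolding k by (rule cvs_sum_cong[OF V refl]) (use V bV in \<open>auto simp: Pi_iff\<close>)
      then show "restrict k {..<n} \<in> {..<n} \<rightarrow>\<^sub>E UNIV \<and> v = (\<Oplus>\<^bsub>V\<^esub>j\<in>{..<n}. restrict k {..<n} j \<odot>\<^bsub>V\<^esub> b j)" by simp
      fix l assume l: "l \<in> {..<n} \<rightarrow>\<^sub>E UNIV \<and> v = (\<Oplus>\<^bsub>V\<^esub>j\<in>{..<n}. l j \<odot>\<^bsub>V\<^esub> b j)"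
      have "(\<Oplus>\<^bsub>V\<^esub>j\<in>{..<n}. (l j + (-1) * k j) \<odot>\<^bsub>V\<^esub> b j) =
          (\<Oplus>\<^bsub>V\<^esub>j\<in>{..<n}. l j \<odot>\<^bsub>V\<^esub> b j \<oplus>\<^bsub>V\<^esub> (-1) \<odot>\<^bsub>V\<^esub> (k j \<odot>\<^bsub>V\<^esub> b j))"
      proof (rule cvs_sum_cong[OF V refl])
        fix j assume "j \<in> {..<n}"
        then have bj: "b j \<in> carrier V" using bV by blast
        show "(l j + (-1) * k j) \<odot>\<^bsub>V\<^esub> b j = l j \<odot>\<^bsub>V\<^esub> b j \<oplus>\<^bsub>V\<^esub> (-1) \<odot>\<^bsub>V\<^esub> (k j \<odot>\<^bsub>V\<^esub> b j)"
          unfolding cvs_add_smult[OF V bj] cvs_smult_smult[OF V bj] ..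
      qed (use V bV in \<open>auto simp: Pi_iff\<close>)
      also have "\<dots> = (\<Oplus>\<^bsub>V\<^esub>j\<in>{..<n}. l j \<odot>\<^bsub>V\<^esub> b j) \<oplus>\<^bsub>V\<^esub> (\<Oplus>\<^bsub>V\<^esub>j\<in>{..<n}. (-1) \<odot>\<^bsub>V\<^esub> (k j \<odot>\<^bsub>V\<^esub> b j))"
        by (rule cvs_sum_add[OF V c]) (use V bV in \<open>auto simp: Pi_iff\<close>)
      also have "\<dots> = v \<oplus>\<^bsub>V\<^esub> (-1) \<odot>\<^bsub>V\<^esub> v"
        using cvs_sum_smult[OF V finite_lessThan c, of "-1" k] l k by simp
      also have "\<dots> = \<zero>\<^bsub>V\<^esub>" using cvs_add_minus(1)[OF V v] cvs_minus[OF V v] by simp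
      finally have "l j = k j" if "j < n" for j using indep[OF _ that, of "\<lambda>j. l j + (-1) * k j"] by simp
      then show "l = restrict k {..<n}" using l by (intro extensionalityI[of _ "{..<n}"]) (auto simp: PiE_def)
    qed
  qed (use bV in auto)
  then show ?thesis by blast
qed

lemma finite_basis_coords:
  assumes "is_finite_basis V J b" "v \<in> carrier V"
  shows "v = (\<Oplus>\<^bsub>V\<^esub>j\<in>J. coords V J b v j \<odot>\<^bsub>V\<^esub> b j)"
proof -
  have "\<exists>!k. k \<in> J \<rightarrow>\<^sub>E UNIV \<and> v = (\<Oplus>\<^bsub>V\<^esub>j\<in>J. k j \<odot>\<^bsub>V\<^esub> b j)"
    using assms by (simp add: is_finite_basis_def)
  from theI'[OF this] show ?thesis unfolding coords_def by blast
qed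

lemma finite_basis_unique:
  assumes "is_finite_basis V J b" "cvs V" "(\<Oplus>\<^bsub>V\<^esub>j\<in>J. k j \<odot>\<^bsub>V\<^esub> b j) = (\<Oplus>\<^bsub>V\<^esub>j\<in>J. l j \<odot>\<^bsub>V\<^esub> b j)" "j \<in> J"
  shows "k j = l j"
proof -
  have b: "b \<in> J \<rightarrow> carrier V" using assms(1) by (simp add: is_finite_basis_def)
  have r: "(\<Oplus>\<^bsub>V\<^esub>j\<in>J. restrict k J j \<odot>\<^bsub>V\<^esub> b j) = (\<Oplus>\<^bsub>V\<^esub>j\<in>J. k j \<odot>\<^bsub>V\<^esub> b j)" for k
    by (rule cvs_sum_cong[OF assms(2) refl]) (use b assms(2) in \<open>auto simp: Pi_iff\<close>)
  let ?v = "\<Oplus>\<^bsub>V\<^esub>j\<in>J. k j \<odot>\<^bsub>V\<^esub> b j"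
  have v: "?v \<in> carrier V" by (rule cvs_sum_closed[OF assms(2)]) (use b assms(2) in \<open>auto simp: Pi_iff\<close>)
  have "\<exists>!k. k \<in> J \<rightarrow>\<^sub>E UNIV \<and> ?v = (\<Oplus>\<^bsub>V\<^esub>j\<in>J. k j \<odot>\<^bsub>V\<^esub> b j)"
    using assms(1) v unfolding is_finite_basis_def by blast
  moreover have "restrict k J \<in> J \<rightarrow>\<^sub>E UNIV \<and> ?v = (\<Oplus>\<^bsub>V\<^esub>j\<in>J. restrict k J j \<odot>\<^bsub>V\<^esub> b j)"
    by (rule conjI[OF _ r[symmetric]]) simp
  moreover have "restrict l J \<in> J \<rightarrow>\<^sub>E UNIV \<and> ?v = (\<Oplus>\<^bsub>V\<^esub>j\<in>J. restrict l J j \<odot>\<^bsub>V\<^esub> b j)"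
    by (rule conjI[OF _ trans[OF assms(3) r[symmetric]]]) simp
  ultimately have "restrict k J = restrict l J" by blast
  then show ?thesis using assms(4) by (metis restrict_apply')
qed

section \<open>Centralizer, conjugacy class and the class module\<close>

locale class_rep_data = G: group G for G :: "('g, 'm) monoid_scheme" +
  fixes s :: 'g and V :: "(complex, 'v) module" and \<rho> :: "'g \<Rightarrow> 'v \<Rightarrow> 'v"
    and m :: nat and t g :: "nat \<Rightarrow> 'g"
  assumes finite_G: "finite (carrier G)" and s_closed [simp]: "s \<in> carrier G"
    and irreducible: "irreducible_left_rep G (centralizer G s) V \<rho>"
    and numeration: "class_numeration G s m t g"
begin

abbreviation "Z \<equiv> centralizer G s"
abbreviation "C \<equiv> conj_class G s"
abbreviation "cjg a x \<equiv> a \<otimes>\<^bsub>G\<^esub> x \<otimes>\<^bsub>G\<^esub> inv\<^bsub>G\<^esub> a"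
abbreviation "M \<equiv> class_yd_module G V \<rho> s m t g"
abbreviation "idx \<equiv> inv_into {1..m} t"

lemma inv_cancel [simp]:
  "a \<in> carrier G \<Longrightarrow> b \<in> carrier G \<Longrightarrow> inv\<^bsub>G\<^esub> a \<otimes>\<^bsub>G\<^esub> (a \<otimes>\<^bsub>G\<^esub> b) = b"
  "a \<in> carrier G \<Longrightarrow> b \<in> carrier G \<Longrightarrow> a \<otimes>\<^bsub>G\<^esub> (inv\<^bsub>G\<^esub> a \<otimes>\<^bsub>G\<^esub> b) = b"
  by (simp_all add: G.m_assoc[symmetric])

lemma conj_conj:
  "a \<in> carrier G \<Longrightarrow> b \<in> carrier G \<Longrightarrow> x \<in> carrier G \<Longrightarrow> cjg a (cjg b x) = cjg (a \<otimes>\<^bsub>G\<^esub> b) x"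
  by (simp add: G.inv_mult_group G.m_assoc)

lemma conj_inv_eq:
  "a \<in> carrier G \<Longrightarrow> x \<in> carrier G \<Longrightarrow> y \<in> carrier G \<Longrightarrow> cjg (inv\<^bsub>G\<^esub> a) y = x \<longleftrightarrow> y = cjg a x"
  by (auto simp: G.m_assoc)

lemma conj_cancel:
  "a \<in> carrier G \<Longrightarrow> x \<in> carrier G \<Longrightarrow> y \<in> carrier G \<Longrightarrow> cjg a x = cjg a y \<longleftrightarrow> x = y"
  by (metis G.inv_closed G.m_closed G.l_cancel G.r_cancel)

text \<open>As the stabiliser of \<open>s\<close> under conjugation, the centralizer can be tested
  by composing conjugations; all later membership proofs have this form.\<close>

lemma Z_iff: "z \<in> Z \<longleftrightarrow> z \<in> carrier G \<and> cjg z s = s"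
proof -
  have "z \<otimes>\<^bsub>G\<^esub> s = s \<otimes>\<^bsub>G\<^esub> z \<longleftrightarrow> cjg z s = s" if "z \<in> carrier G"
    using that s_closed by (metis G.inv_closed G.inv_solve_right' G.m_closed)
  then show ?thesis by (auto simp: centralizer_def)
qed

lemma Z_closed: "z \<in> Z \<Longrightarrow> z \<in> carrier G"
  by (simp add: centralizer_def)

lemma Z_one: "\<one>\<^bsub>G\<^esub> \<in> Z"
  by (simp add: centralizer_def)

lemma Z_mult: "a \<in> Z \<Longrightarrow> b \<in> Z \<Longrightarrow> a \<otimes>\<^bsub>G\<^esub> b \<in> Z"
  unfolding Z_iff using conj_conj[of a b s] by simp

lemma Z_inv: "a \<in> Z \<Longrightarrow> inv\<^bsub>G\<^esub> a \<in> Z"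
  unfolding Z_iff using conj_inv_eq[of a s s] by simp

lemma Z_subgroup: "subgroup Z G"
  by (rule G.subgroupI) (use Z_closed Z_one Z_mult Z_inv in auto)

lemma cvs_V: "cvs V"
  using irreducible by (simp add: irreducible_left_rep_def)

lemma rho_linear: "z \<in> Z \<Longrightarrow> linear_map V V (\<rho> z)"
  using irreducible by (simp add: irreducible_left_rep_def)

lemmas rho_closed [simp] = linear_mapD(1)[OF rho_linear]

lemma rho_one [simp]: "v \<in> carrier V \<Longrightarrow> \<rho> \<one>\<^bsub>G\<^esub> v = v"
  using irreducible by (simp add: irreducible_left_rep_def)

lemma rho_mult: "a \<in> Z \<Longrightarrow> b \<in> Z \<Longrightarrow> v \<in> carrier V \<Longrightarrow> \<rho> a (\<rho> b v) = \<rho> (a \<otimes>\<^bsub>G\<^esub> b) v"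
  using irreducible by (simp add: irreducible_left_rep_def)

lemma rho_zero [simp]: "z \<in> Z \<Longrightarrow> \<rho> z \<zero>\<^bsub>V\<^esub> = \<zero>\<^bsub>V\<^esub>"
  by (rule linear_map_zero[OF cvs_V cvs_V rho_linear])

lemma rho_inv [simp]:
  "z \<in> Z \<Longrightarrow> v \<in> carrier V \<Longrightarrow> \<rho> z (\<rho> (inv\<^bsub>G\<^esub> z) v) = v"
  "z \<in> Z \<Longrightarrow> v \<in> carrier V \<Longrightarrow> \<rho> (inv\<^bsub>G\<^esub> z) (\<rho> z v) = v"
  using Z_closed by (simp_all add: rho_mult Z_inv)

lemma V_nonzero: "carrier V \<noteq> {\<zero>\<^bsub>V\<^esub>}"
  using irreducible by (simp add: irreducible_left_rep_def)

lemma invariant_subspace: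
  "submodule W \<C> V \<Longrightarrow> (\<And>h w. h \<in> Z \<Longrightarrow> w \<in> W \<Longrightarrow> \<rho> h w \<in> W) \<Longrightarrow> W = {\<zero>\<^bsub>V\<^esub>} \<or> W = carrier V"
  using irreducible by (simp add: irreducible_left_rep_def)

text \<open>The finitely many translates of a nonzero vector span an invariant subspace, which
  irreducibility forces to be \<open>V\<close>. This is where finiteness of the group yields finite
  dimension.\<close>

lemma basis_exists: "\<exists>n (b :: nat \<Rightarrow> 'v). is_finite_basis V {..<n} b"
proof -
  obtain v where v: "v \<in> carrier V" "v \<noteq> \<zero>\<^bsub>V\<^esub>" using V_nonzero cvs_zero_closed[OF cvs_V] by blast
  let ?A = "(\<lambda>h. \<rho> h v) ` Z"
  have A: "?A \<subseteq> carrier V" using v(1) by auto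
  have fin: "finite ?A" by (rule finite_imageI, rule finite_subset[OF _ finite_G]) (use Z_closed in blast)
  have "\<rho> h w \<in> lin_span V ?A" if h: "h \<in> Z" and w: "w \<in> lin_span V ?A" for h w
  proof (rule linear_map_span[OF cvs_V cvs_V rho_linear[OF h] lin_span_submodule[OF cvs_V A] A _ w])
    fix x assume "x \<in> ?A"
    then obtain k where k: "k \<in> Z" "x = \<rho> k v" by blast
    then have "\<rho> h x \<in> ?A" using rho_mult[OF h k(1) v(1)] Z_mult[OF h k(1)] by auto
    then show "\<rho> h x \<in> lin_span V ?A" by (rule subsetD[OF lin_span_superset[OF cvs_V]])
  qed
  then have "lin_span V ?A = {\<zero>\<^bsub>V\<^esub>} \<or> lin_span V ?A = carrier V"
    by (intro invariant_subspace lin_span_submodule[OF cvs_V A])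
  moreover have "v \<in> lin_span V ?A"
    by (rule subsetD[OF lin_span_superset[OF cvs_V]], rule image_eqI[OF _ Z_one]) (use v(1) in simp)
  ultimately have "lin_span V ?A = carrier V" using v(2) by blast
  then show ?thesis by (rule finite_basis_exists[OF cvs_V fin A])
qed

lemma g_closed [simp]: "i \<in> {1..m} \<Longrightarrow> g i \<in> carrier G"
  and t_eq: "i \<in> {1..m} \<Longrightarrow> t i = cjg (g i) s"
  and t_bij: "bij_betw t {1..m} C"
  using numeration by (auto simp: class_numeration_def)

lemma C_closed: "x \<in> C \<Longrightarrow> x \<in> carrier G"
  by (auto simp: conj_class_def)

lemma t_C: "i \<in> {1..m} \<Longrightarrow> t i \<in> C"
  using t_bij by (auto simp: bij_betw_def)

lemma t_closed [simp]: "i \<in> {1..m} \<Longrightarrow> t i \<in> carrier G"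
  using C_closed t_C by blast

lemma C_conj: "h \<in> carrier G \<Longrightarrow> x \<in> C \<Longrightarrow> cjg h x \<in> C"
  unfolding conj_class_def using conj_conj by force

lemma idx_range: "x \<in> C \<Longrightarrow> idx x \<in> {1..m}"
  using t_bij by (metis bij_betw_def inv_into_into)

lemma t_idx [simp]: "x \<in> C \<Longrightarrow> t (idx x) = x"
  using t_bij by (metis bij_betw_def f_inv_into_f)

lemma idx_t [simp]: "i \<in> {1..m} \<Longrightarrow> idx (t i) = i"
  using t_bij by (metis bij_betw_def inv_into_f_f)

lemma t_inj: "i \<in> {1..m} \<Longrightarrow> j \<in> {1..m} \<Longrightarrow> t i = t j \<longleftrightarrow> i = j"
  by (metis idx_t)

lemma conj_index:
  assumes "h \<in> carrier G" "j \<in> {1..m}"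
  obtains i where "i \<in> {1..m}" "t j = cjg h (t i)"
proof -
  have c: "cjg (inv\<^bsub>G\<^esub> h) (t j) \<in> C" by (rule C_conj) (use assms t_C in auto)
  have "t j = cjg h (cjg (inv\<^bsub>G\<^esub> h) (t j))" using assms by (simp add: G.m_assoc)
  then show ?thesis using that[of "idx (cjg (inv\<^bsub>G\<^esub> h) (t j))"] idx_range[OF c] t_idx[OF c] by simp
qed

text \<open>Both \<open>h g_i\<close> and \<open>g_j\<close> conjugate \<open>s\<close> to
  \<open>t_j\<close>, so they differ by a centralizing element. It is the \<open>\<gamma>\<close> of
  the factorisation \<open>h g_i = g_j \<gamma>\<close>.\<close>

lemma transition_Z:
  assumes "h \<in> carrier G" "i \<in> {1..m}" "j \<in> {1..m}" "t j = cjg h (t i)"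
  shows "inv\<^bsub>G\<^esub> (g j) \<otimes>\<^bsub>G\<^esub> h \<otimes>\<^bsub>G\<^esub> g i \<in> Z"
proof -
  have "cjg (inv\<^bsub>G\<^esub> (g j) \<otimes>\<^bsub>G\<^esub> h \<otimes>\<^bsub>G\<^esub> g i) s = cjg (inv\<^bsub>G\<^esub> (g j)) (cjg h (cjg (g i) s))"
    using assms(1) g_closed[OF assms(2)] g_closed[OF assms(3)] by (simp add: conj_conj G.m_assoc G.inv_mult_group)
  also have "\<dots> = cjg (inv\<^bsub>G\<^esub> (g j)) (t j)" using assms(4) t_eq[OF assms(2)] by simp
  also have "\<dots> = s" using conj_inv_eq[of "g j" s "t j"] t_eq[OF assms(3)] assms(3) by simp
  finally show ?thesis using assms unfolding Z_iff by simp
qed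

lemma class_sum_space_simps [simp]:
  "carrier (class_sum_space V m) = {1..m} \<rightarrow>\<^sub>E carrier V"
  "\<zero>\<^bsub>class_sum_space V m\<^esub> = (\<lambda>i\<in>{1..m}. \<zero>\<^bsub>V\<^esub>)"
  "x \<oplus>\<^bsub>class_sum_space V m\<^esub> y = (\<lambda>i\<in>{1..m}. x i \<oplus>\<^bsub>V\<^esub> y i)"
  "c \<odot>\<^bsub>class_sum_space V m\<^esub> x = (\<lambda>i\<in>{1..m}. c \<odot>\<^bsub>V\<^esub> x i)"
  by (simp_all add: class_sum_space_def)

lemma class_yd_module_simps [simp]:
  "carrier M = {1..m} \<rightarrow>\<^sub>E carrier V"
  "\<zero>\<^bsub>M\<^esub> = (\<lambda>i\<in>{1..m}. \<zero>\<^bsub>V\<^esub>)"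
  "x \<oplus>\<^bsub>M\<^esub> y = (\<lambda>i\<in>{1..m}. x i \<oplus>\<^bsub>V\<^esub> y i)"
  "c \<odot>\<^bsub>M\<^esub> x = (\<lambda>i\<in>{1..m}. c \<odot>\<^bsub>V\<^esub> x i)"
  "coact M x h = (\<lambda>i\<in>{1..m}. if t i = h then x i else \<zero>\<^bsub>V\<^esub>)"
  by (simp_all add: class_yd_module_def class_sum_space_def Let_def)

lemma M_eqI:
  "x \<in> carrier M \<Longrightarrow> y \<in> carrier M \<Longrightarrow> (\<And>i. i \<in> {1..m} \<Longrightarrow> x i = y i) \<Longrightarrow> x = y"
  unfolding class_yd_module_simps by (rule PiE_ext)

lemma M_apply [simp]: "x \<in> carrier M \<Longrightarrow> i \<in> {1..m} \<Longrightarrow> x i \<in> carrier V"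
  unfolding class_yd_module_simps by (rule PiE_mem)

lemma cvs_class_sum_space: "cvs (class_sum_space V m)"
  by (rule cvsI)
    (use cvs_V in \<open>auto simp: PiE_iff fun_eq_iff restrict_def extensional_def cvs_add_ac[OF cvs_V]
      cvs_add_smult[OF cvs_V] cvs_smult_add[OF cvs_V] cvs_smult_smult[OF cvs_V]\<close>)

lemma cvs_class: "cvs M"
  by (rule cvs_cong[OF cvs_class_sum_space]) (simp_all add: fun_eq_iff)

lemma class_elt_closed: "v \<in> carrier V \<Longrightarrow> class_elt V m i v \<in> carrier M"
  using cvs_V by (auto simp: class_elt_def)

lemma class_eval_linear: "i \<in> {1..m} \<Longrightarrow> linear_map (class_sum_space V m) V (\<lambda>x. x i)"
  by (rule linear_mapI) auto

text \<open>The factorisation determines its ingredients: conjugating \<open>s\<close> by both sides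
  of \<open>h g_i = g_j' \<gamma>\<close> shows \<open>t_j' = t_j\<close>, so \<open>j' = j\<close>
  by injectivity of \<open>t\<close>, and then \<open>\<gamma>\<close> follows by
  cancellation.\<close>

lemma class_action_term:
  assumes h: "h \<in> carrier G" and i: "i \<in> {1..m}" and j: "j \<in> {1..m}" and ij: "t j = cjg h (t i)"
  shows "(THE y. \<exists>j\<in>{1..m}. \<exists>\<gamma>\<in>Z. h \<otimes>\<^bsub>G\<^esub> g i = g j \<otimes>\<^bsub>G\<^esub> \<gamma> \<and> y = class_elt V m j (\<rho> \<gamma> (x i))) =
    class_elt V m j (\<rho> (inv\<^bsub>G\<^esub> (g j) \<otimes>\<^bsub>G\<^esub> h \<otimes>\<^bsub>G\<^esub> g i) (x i))" (is "The ?P = ?y")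
proof (rule the_equality)
  have "h \<otimes>\<^bsub>G\<^esub> g i = g j \<otimes>\<^bsub>G\<^esub> (inv\<^bsub>G\<^esub> (g j) \<otimes>\<^bsub>G\<^esub> h \<otimes>\<^bsub>G\<^esub> g i)" using h i j by (simp add: G.m_assoc)
  then show "?P ?y" using transition_Z[OF h i j ij] j by blast
  fix y assume "?P y"
  then obtain j' \<gamma> where *: "j' \<in> {1..m}" "\<gamma> \<in> Z" "h \<otimes>\<^bsub>G\<^esub> g i = g j' \<otimes>\<^bsub>G\<^esub> \<gamma>" "y = class_elt V m j' (\<rho> \<gamma> (x i))" by blast
  have "t j = cjg (h \<otimes>\<^bsub>G\<^esub> g i) s" using ij t_eq[OF i] h i by (simp add: conj_conj)
  also have "\<dots> = cjg (g j') (cjg \<gamma> s)" using *(1-3) Z_closed by (simp add: conj_conj)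
  also have "\<dots> = t j'" using *(1,2) t_eq Z_iff by simp
  finally have "j' = j" using t_inj *(1) j by simp
  moreover have "\<gamma> = inv\<^bsub>G\<^esub> (g j) \<otimes>\<^bsub>G\<^esub> h \<otimes>\<^bsub>G\<^esub> g i"
    using *(1-3) Z_closed \<open>j' = j\<close> h i j by (simp add: G.m_assoc)
  ultimately show "y = ?y" using *(4) by simp
qed

text \<open>Conjugation by \<open>h\<close> permutes the class, so exactly one summand reaches
  component \<open>j\<close>, the one whose index is moved there. The componentwise formula replaces
  the definite description in later computations.\<close>

lemma
  assumes "h \<in> carrier G" "x \<in> carrier M"
  shows class_action_closed: "action M h x \<in> carrier M"
    and class_action_apply: "i \<in> {1..m} \<Longrightarrow> j \<in> {1..m} \<Longrightarrow> t j = cjg h (t i) \<Longrightarrow>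
      action M h x j = \<rho> (inv\<^bsub>G\<^esub> (g j) \<otimes>\<^bsub>G\<^esub> h \<otimes>\<^bsub>G\<^esub> g i) (x i)"
proof -
  let ?f = "\<lambda>i. THE y. \<exists>j\<in>{1..m}. \<exists>\<gamma>\<in>Z. h \<otimes>\<^bsub>G\<^esub> g i = g j \<otimes>\<^bsub>G\<^esub> \<gamma> \<and> y = class_elt V m j (\<rho> \<gamma> (x i))"
  have act: "action M h x = (\<Oplus>\<^bsub>class_sum_space V m\<^esub>i\<in>{1..m}. ?f i)"
    by (simp add: class_yd_module_def Let_def)
  have ex: "\<exists>j\<in>{1..m}. t j = cjg h (t i)" if "i \<in> {1..m}" for i
    using that t_C C_conj[OF assms(1)] t_idx idx_range by metis
  have f: "?f \<in> {1..m} \<rightarrow> carrier (class_sum_space V m)"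
  proof
    fix i assume i: "i \<in> {1..m}"
    obtain j where j: "j \<in> {1..m}" "t j = cjg h (t i)" using ex[OF i] by blast
    show "?f i \<in> carrier (class_sum_space V m)"
      unfolding class_action_term[OF assms(1) i j]
      using class_elt_closed[OF rho_closed[OF transition_Z[OF assms(1) i j] M_apply[OF assms(2) i]]] by simp
  qed
  show "action M h x \<in> carrier M"
    unfolding act using cvs_sum_closed[OF cvs_class_sum_space f] by simp
  fix i j assume i: "i \<in> {1..m}" and j: "j \<in> {1..m}" and ij: "t j = cjg h (t i)"
  have "action M h x j = (\<Oplus>\<^bsub>V\<^esub>k\<in>{1..m}. ?f k j)"
    unfolding act by (rule linear_map_sum[OF cvs_class_sum_space cvs_V class_eval_linear[OF j] _ f]) simp
  also have "\<dots> = ?f i j"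
  proof (rule cvs_sum_delta[OF cvs_V _ i])
    show "?f i j \<in> carrier V" using f i j by (auto simp: PiE_iff Pi_iff)
    fix k assume k: "k \<in> {1..m}" "k \<noteq> i"
    obtain l where l: "l \<in> {1..m}" "t l = cjg h (t k)" using ex[OF k(1)] by blast
    have "l \<noteq> j"
    proof
      assume "l = j"
      then have "cjg h (t k) = cjg h (t i)" using l(2) ij by simp
      then show False using conj_cancel[OF assms(1), of "t k" "t i"] k i t_inj by simp
    qed
    then show "?f k j = \<zero>\<^bsub>V\<^esub>" unfolding class_action_term[OF assms(1) k(1) l] using j by (simp add: class_elt_def)
  qed simp
  also have "\<dots> = \<rho> (inv\<^bsub>G\<^esub> (g j) \<otimes>\<^bsub>G\<^esub> h \<otimes>\<^bsub>G\<^esub> g i) (x i)"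
    unfolding class_action_term[OF assms(1) i j ij] using j by (simp add: class_elt_def)
  finally show "action M h x j = \<rho> (inv\<^bsub>G\<^esub> (g j) \<otimes>\<^bsub>G\<^esub> h \<otimes>\<^bsub>G\<^esub> g i) (x i)" .
qed

lemma class_coact_closed: "x \<in> carrier M \<Longrightarrow> coact M x h \<in> carrier M"
  using cvs_V by (auto simp: PiE_iff)

lemma class_action_linear:
  assumes h: "h \<in> carrier G"
  shows "linear_map M M (action M h)"
proof (rule linear_mapI)
  show "action M h x \<in> carrier M" if "x \<in> carrier M" for x
    by (rule class_action_closed[OF h that])
  show "action M h (x \<oplus>\<^bsub>M\<^esub> y) = action M h x \<oplus>\<^bsub>M\<^esub> action M h y"
    if xy: "x \<in> carrier M" "y \<in> carrier M" for x y
  proof (rule M_eqI)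
    have c: "x \<oplus>\<^bsub>M\<^esub> y \<in> carrier M" using xy cvs_class by (simp only: cvs_add_closed)
    show "action M h (x \<oplus>\<^bsub>M\<^esub> y) \<in> carrier M" by (rule class_action_closed[OF h c])
    show "action M h x \<oplus>\<^bsub>M\<^esub> action M h y \<in> carrier M"
      by (rule cvs_add_closed[OF cvs_class class_action_closed[OF h xy(1)] class_action_closed[OF h xy(2)]])
    fix j assume j: "j \<in> {1..m}"
    obtain i where i: "i \<in> {1..m}" "t j = cjg h (t i)" using conj_index[OF h j] .
    show "action M h (x \<oplus>\<^bsub>M\<^esub> y) j = (action M h x \<oplus>\<^bsub>M\<^esub> action M h y) j"
      using class_action_apply[OF h c i(1) j i(2)] class_action_apply[OF h xy(1) i(1) j i(2)]
        class_action_apply[OF h xy(2) i(1) j i(2)] i j xy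
        linear_mapD(2)[OF rho_linear[OF transition_Z[OF h i(1) j i(2)]] M_apply[OF xy(1) i(1)] M_apply[OF xy(2) i(1)]]
      by simp
  qed
  show "action M h (c \<odot>\<^bsub>M\<^esub> x) = c \<odot>\<^bsub>M\<^esub> action M h x" if x: "x \<in> carrier M" for c x
  proof (rule M_eqI)
    have c: "c \<odot>\<^bsub>M\<^esub> x \<in> carrier M" using x cvs_class by (simp only: cvs_smult_closed)
    show "action M h (c \<odot>\<^bsub>M\<^esub> x) \<in> carrier M" by (rule class_action_closed[OF h c])
    show "c \<odot>\<^bsub>M\<^esub> action M h x \<in> carrier M"
      by (rule cvs_smult_closed[OF cvs_class class_action_closed[OF h x]])
    fix j assume j: "j \<in> {1..m}"
    obtain i where i: "i \<in> {1..m}" "t j = cjg h (t i)" using conj_index[OF h j] .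
    show "action M h (c \<odot>\<^bsub>M\<^esub> x) j = (c \<odot>\<^bsub>M\<^esub> action M h x) j"
      using class_action_apply[OF h c i(1) j i(2)] class_action_apply[OF h x i(1) j i(2)] i j
        linear_mapD(3)[OF rho_linear[OF transition_Z[OF h i(1) j i(2)]] M_apply[OF x i(1)]]
      by simp
  qed
qed

lemma class_coact_linear: "linear_map M M (\<lambda>x. coact M x h)"
proof (rule linear_mapI)
  show "coact M x h \<in> carrier M" if "x \<in> carrier M" for x
    by (rule class_coact_closed[OF that])
qed (use cvs_V in \<open>auto simp: fun_eq_iff restrict_def\<close>)

text \<open>Multiplicativity is the cocycle identity
  \<open>(g_j^-1 a g_k) (g_k^-1 h g_i) = g_j^-1 (a h) g_i\<close>. The Yetter-Drinfeld condition
  holds because, for \<open>t_j = h t_i h^-1\<close>, the equations \<open>t_j = h a h^-1\<close>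
  and \<open>t_i = a\<close> are equivalent.\<close>

lemma yd_class: "yd G M"
proof (intro yd.intro linear_yd.intro yd_axioms.intro)
  show "group G" by (rule G.group_axioms)
  show "finite (carrier G)" by (rule finite_G)
  show "cvs M" by (rule cvs_class)
  show "linear_map M M (action M h)" if "h \<in> carrier G" for h by (rule class_action_linear[OF that])
  show "linear_map M M (\<lambda>x. coact M x h)" for h by (rule class_coact_linear)
  show "action M \<one>\<^bsub>G\<^esub> x = x" if x: "x \<in> carrier M" for x
  proof (rule M_eqI[OF class_action_closed[OF G.one_closed x] x])
    fix i assume i: "i \<in> {1..m}"
    then show "action M \<one>\<^bsub>G\<^esub> x i = x i"
      using class_action_apply[OF G.one_closed x i i] M_apply[OF x i] by simp
  qed
  fix a h x assume a: "a \<in> carrier G" and h: "h \<in> carrier G" and x: "x \<in> carrier M"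
  have ah: "a \<otimes>\<^bsub>G\<^esub> h \<in> carrier G" using a h by simp
  note hx = class_action_closed[OF h x]
  show "action M (a \<otimes>\<^bsub>G\<^esub> h) x = action M a (action M h x)"
  proof (rule M_eqI[OF class_action_closed[OF ah x] class_action_closed[OF a hx]])
    fix j assume j: "j \<in> {1..m}"
    obtain k where k: "k \<in> {1..m}" "t j = cjg a (t k)" using conj_index[OF a j] .
    obtain i where i: "i \<in> {1..m}" "t k = cjg h (t i)" using conj_index[OF h k(1)] .
    have ji: "t j = cjg (a \<otimes>\<^bsub>G\<^esub> h) (t i)" using k(2) i a h by (simp add: conj_conj)
    have "\<rho> (inv\<^bsub>G\<^esub> (g j) \<otimes>\<^bsub>G\<^esub> a \<otimes>\<^bsub>G\<^esub> g k) (\<rho> (inv\<^bsub>G\<^esub> (g k) \<otimes>\<^bsub>G\<^esub> h \<otimes>\<^bsub>G\<^esub> g i) (x i)) =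
        \<rho> ((inv\<^bsub>G\<^esub> (g j) \<otimes>\<^bsub>G\<^esub> a \<otimes>\<^bsub>G\<^esub> g k) \<otimes>\<^bsub>G\<^esub> (inv\<^bsub>G\<^esub> (g k) \<otimes>\<^bsub>G\<^esub> h \<otimes>\<^bsub>G\<^esub> g i)) (x i)"
      by (rule rho_mult[OF transition_Z[OF a k(1) j k(2)] transition_Z[OF h i(1) k(1) i(2)] M_apply[OF x i(1)]])
    moreover have "(inv\<^bsub>G\<^esub> (g j) \<otimes>\<^bsub>G\<^esub> a \<otimes>\<^bsub>G\<^esub> g k) \<otimes>\<^bsub>G\<^esub> (inv\<^bsub>G\<^esub> (g k) \<otimes>\<^bsub>G\<^esub> h \<otimes>\<^bsub>G\<^esub> g i) =
        inv\<^bsub>G\<^esub> (g j) \<otimes>\<^bsub>G\<^esub> (a \<otimes>\<^bsub>G\<^esub> h) \<otimes>\<^bsub>G\<^esub> g i"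
      using a h i(1) j k(1) by (simp add: G.m_assoc)
    ultimately show "action M (a \<otimes>\<^bsub>G\<^esub> h) x j = action M a (action M h x) j"
      using class_action_apply[OF ah x i(1) j ji] class_action_apply[OF a hx k(1) j k(2)]
        class_action_apply[OF h x i(1) k(1) i(2)] by simp
  qed
  show "coact M (action M h x) (h \<otimes>\<^bsub>G\<^esub> a \<otimes>\<^bsub>G\<^esub> inv\<^bsub>G\<^esub> h) = action M h (coact M x a)"
  proof (rule M_eqI[OF class_coact_closed[OF hx] class_action_closed[OF h class_coact_closed[OF x]]])
    fix j assume j: "j \<in> {1..m}"
    obtain i where i: "i \<in> {1..m}" "t j = cjg h (t i)" using conj_index[OF h j] .
    have "t j = cjg h a \<longleftrightarrow> t i = a" using i conj_cancel[OF h, of "t i" a] a by simp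
    then show "coact M (action M h x) (cjg h a) j = action M h (coact M x a) j"
      using class_action_apply[OF h x i(1) j i(2)] class_action_apply[OF h class_coact_closed[OF x] i(1) j i(2)]
        rho_zero[OF transition_Z[OF h i(1) j i(2)]] i(1) j by simp
  qed
qed

end

section \<open>The arrow Yetter-Drinfeld module\<close>

context class_rep_data
begin

text \<open>Inversion converts the left representation into a right one. The class representative at
  \<open>C\<close> is \<open>s\<close> itself, which makes the two centralizers equal; at the other
  classes some element is chosen, as \<open>is_rsr\<close> asks at every class. The one-element
  index set \<open>{0}\<close> gives bi-one.\<close>

definition left_rsr :: "nat \<Rightarrow> (nat \<Rightarrow> 'v) \<Rightarrow> ('g, nat, nat, 'v) rsr" where
  "left_rsr n b =
    \<lparr>ramif = (\<lambda>D. if D = C then n else 0),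
     class_rep = (\<lambda>D. if D = C then s else (SOME x. x \<in> D)),
     rep_index = (\<lambda>_. {0}),
     rep_space = (\<lambda>_ _. V),
     rep_act = (\<lambda>_ _ x h. \<rho> (inv\<^bsub>G\<^esub> h) x),
     basis_index = (\<lambda>_ _. {..<n}),
     basis_vec = (\<lambda>_ _. b)\<rparr>"

lemma conj_class_self: "x \<in> carrier G \<Longrightarrow> x \<in> conj_class G x"
  unfolding conj_class_def by (intro CollectI exI[of _ "\<one>\<^bsub>G\<^esub>"]) simp

lemma C_in_conj_classes: "C \<in> conj_classes G"
  by (simp add: conj_classes_def)

text \<open>\<open>arrow_basis_action\<close> recovers the class from its element \<open>x\<close>;
  this identifies that class with \<open>C\<close>.\<close>

lemma conj_class_eq:
  assumes "x \<in> C"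
  shows "conj_class G x = C"
proof -
  obtain a where a: "a \<in> carrier G" "x = cjg a s" using assms by (auto simp: conj_class_def)
  have s: "s = cjg (inv\<^bsub>G\<^esub> a) x" using conj_inv_eq[of a s x] a by simp
  have x: "x \<in> carrier G" using C_closed assms .
  have "cjg h x \<in> C" if "h \<in> carrier G" for h by (rule C_conj[OF that assms])
  moreover have "\<exists>k. cjg h s = cjg k x \<and> k \<in> carrier G" if h: "h \<in> carrier G" for h
  proof (intro exI conjI)
    show "cjg h s = cjg (h \<otimes>\<^bsub>G\<^esub> inv\<^bsub>G\<^esub> a) x"
      using conj_conj[of h "inv\<^bsub>G\<^esub> a" x] h a(1) x s by simp
  qed (use h a in simp)
  ultimately show ?thesis unfolding conj_class_def[of G x] by (auto simp: conj_class_def[of G s])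
qed

text \<open>Inversion is a bijection of the centralizer, so the left and the right action have the
  same invariant subspaces.\<close>

lemma irreducible_right: "irreducible_right_rep G Z V (\<lambda>x h. \<rho> (inv\<^bsub>G\<^esub> h) x)"
  unfolding irreducible_right_rep_def
proof (intro conjI ballI allI impI)
  show "module \<C> V" by (rule cvs_V)
  show "linear_map V V (\<rho> (inv\<^bsub>G\<^esub> h))" if "h \<in> Z" for h by (rule rho_linear[OF Z_inv[OF that]])
  show "\<rho> (inv\<^bsub>G\<^esub> \<one>\<^bsub>G\<^esub>) x = x" if "x \<in> carrier V" for x using that by simp
  show "\<rho> (inv\<^bsub>G\<^esub> (h \<otimes>\<^bsub>G\<^esub> h')) x = \<rho> (inv\<^bsub>G\<^esub> h') (\<rho> (inv\<^bsub>G\<^esub> h) x)"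
    if "h \<in> Z" "h' \<in> Z" "x \<in> carrier V" for h h' x
    using that rho_mult[OF Z_inv Z_inv] Z_closed by (simp add: G.inv_mult_group)
  show "carrier V \<noteq> {\<zero>\<^bsub>V\<^esub>}" by (rule V_nonzero)
  fix W assume W: "submodule W \<C> V \<and> (\<forall>h\<in>Z. \<forall>w\<in>W. \<rho> (inv\<^bsub>G\<^esub> h) w \<in> W)"
  show "W = {\<zero>\<^bsub>V\<^esub>} \<or> W = carrier V"
  proof (rule invariant_subspace)
    fix h w assume "h \<in> Z" "w \<in> W"
    then have "\<rho> (inv\<^bsub>G\<^esub> (inv\<^bsub>G\<^esub> h)) w \<in> W" using W Z_inv by blast
    then show "\<rho> h w \<in> W" using Z_closed[OF \<open>h \<in> Z\<close>] by simp
  qed (use W in blast)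
qed

text \<open>The coefficient of \<open>C\<close> is \<open>n\<close>, and it must be nonzero for
  \<open>C\<close> to be among the ramified classes.\<close>

lemma basis_nonempty:
  fixes n :: nat
  assumes "is_finite_basis V {..<n} b"
  shows "n \<noteq> 0"
proof
  assume "n = 0"
  then have "v = \<zero>\<^bsub>V\<^esub>" if "v \<in> carrier V" for v
    using finite_basis_coords[OF assms that] cvs_V by simp
  then show False using V_nonzero cvs_zero_closed[OF cvs_V] by blast
qed

lemma ramif_classes_left_rsr:
  assumes "is_finite_basis V {..<n} b"
  shows "ramif_classes G (left_rsr n b) = {C}"
  using basis_nonempty[OF assms] C_in_conj_classes by (auto simp: ramif_classes_def left_rsr_def)

lemma is_rsr_left_rsr:
  assumes "is_finite_basis V {..<n} b"
  shows "is_rsr G (left_rsr n b)" "bi_one G (left_rsr n b)"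
proof -
  have "class_rep (left_rsr n b) D \<in> D" if D: "D \<in> conj_classes G" for D
  proof -
    obtain x where x: "x \<in> carrier G" "D = conj_class G x" using D by (auto simp: conj_classes_def)
    have "(SOME x. x \<in> D) \<in> D" using conj_class_self[OF x(1)] x(2) by (metis someI)
    then show ?thesis using conj_class_self[OF s_closed] by (simp add: left_rsr_def)
  qed
  then show "is_rsr G (left_rsr n b)"
    unfolding is_rsr_def ramif_classes_left_rsr[OF assms]
    using irreducible_right assms by (simp add: left_rsr_def)
  show "bi_one G (left_rsr n b)"
    unfolding bi_one_def ramif_classes_left_rsr[OF assms] by (simp add: left_rsr_def)
qed

end

section \<open>Coset representatives and the action on the arrow module\<close>

locale arrow_data = class_rep_data +
  fixes n :: nat and b :: "nat \<Rightarrow> 'c" and \<Theta> :: "'a set \<Rightarrow> 't set" and c :: "'a set \<Rightarrow> 't \<Rightarrow> 'a"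
  assumes basis: "is_finite_basis V {..<n} b"
    and decomposition: "coset_decompositions G (left_rsr n b) \<Theta> c"
begin

abbreviation "R \<equiv> left_rsr n b"
abbreviation "F \<equiv> free_space (arrow_basis G R)"
abbreviation "N \<equiv> arrow_yd_module G R \<Theta> c"

lemma R_simps [simp]:
  "class_rep R C = s" "rep_index R D = {0}" "rep_space R D i = V" "rep_act R D i = (\<lambda>x h. \<rho> (inv\<^bsub>G\<^esub> h) x)"
  "basis_index R D i = {..<n}" "basis_vec R D i = b"
  by (simp_all add: left_rsr_def)

lemma arrow_basis_iff: "(x, i, j) \<in> arrow_basis G R \<longleftrightarrow> x \<in> C \<and> i = 0 \<and> j < n"
  unfolding arrow_basis_def ramif_classes_left_rsr[OF basis] by auto

lemma b_closed [simp]: "j < n \<Longrightarrow> b j \<in> carrier V"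
  using basis by (auto simp: is_finite_basis_def)

lemma c_closed: "\<theta> \<in> \<Theta> C \<Longrightarrow> c C \<theta> \<in> carrier G"
  and coset_bij: "bij_betw (\<lambda>\<theta>. Z #>\<^bsub>G\<^esub> c C \<theta>) (\<Theta> C) (rcosets\<^bsub>G\<^esub> Z)"
  using decomposition C_in_conj_classes unfolding coset_decompositions_def by fastforce+

lemma coset_inj:
  assumes "\<theta> \<in> \<Theta> C" "\<theta>' \<in> \<Theta> C" "z \<in> Z" "c C \<theta> = z \<otimes>\<^bsub>G\<^esub> c C \<theta>'"
  shows "\<theta> = \<theta>'"
proof -
  have "c C \<theta> \<in> Z #>\<^bsub>G\<^esub> c C \<theta>'" using assms(3,4) by (auto simp: r_coset_def)
  then have "Z #>\<^bsub>G\<^esub> c C \<theta>' = Z #>\<^bsub>G\<^esub> c C \<theta>"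
    by (rule G.repr_independence[OF _ c_closed[OF assms(2)] Z_subgroup])
  then show ?thesis using coset_bij assms(1,2) by (auto simp: bij_betw_def inj_on_def)
qed

lemma coset_ex:
  assumes "a \<in> carrier G"
  shows "\<exists>\<theta>\<in>\<Theta> C. \<exists>z\<in>Z. a = z \<otimes>\<^bsub>G\<^esub> c C \<theta>"
proof -
  have "Z \<subseteq> carrier G" using Z_closed by blast
  then have "Z #>\<^bsub>G\<^esub> a \<in> rcosets\<^bsub>G\<^esub> Z" using assms by (rule G.rcosetsI)
  then obtain \<theta> where \<theta>: "\<theta> \<in> \<Theta> C" "Z #>\<^bsub>G\<^esub> a = Z #>\<^bsub>G\<^esub> c C \<theta>"
    using coset_bij unfolding bij_betw_def by blast
  have "a \<in> Z #>\<^bsub>G\<^esub> a" by (rule G.rcos_self[OF assms Z_subgroup])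
  then have "a \<in> Z #>\<^bsub>G\<^esub> c C \<theta>" using \<theta>(2) by simp
  then show ?thesis using \<theta>(1) unfolding r_coset_def by blast
qed

text \<open>The choice made inside \<open>arrow_basis_action\<close>, named so that its existence
  and uniqueness can be stated.\<close>

definition "theta x = (THE \<theta>. \<theta> \<in> \<Theta> C \<and> x = inv\<^bsub>G\<^esub> (c C \<theta>) \<otimes>\<^bsub>G\<^esub> s \<otimes>\<^bsub>G\<^esub> c C \<theta>)"

definition "d x = c C (theta x)"

text \<open>Sending \<open>a\<close> to \<open>a^-1 s a\<close> identifies the right cosets of the
  centralizer with the class. If \<open>x = a s a^-1\<close>, the coset of \<open>a^-1\<close>
  supplies the index; two indices with the same \<open>x\<close> have representatives in one coset,
  hence are equal.\<close>

lemma theta: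
  assumes x: "x \<in> C"
  shows "theta x \<in> \<Theta> C \<and> x = inv\<^bsub>G\<^esub> (c C (theta x)) \<otimes>\<^bsub>G\<^esub> s \<otimes>\<^bsub>G\<^esub> c C (theta x)"
  unfolding theta_def
proof (rule theI')
  obtain a where a: "a \<in> carrier G" "x = cjg a s" using x by (auto simp: conj_class_def)
  obtain \<theta> z where \<theta>: "\<theta> \<in> \<Theta> C" "z \<in> Z" "inv\<^bsub>G\<^esub> a = z \<otimes>\<^bsub>G\<^esub> c C \<theta>" using coset_ex[of "inv\<^bsub>G\<^esub> a"] a by auto
  note c\<theta> = c_closed[OF \<theta>(1)] and zG = Z_closed[OF \<theta>(2)]
  have ai: "a = inv\<^bsub>G\<^esub> (c C \<theta>) \<otimes>\<^bsub>G\<^esub> inv\<^bsub>G\<^esub> z"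
    using \<theta>(3) a(1) c\<theta> zG by (metis G.inv_inv G.inv_mult_group)
  have "x = cjg (inv\<^bsub>G\<^esub> (c C \<theta>)) (cjg (inv\<^bsub>G\<^esub> z) s)"
    unfolding a(2) ai by (rule conj_conj[symmetric]) (use c\<theta> zG in simp_all)
  also have "cjg (inv\<^bsub>G\<^esub> z) s = s" using Z_inv[OF \<theta>(2)] Z_iff by blast
  finally have x\<theta>: "x = inv\<^bsub>G\<^esub> (c C \<theta>) \<otimes>\<^bsub>G\<^esub> s \<otimes>\<^bsub>G\<^esub> c C \<theta>" using c\<theta> by simp
  show "\<exists>!\<theta>. \<theta> \<in> \<Theta> C \<and> x = inv\<^bsub>G\<^esub> (c C \<theta>) \<otimes>\<^bsub>G\<^esub> s \<otimes>\<^bsub>G\<^esub> c C \<theta>"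
  proof (rule ex1I[of _ \<theta>])
    fix \<theta>' assume \<theta>': "\<theta>' \<in> \<Theta> C \<and> x = inv\<^bsub>G\<^esub> (c C \<theta>') \<otimes>\<^bsub>G\<^esub> s \<otimes>\<^bsub>G\<^esub> c C \<theta>'"
    have c\<theta>': "c C \<theta>' \<in> carrier G" using c_closed \<theta>' by blast
    let ?z = "c C \<theta>' \<otimes>\<^bsub>G\<^esub> inv\<^bsub>G\<^esub> (c C \<theta>)"
    have "cjg ?z s = cjg (c C \<theta>') (inv\<^bsub>G\<^esub> (c C \<theta>) \<otimes>\<^bsub>G\<^esub> s \<otimes>\<^bsub>G\<^esub> c C \<theta>)"
      using c\<theta> c\<theta>' by (simp add: G.m_assoc G.inv_mult_group)
    also have "\<dots> = cjg (c C \<theta>') (inv\<^bsub>G\<^esub> (c C \<theta>') \<otimes>\<^bsub>G\<^esub> s \<otimes>\<^bsub>G\<^esub> c C \<theta>')" using x\<theta> \<theta>' by simp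
    also have "\<dots> = s" using c\<theta>' by (simp add: G.m_assoc)
    finally have "?z \<in> Z" using c\<theta> c\<theta>' unfolding Z_iff by simp
    moreover have "c C \<theta>' = ?z \<otimes>\<^bsub>G\<^esub> c C \<theta>" using c\<theta> c\<theta>' by (simp add: G.m_assoc)
    ultimately show "\<theta>' = \<theta>" using coset_inj \<theta>(1) \<theta>' by blast
  qed (use \<theta>(1) x\<theta> in blast)
qed

lemma d_closed [simp]: "x \<in> C \<Longrightarrow> d x \<in> carrier G"
  unfolding d_def using theta c_closed by blast

lemma cjg_d:
  assumes x: "x \<in> C"
  shows "cjg (d x) x = s"
proof -
  have "cjg (d x) (inv\<^bsub>G\<^esub> (d x) \<otimes>\<^bsub>G\<^esub> s \<otimes>\<^bsub>G\<^esub> d x) = s" using d_closed[OF x] by (simp add: G.m_assoc)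
  then show ?thesis using theta[OF x] unfolding d_def by simp
qed

lemma cjg_inv_d:
  assumes x: "x \<in> C"
  shows "cjg (inv\<^bsub>G\<^esub> (d x)) s = x"
  using conj_inv_eq[of "d x" x s] cjg_d[OF x] d_closed[OF x] C_closed[OF x] by simp

text \<open>Both \<open>inv (d x)\<close> and \<open>g (idx x)\<close> conjugate \<open>s\<close> to
  \<open>x\<close>, so they differ by an element of the centralizer:
  \<open>inv (d x) = g (idx x) \<otimes> inv (kappa x)\<close>. This element translates between the
  two systems of representatives.\<close>

definition "kappa x = d x \<otimes>\<^bsub>G\<^esub> g (idx x)"

lemma kappa_Z:
  assumes x: "x \<in> C"
  shows "kappa x \<in> Z"
proof -
  note i = idx_range[OF x]
  have "cjg (kappa x) s = cjg (d x) (cjg (g (idx x)) s)"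
    unfolding kappa_def using d_closed[OF x] g_closed[OF i] by (simp add: conj_conj)
  also have "cjg (g (idx x)) s = x" using t_eq[OF i] t_idx[OF x] by simp
  finally show ?thesis using cjg_d[OF x] d_closed[OF x] g_closed[OF i] unfolding Z_iff kappa_def by simp
qed

text \<open>The equation \<open>d_x h^-1 = \<zeta> d_y\<close> with \<open>y = h x h^-1\<close>,
  solved for \<open>\<zeta>\<close>; that \<open>d_y\<close> is the representative occurring there
  is part of \<open>zeta_unique\<close>.\<close>

definition "zeta h x = d x \<otimes>\<^bsub>G\<^esub> inv\<^bsub>G\<^esub> h \<otimes>\<^bsub>G\<^esub> inv\<^bsub>G\<^esub> (d (cjg h x))"

lemma zeta_Z:
  assumes h: "h \<in> carrier G" and x: "x \<in> C"
  shows "zeta h x \<in> Z"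
proof -
  note y = C_conj[OF h x]
  note cl = d_closed[OF x] d_closed[OF y] C_closed[OF x] C_closed[OF y] h
  have "cjg (zeta h x) s = cjg (d x) (cjg (inv\<^bsub>G\<^esub> h) (cjg (inv\<^bsub>G\<^esub> (d (cjg h x))) s))"
    unfolding zeta_def using cl(1,2,5) by (simp add: G.m_assoc G.inv_mult_group)
  also have "cjg (inv\<^bsub>G\<^esub> (d (cjg h x))) s = cjg h x" by (rule cjg_inv_d[OF y])
  also have "cjg (inv\<^bsub>G\<^esub> h) (cjg h x) = x" using conj_inv_eq[of h x "cjg h x"] cl by simp
  also have "cjg (d x) x = s" by (rule cjg_d[OF x])
  finally show ?thesis using cl(1,2,5) unfolding Z_iff zeta_def by simp
qed

text \<open>Two factorisations of \<open>d_x h^-1\<close> put their representatives in the same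
  coset. The index is therefore the same, and the centralizing factor follows by
  cancellation.\<close>

lemma zeta_unique:
  assumes h: "h \<in> carrier G" and x: "x \<in> C"
  shows "(THE \<zeta>. \<zeta> \<in> Z \<and> (\<exists>\<theta>'\<in>\<Theta> C. d x \<otimes>\<^bsub>G\<^esub> inv\<^bsub>G\<^esub> h = \<zeta> \<otimes>\<^bsub>G\<^esub> c C \<theta>')) = zeta h x"
proof (rule the_equality)
  note y = C_conj[OF h x]
  note cl = d_closed[OF x] d_closed[OF y] h
  have eq: "d x \<otimes>\<^bsub>G\<^esub> inv\<^bsub>G\<^esub> h = zeta h x \<otimes>\<^bsub>G\<^esub> d (cjg h x)"
    unfolding zeta_def using cl by (simp add: G.m_assoc)
  then show "zeta h x \<in> Z \<and> (\<exists>\<theta>'\<in>\<Theta> C. d x \<otimes>\<^bsub>G\<^esub> inv\<^bsub>G\<^esub> h = zeta h x \<otimes>\<^bsub>G\<^esub> c C \<theta>')"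
    using zeta_Z[OF h x] theta[OF y] unfolding d_def[of "cjg h x"] by blast
  fix \<zeta> assume "\<zeta> \<in> Z \<and> (\<exists>\<theta>'\<in>\<Theta> C. d x \<otimes>\<^bsub>G\<^esub> inv\<^bsub>G\<^esub> h = \<zeta> \<otimes>\<^bsub>G\<^esub> c C \<theta>')"
  then obtain \<theta>' where \<zeta>: "\<zeta> \<in> Z" "\<theta>' \<in> \<Theta> C" "d x \<otimes>\<^bsub>G\<^esub> inv\<^bsub>G\<^esub> h = \<zeta> \<otimes>\<^bsub>G\<^esub> c C \<theta>'" by blast
  note zG = Z_closed[OF \<zeta>(1)] Z_closed[OF zeta_Z[OF h x]] and cG = c_closed[OF \<zeta>(2)]
  have "c C \<theta>' = inv\<^bsub>G\<^esub> \<zeta> \<otimes>\<^bsub>G\<^esub> (\<zeta> \<otimes>\<^bsub>G\<^esub> c C \<theta>')" using zG cG by simp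
  also have "\<dots> = inv\<^bsub>G\<^esub> \<zeta> \<otimes>\<^bsub>G\<^esub> (zeta h x \<otimes>\<^bsub>G\<^esub> d (cjg h x))" using \<zeta>(3) eq by simp
  also have "\<dots> = (inv\<^bsub>G\<^esub> \<zeta> \<otimes>\<^bsub>G\<^esub> zeta h x) \<otimes>\<^bsub>G\<^esub> d (cjg h x)" using zG cl by (simp add: G.m_assoc)
  finally have "\<theta>' = theta (cjg h x)"
    unfolding d_def using coset_inj[OF \<zeta>(2) _ Z_mult[OF Z_inv[OF \<zeta>(1)] zeta_Z[OF h x]]] theta[OF y] by blast
  then have "\<zeta> \<otimes>\<^bsub>G\<^esub> d (cjg h x) = zeta h x \<otimes>\<^bsub>G\<^esub> d (cjg h x)" using \<zeta>(3) eq by (simp add: d_def)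
  then show "\<zeta> = zeta h x" using zG cl by simp
qed

lemma arrow_basis_action_eq:
  assumes h: "h \<in> carrier G" and x: "x \<in> C"
  shows "arrow_basis_action G R \<Theta> c h (x, 0, j) =
    (\<Oplus>\<^bsub>F\<^esub>p\<in>{..<n}. coords V {..<n} b (\<rho> (inv\<^bsub>G\<^esub> (zeta h x)) (b j)) p \<odot>\<^bsub>F\<^esub> gen (cjg h x, 0, p))"
  using zeta_unique[OF h x]
  by (simp add: arrow_basis_action_def Let_def conj_class_eq[OF x] theta_def[symmetric] d_def[symmetric] del: free_space_simps)

lemma gen_basis: "x \<in> C \<Longrightarrow> j < n \<Longrightarrow> gen (x, 0, j) \<in> carrier F"
  by (rule gen_closed) (simp add: arrow_basis_iff)

lemma arrow_basis_action_closed: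
  assumes h: "h \<in> carrier G"
  shows "arrow_basis_action G R \<Theta> c h \<in> arrow_basis G R \<rightarrow> carrier F"
proof
  fix p assume "p \<in> arrow_basis G R"
  then obtain x j where p: "p = (x, 0, j)" "x \<in> C" "j < n" by (cases p) (auto simp: arrow_basis_iff)
  show "arrow_basis_action G R \<Theta> c h p \<in> carrier F"
    unfolding p(1) arrow_basis_action_eq[OF h p(2)]
    by (rule cvs_sum_closed[OF cvs_free_space])
      (intro funcsetI cvs_smult_closed[OF cvs_free_space] gen_basis C_conj h p(2), simp)
qed

lemma N_simps [simp]:
  "carrier N = carrier F" "add N = add F" "\<zero>\<^bsub>N\<^esub> = \<zero>\<^bsub>F\<^esub>" "module.smult N = module.smult F"
  "action N h = lin_ext F (arrow_basis_action G R \<Theta> c h)"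
  "coact N f a = lin_ext F (\<lambda>(x, i, j). if x = a then gen (x, i, j) else \<zero>\<^bsub>F\<^esub>) f"
  by (simp_all add: arrow_yd_module_def Let_def del: free_space_simps)

lemma cvs_N: "cvs N"
  by (rule cvs_cong[OF cvs_free_space]) (simp_all del: free_space_simps)

lemma linear_map_N: "linear_map N U f \<longleftrightarrow> linear_map F U f" "linear_map U N f' \<longleftrightarrow> linear_map U F f'"
  by (simp_all add: linear_map_def del: free_space_simps)

lemma coact_term_closed: "(\<lambda>(x, i, j). if x = a then gen (x, i, j) else \<zero>\<^bsub>F\<^esub>) \<in> arrow_basis G R \<rightarrow> carrier F"
  by (rule funcsetI) (auto simp del: free_space_simps)

lemma linear_yd_N: "linear_yd G N"
proof (intro linear_yd.intro)
  show "group G" by (rule G.group_axioms)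
  show "finite (carrier G)" by (rule finite_G)
  show "cvs N" by (rule cvs_N)
  show "linear_map N N (action N h)" if "h \<in> carrier G" for h
    unfolding linear_map_N N_simps by (rule lin_ext_linear[OF cvs_free_space arrow_basis_action_closed[OF that]])
  show "linear_map N N (\<lambda>x. coact N x h)" for h
    unfolding linear_map_N N_simps by (rule lin_ext_linear[OF cvs_free_space coact_term_closed])
qed

section \<open>The isomorphism from the arrow module to the class module\<close>

definition "psi_gen = (\<lambda>(x, i :: nat, j). class_elt V m (idx x) (\<rho> (inv\<^bsub>G\<^esub> (kappa x)) (b j)))"

definition "psi = lin_ext M psi_gen"

lemma psi_gen_closed: "psi_gen \<in> arrow_basis G R \<rightarrow> carrier M"
proof
  fix p assume "p \<in> arrow_basis G R"
  then obtain x j where p: "p = (x, 0, j)" "x \<in> C" "j < n" by (cases p) (auto simp: arrow_basis_iff)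
  show "psi_gen p \<in> carrier M"
    unfolding p(1) psi_gen_def prod.case
    by (rule class_elt_closed[OF rho_closed[OF Z_inv[OF kappa_Z[OF p(2)]] b_closed[OF p(3)]]])
qed

lemma psi_linear: "linear_map F M psi"
  unfolding psi_def by (rule lin_ext_linear[OF cvs_class psi_gen_closed])

lemma psi_basis: "x \<in> C \<Longrightarrow> j < n \<Longrightarrow> psi (gen (x, 0, j)) = class_elt V m (idx x) (\<rho> (inv\<^bsub>G\<^esub> (kappa x)) (b j))"
  unfolding psi_def using lin_ext_gen[OF cvs_class psi_gen_closed, of "(x, 0, j)"] by (simp add: arrow_basis_iff psi_gen_def)

lemma class_elt_linear:
  assumes "i \<in> {1..m}"
  shows "linear_map V M (class_elt V m i)"
proof (rule linear_mapI)
  show "class_elt V m i v \<in> carrier M" if "v \<in> carrier V" for v by (rule class_elt_closed[OF that])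
qed (use cvs_V in \<open>auto simp: class_elt_def fun_eq_iff restrict_def\<close>)

lemma class_action_class_elt:
  assumes h: "h \<in> carrier G" and i: "i \<in> {1..m}" and j: "j \<in> {1..m}" and ij: "t j = cjg h (t i)" and v: "v \<in> carrier V"
  shows "action M h (class_elt V m i v) = class_elt V m j (\<rho> (inv\<^bsub>G\<^esub> (g j) \<otimes>\<^bsub>G\<^esub> h \<otimes>\<^bsub>G\<^esub> g i) v)"
proof (rule M_eqI)
  note e = class_elt_closed[OF v]
  show "action M h (class_elt V m i v) \<in> carrier M" by (rule class_action_closed[OF h e])
  show "class_elt V m j (\<rho> (inv\<^bsub>G\<^esub> (g j) \<otimes>\<^bsub>G\<^esub> h \<otimes>\<^bsub>G\<^esub> g i) v) \<in> carrier M"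
    by (rule class_elt_closed[OF rho_closed[OF transition_Z[OF h i j ij] v]])
  fix k assume k: "k \<in> {1..m}"
  obtain l where l: "l \<in> {1..m}" "t k = cjg h (t l)" using conj_index[OF h k] .
  have kj: "k = j \<longleftrightarrow> l = i"
    using t_inj[OF k j] t_inj[OF l(1) i] conj_cancel[OF h t_closed[OF l(1)] t_closed[OF i]] l(2) ij by simp
  show "action M h (class_elt V m i v) k = class_elt V m j (\<rho> (inv\<^bsub>G\<^esub> (g j) \<otimes>\<^bsub>G\<^esub> h \<otimes>\<^bsub>G\<^esub> g i) v) k"
    unfolding class_action_apply[OF h e l(1) k l(2)]
    using kj k l(1) rho_zero[OF transition_Z[OF h l(1) k l(2)]] by (auto simp: class_elt_def)
qed

lemma psi_action:
  assumes h: "h \<in> carrier G" and f: "f \<in> carrier F"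
  shows "psi (action N h f) = action M h (psi f)"
proof (rule linear_map_eq_on_span[OF cvs_free_space cvs_class _ _ _ _ f[folded free_space_span]])
  have aN: "linear_map F F (action N h)"
    unfolding N_simps by (rule lin_ext_linear[OF cvs_free_space arrow_basis_action_closed[OF h]])
  show "linear_map F M (\<lambda>f. psi (action N h f))" by (rule linear_map_comp[OF psi_linear aN])
  show "linear_map F M (\<lambda>f. action M h (psi f))" by (rule linear_map_comp[OF class_action_linear[OF h] psi_linear])
  show "gen ` arrow_basis G R \<subseteq> carrier F" by (rule image_subsetI) (rule gen_closed)
  fix q assume "q \<in> gen ` arrow_basis G R"
  then obtain x j where q: "q = gen (x, 0, j)" and x: "x \<in> C" and j: "j < n"
    by (auto simp: arrow_basis_iff)
  let ?y = "cjg h x"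
  let ?v = "\<rho> (inv\<^bsub>G\<^esub> (zeta h x)) (b j)"
  let ?k = "coords V {..<n} b ?v"
  let ?L = "\<lambda>v. class_elt V m (idx ?y) (\<rho> (inv\<^bsub>G\<^esub> (kappa ?y)) v)"
  note y = C_conj[OF h x]
  note iZ = Z_inv[OF zeta_Z[OF h x]] Z_inv[OF kappa_Z[OF x]] Z_inv[OF kappa_Z[OF y]]
  have v: "?v \<in> carrier V" by (rule rho_closed[OF iZ(1) b_closed[OF j]])
  have L: "linear_map V M ?L" by (rule linear_map_comp[OF class_elt_linear[OF idx_range[OF y]] rho_linear[OF iZ(3)]])
  have "action N h q = (\<Oplus>\<^bsub>F\<^esub>p\<in>{..<n}. ?k p \<odot>\<^bsub>F\<^esub> gen (?y, 0, p))"
    unfolding q N_simps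
    using lin_ext_gen[OF cvs_free_space arrow_basis_action_closed[OF h], of "(x, 0, j)"] x j
      arrow_basis_action_eq[OF h x] by (simp add: arrow_basis_iff del: free_space_simps)
  then have "psi (action N h q) = psi (\<Oplus>\<^bsub>F\<^esub>p\<in>{..<n}. ?k p \<odot>\<^bsub>F\<^esub> gen (?y, 0, p))" by simp
  also have "\<dots> = (\<Oplus>\<^bsub>M\<^esub>p\<in>{..<n}. psi (?k p \<odot>\<^bsub>F\<^esub> gen (?y, 0, p)))"
    by (rule linear_map_sum[OF cvs_free_space cvs_class psi_linear finite_lessThan])
      (intro funcsetI cvs_smult_closed[OF cvs_free_space] gen_basis y, simp)
  also have "\<dots> = (\<Oplus>\<^bsub>M\<^esub>p\<in>{..<n}. ?L (?k p \<odot>\<^bsub>V\<^esub> b p))"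
  proof (rule cvs_sum_cong[OF cvs_class refl])
    show "(\<lambda>p. ?L (?k p \<odot>\<^bsub>V\<^esub> b p)) \<in> {..<n} \<rightarrow> carrier M"
      by (rule funcsetI, rule linear_mapD(1)[OF L]) (use cvs_V in simp)
    fix p assume p: "p \<in> {..<n}"
    have "psi (?k p \<odot>\<^bsub>F\<^esub> gen (?y, 0, p)) = ?k p \<odot>\<^bsub>M\<^esub> psi (gen (?y, 0, p))"
      by (rule linear_mapD(3)[OF psi_linear gen_basis[OF y]]) (use p in simp)
    also have "\<dots> = ?k p \<odot>\<^bsub>M\<^esub> ?L (b p)" using psi_basis[OF y] p by simp
    also have "\<dots> = ?L (?k p \<odot>\<^bsub>V\<^esub> b p)" by (rule linear_mapD(3)[OF L, symmetric]) (use p in simp)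
    finally show "psi (?k p \<odot>\<^bsub>F\<^esub> gen (?y, 0, p)) = ?L (?k p \<odot>\<^bsub>V\<^esub> b p)" .
  qed
  \<comment> \<open>The coordinates merely expand \<open>?v\<close> in the basis, and linearity of
    \<open>?L\<close> reassembles it.\<close>
  also have "\<dots> = ?L (\<Oplus>\<^bsub>V\<^esub>p\<in>{..<n}. ?k p \<odot>\<^bsub>V\<^esub> b p)"
    by (rule linear_map_sum[OF cvs_V cvs_class L finite_lessThan, symmetric]) (use cvs_V in auto)
  also have "\<dots> = ?L ?v" using finite_basis_coords[OF basis v] by simp
  also have "\<dots> = class_elt V m (idx ?y) (\<rho> (inv\<^bsub>G\<^esub> (kappa ?y) \<otimes>\<^bsub>G\<^esub> inv\<^bsub>G\<^esub> (zeta h x)) (b j))"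
    using rho_mult[OF iZ(3,1) b_closed[OF j]] by simp
  \<comment> \<open>This identity is the heart of equivariance. With \<open>y = h x h^-1\<close>
    both sides equal \<open>g_j^-1 h d_x^-1\<close>, where \<open>j\<close> is the index of
    \<open>y\<close>: the factors \<open>d_y\<close> cancel on the left, the factors
    \<open>g_i\<close> on the right.\<close>
  also have "inv\<^bsub>G\<^esub> (kappa ?y) \<otimes>\<^bsub>G\<^esub> inv\<^bsub>G\<^esub> (zeta h x) =
      (inv\<^bsub>G\<^esub> (g (idx ?y)) \<otimes>\<^bsub>G\<^esub> h \<otimes>\<^bsub>G\<^esub> g (idx x)) \<otimes>\<^bsub>G\<^esub> inv\<^bsub>G\<^esub> (kappa x)"
    unfolding kappa_def zeta_def
    using d_closed[OF x] d_closed[OF y] g_closed[OF idx_range[OF x]] g_closed[OF idx_range[OF y]] h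
    by (simp add: G.m_assoc G.inv_mult_group)
  also have "class_elt V m (idx ?y) (\<rho> (inv\<^bsub>G\<^esub> (g (idx ?y)) \<otimes>\<^bsub>G\<^esub> h \<otimes>\<^bsub>G\<^esub> g (idx x) \<otimes>\<^bsub>G\<^esub> inv\<^bsub>G\<^esub> (kappa x)) (b j)) =
      class_elt V m (idx ?y) (\<rho> (inv\<^bsub>G\<^esub> (g (idx ?y)) \<otimes>\<^bsub>G\<^esub> h \<otimes>\<^bsub>G\<^esub> g (idx x)) (\<rho> (inv\<^bsub>G\<^esub> (kappa x)) (b j)))"
    using rho_mult[OF transition_Z[OF h idx_range[OF x] idx_range[OF y]] iZ(2) b_closed[OF j]] t_idx[OF x] t_idx[OF y] by simp
  also have "\<dots> = action M h (psi q)"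
    unfolding q psi_basis[OF x j]
    by (rule class_action_class_elt[OF h idx_range[OF x] idx_range[OF y] _ rho_closed[OF iZ(2) b_closed[OF j]], symmetric])
      (simp only: t_idx[OF x] t_idx[OF y])
  finally show "psi (action N h q) = action M h (psi q)" .
qed

lemma psi_coact:
  assumes h: "h \<in> carrier G" and f: "f \<in> carrier F"
  shows "psi (coact N f h) = coact M (psi f) h"
proof (rule linear_map_eq_on_span[OF cvs_free_space cvs_class _ _ _ _ f[folded free_space_span]])
  have cN: "linear_map F F (\<lambda>f. coact N f h)"
    unfolding N_simps by (rule lin_ext_linear[OF cvs_free_space coact_term_closed])
  show "linear_map F M (\<lambda>f. psi (coact N f h))" by (rule linear_map_comp[OF psi_linear cN])
  show "linear_map F M (\<lambda>f. coact M (psi f) h)" by (rule linear_map_comp[OF class_coact_linear psi_linear])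
  show "gen ` arrow_basis G R \<subseteq> carrier F" by (rule image_subsetI) (rule gen_closed)
  fix q assume "q \<in> gen ` arrow_basis G R"
  then obtain x j where q: "q = gen (x, 0, j)" and x: "x \<in> C" and j: "j < n"
    by (auto simp: arrow_basis_iff)
  have "coact N q h = (if x = h then gen (x, 0, j) else \<zero>\<^bsub>F\<^esub>)"
    unfolding q N_simps
    using lin_ext_gen[OF cvs_free_space coact_term_closed, of "(x, 0, j)"] x j
    by (simp add: arrow_basis_iff del: free_space_simps)
  then have "psi (coact N q h) = (if x = h then psi q else \<zero>\<^bsub>M\<^esub>)"
    using linear_map_zero[OF cvs_free_space cvs_class psi_linear] q by simp
  also have "\<dots> = coact M (psi q) h"
    unfolding q psi_basis[OF x j] using t_idx[OF x] idx_range[OF x]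
    by (auto simp: class_elt_def fun_eq_iff)
  finally show "psi (coact N q h) = coact M (psi q) h" .
qed

lemma evaluation_linear: "linear_map F V (\<lambda>f. \<Oplus>\<^bsub>V\<^esub>j\<in>{..<n}. f (x, 0, j) \<odot>\<^bsub>V\<^esub> b j)"
proof (rule linear_map_sum_fun[OF cvs_free_space cvs_V finite_lessThan])
  fix j assume "j \<in> {..<n}"
  then show "linear_map F V (\<lambda>f. f (x, 0, j) \<odot>\<^bsub>V\<^esub> b j)"
    using cvs_V by (intro linear_mapI) (simp_all add: cvs_add_smult cvs_smult_smult)
qed

text \<open>Each component of the image is the vector with coefficients \<open>f (t i, 0, j)\<close>
  in the basis, moved by an invertible operator. Injectivity and surjectivity can both be read off
  from this.\<close>

lemma psi_apply:
  assumes f: "f \<in> carrier F" and i: "i \<in> {1..m}"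
  shows "psi f i = \<rho> (inv\<^bsub>G\<^esub> (kappa (t i))) (\<Oplus>\<^bsub>V\<^esub>j\<in>{..<n}. f (t i, 0, j) \<odot>\<^bsub>V\<^esub> b j)"
proof (rule linear_map_eq_on_span[OF cvs_free_space cvs_V _ _ _ _ f[folded free_space_span]])
  have kZ: "inv\<^bsub>G\<^esub> (kappa (t i)) \<in> Z" by (rule Z_inv[OF kappa_Z[OF t_C[OF i]]])
  have "linear_map M V (\<lambda>x. x i)" by (rule linear_mapI) (use i in auto)
  then show "linear_map F V (\<lambda>f. psi f i)" by (rule linear_map_comp[OF _ psi_linear])
  show "linear_map F V (\<lambda>f. \<rho> (inv\<^bsub>G\<^esub> (kappa (t i))) (\<Oplus>\<^bsub>V\<^esub>j\<in>{..<n}. f (t i, 0, j) \<odot>\<^bsub>V\<^esub> b j))"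
    by (rule linear_map_comp[OF rho_linear[OF kZ] evaluation_linear])
  show "gen ` arrow_basis G R \<subseteq> carrier F" by (rule image_subsetI) (rule gen_closed)
  fix q assume "q \<in> gen ` arrow_basis G R"
  then obtain x j where q: "q = gen (x, 0, j)" and x: "x \<in> C" and j: "j < n"
    by (auto simp: arrow_basis_iff)
  show "psi q i = \<rho> (inv\<^bsub>G\<^esub> (kappa (t i))) (\<Oplus>\<^bsub>V\<^esub>j\<in>{..<n}. q (t i, 0, j) \<odot>\<^bsub>V\<^esub> b j)"
  proof (cases "t i = x")
    case True
    then have "idx x = i" using idx_t[OF i] by simp
    moreover have "(\<Oplus>\<^bsub>V\<^esub>k\<in>{..<n}. q (t i, 0, k) \<odot>\<^bsub>V\<^esub> b k) = q (t i, 0, j) \<odot>\<^bsub>V\<^esub> b j"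
      by (rule cvs_sum_delta[OF cvs_V]) (use j cvs_V in \<open>auto simp: q gen_def\<close>)
    moreover have "q (t i, 0, j) = 1" by (simp add: q gen_def True)
    ultimately show ?thesis
      using psi_basis[OF x j] q i True b_closed[OF j] cvs_V by (simp add: class_elt_def)
  next
    case False
    then have "idx x \<noteq> i" using t_idx[OF x] by auto
    moreover have "(\<Oplus>\<^bsub>V\<^esub>k\<in>{..<n}. q (t i, 0, k) \<odot>\<^bsub>V\<^esub> b k) = \<zero>\<^bsub>V\<^esub>"
      by (rule cvs_sum_zero[OF cvs_V]) (use cvs_V False in \<open>auto simp: q gen_def\<close>)
    ultimately show ?thesis
      using psi_basis[OF x j] q i rho_zero[OF kZ] by (simp add: class_elt_def)
  qed
qed

lemma psi_bij: "bij_betw psi (carrier F) (carrier M)"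
  unfolding bij_betw_def
proof
  show "inj_on psi (carrier F)"
  proof (rule inj_onI)
    fix f f' assume f: "f \<in> carrier F" "f' \<in> carrier F" "psi f = psi f'"
    have eq: "f (x, 0, j) = f' (x, 0, j)" if x: "x \<in> C" and j: "j < n" for x j
    proof -
      note i = idx_range[OF x] and kZ = kappa_Z[OF x]
      have cl: "(\<Oplus>\<^bsub>V\<^esub>j\<in>{..<n}. f (x, 0, j) \<odot>\<^bsub>V\<^esub> b j) \<in> carrier V" for f :: "'a \<times> nat \<times> nat \<Rightarrow> complex"
        by (rule cvs_sum_closed[OF cvs_V]) (use cvs_V in auto)
      have eqk: "\<rho> (inv\<^bsub>G\<^esub> (kappa x)) (\<Oplus>\<^bsub>V\<^esub>j\<in>{..<n}. f (x, 0, j) \<odot>\<^bsub>V\<^esub> b j) = \<rho> (inv\<^bsub>G\<^esub> (kappa x)) (\<Oplus>\<^bsub>V\<^esub>j\<in>{..<n}. f' (x, 0, j) \<odot>\<^bsub>V\<^esub> b j)"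
        using fun_cong[OF f(3), of "idx x"] unfolding psi_apply[OF f(1) i] psi_apply[OF f(2) i] t_idx[OF x] .
      have "(\<Oplus>\<^bsub>V\<^esub>j\<in>{..<n}. f (x, 0, j) \<odot>\<^bsub>V\<^esub> b j) = (\<Oplus>\<^bsub>V\<^esub>j\<in>{..<n}. f' (x, 0, j) \<odot>\<^bsub>V\<^esub> b j)"
        using arg_cong[OF eqk, of "\<rho> (kappa x)"] unfolding rho_inv(1)[OF kZ cl[of f]] rho_inv(1)[OF kZ cl[of f']] .
      then show ?thesis
        using finite_basis_unique[OF basis cvs_V, of "\<lambda>j. f (x, 0, j)" "\<lambda>j. f' (x, 0, j)" j] j by simp
    qed
    show "f = f'"
    proof
      fix p
      show "f p = f' p"
      proof (cases "p \<in> arrow_basis G R")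
        case True
        then show ?thesis using eq by (cases p) (auto simp: arrow_basis_iff)
      next
        case False
        have z: "h p = 0" if h: "h \<in> carrier F" for h
          using subsetD[OF conjunct2[OF h[unfolded free_space_carrier]], of p] False by auto
        show ?thesis using z[OF f(1)] z[OF f(2)] by simp
      qed
    qed
  qed
  show "psi ` carrier F = carrier M"
  proof
    show "psi ` carrier F \<subseteq> carrier M" using linear_mapD(1)[OF psi_linear] by blast
    show "carrier M \<subseteq> psi ` carrier F"
    proof
      fix u assume u: "u \<in> carrier M"
      \<comment> \<open>The preimage undoes \<open>kappa\<close> on each component; the coordinates
        of the resulting vectors are its coefficients.\<close>
      define w where "w x = \<rho> (kappa x) (u (idx x))" for x
      define f where "f = (\<lambda>(x, i, j). if (x, i, j) \<in> arrow_basis G R then coords V {..<n} b (w x) j else 0)"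
      have w: "w x \<in> carrier V" if "x \<in> C" for x
        unfolding w_def by (rule rho_closed[OF kappa_Z[OF that] M_apply[OF u idx_range[OF that]]])
      have "finite C" by (rule finite_subset[OF _ finite_G]) (use C_closed in blast)
      moreover have "arrow_basis G R \<subseteq> C \<times> {0} \<times> {..<n}" using arrow_basis_iff by auto
      ultimately have fin: "finite (arrow_basis G R)" by (meson finite.emptyI finite.insertI finite_SigmaI finite_lessThan finite_subset)
      have supp: "{p. f p \<noteq> 0} \<subseteq> arrow_basis G R" by (auto simp: f_def split: if_splits)
      then have f: "f \<in> carrier F" unfolding free_space_carrier using finite_subset[OF _ fin] by blast
      have "psi f = u"
      proof (rule M_eqI[OF linear_mapD(1)[OF psi_linear f] u])
        fix i assume i: "i \<in> {1..m}"
        note ti = t_C[OF i]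
        have "(\<Oplus>\<^bsub>V\<^esub>j\<in>{..<n}. f (t i, 0, j) \<odot>\<^bsub>V\<^esub> b j) = (\<Oplus>\<^bsub>V\<^esub>j\<in>{..<n}. coords V {..<n} b (w (t i)) j \<odot>\<^bsub>V\<^esub> b j)"
          by (rule cvs_sum_cong[OF cvs_V refl]) (use cvs_V ti in \<open>auto simp: f_def arrow_basis_iff\<close>)
        also have "\<dots> = w (t i)" by (rule finite_basis_coords[OF basis w[OF ti], symmetric])
        finally show "psi f i = u i"
          unfolding psi_apply[OF f i] w_def using rho_inv(2)[OF kappa_Z[OF ti] M_apply[OF u i]] idx_t[OF i] by simp
      qed
      then show "u \<in> psi ` carrier F" using f by blast
    qed
  qed
qed

lemma psi_isomorphism: "yd_isomorphism G N M psi"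
proof (intro yd_isomorphism.intro yd_morphism.intro yd_morphism_axioms.intro yd_isomorphism_axioms.intro)
  show "linear_yd G N" by (rule linear_yd_N)
  show "linear_yd G M" using yd_class by (rule yd.axioms(1))
  show "linear_map N M psi" unfolding linear_map_N by (rule psi_linear)
  show "psi (action N h x) = action M h (psi x)" if "h \<in> carrier G" "x \<in> carrier N" for h x
    by (rule psi_action) (use that in \<open>simp_all only: N_simps\<close>)
  show "psi (coact N x h) = coact M (psi x) h" if "h \<in> carrier G" "x \<in> carrier N" for h x
    by (rule psi_coact) (use that in \<open>simp_all only: N_simps\<close>)
  show "bij_betw psi (carrier N) (carrier M)" unfolding N_simps by (rule psi_bij)
qed

text \<open>\<open>psi\<close> goes from the arrow module to the class module. Its inverse is used
  here because the class module, for which \<open>yd\<close> is verified, has to be the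
  source.\<close>

lemma nichols_isomorphic:
  "graded_braided_hopf_isomorphic G (class_nichols_algebra G V \<rho> s m t g) (arrow_nichols_algebra G R \<Theta> c)"
  unfolding class_nichols_algebra_def arrow_nichols_algebra_def
  by (rule nichols_algebra_isomorphic[OF yd_class yd_isomorphism.inverse_isomorphism[OF psi_isomorphism]])

end

text \<open>The ramification system depends only on a basis of \<open>V\<close> and is fixed before
  the coset decompositions. These enter through the representatives \<open>d\<close>, whose choice
  \<open>kappa\<close> compensates.\<close>

theorem lemma1p1:
  fixes G :: "('g, 'm) monoid_scheme" and s :: 'g
    and V :: "(complex, 'v) module" and \<rho> :: "'g \<Rightarrow> 'v \<Rightarrow> 'v"
    and m :: nat and t g :: "nat \<Rightarrow> 'g"
  assumes "group G" and "finite (carrier G)" and "s \<in> carrier G"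
    and "irreducible_left_rep G (centralizer G s) V \<rho>"
    and "class_numeration G s m t g"
  shows "\<exists>R :: ('g, nat, nat, 'v) rsr. is_rsr G R \<and> bi_one G R \<and>
           (\<forall>(\<Theta> :: 'g set \<Rightarrow> 't set) c. coset_decompositions G R \<Theta> c \<longrightarrow>
              graded_braided_hopf_isomorphic G
                (class_nichols_algebra G V \<rho> s m t g)
                (arrow_nichols_algebra G R \<Theta> c))"
proof -
  interpret class_rep_data G s V \<rho> m t g
    by (intro class_rep_data.intro class_rep_data_axioms.intro assms)
  obtain n and b :: "nat \<Rightarrow> 'v" where b: "is_finite_basis V {..<n} b" using basis_exists by blast
  show ?thesis
  proof (intro exI[of _ "left_rsr n b"] conjI allI impI is_rsr_left_rsr[OF b])
    fix \<Theta> :: "'g set \<Rightarrow> 't set" and c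
    assume "coset_decompositions G (left_rsr n b) \<Theta> c"
    then have "arrow_data G s V \<rho> m t g n b \<Theta> c"
      using b by (intro arrow_data.intro class_rep_data_axioms arrow_data_axioms.intro)
    then show "graded_braided_hopf_isomorphic G (class_nichols_algebra G V \<rho> s m t g)
        (arrow_nichols_algebra G (left_rsr n b) \<Theta> c)"
      by (rule arrow_data.nichols_isomorphic)
  qed
qed

end
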